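(* Let $q$ be a prime power and $b\geq 2$ an integer, and let $P_M(\infty,q^b)=\lim_{c\to\infty}\frac{|\mathrm{pcb}(c,q^b)|}{|\mathrm{M}(c,q^b)|}$. Then \[- \frac{4b}{e\,q^{b/2}} < P_M(\infty,q^b)- (1-e^{-1}) < \frac{1+b}{e\,q^{b}}+\frac{2(1+b)^2}{e\,q^{2b}},\] so that \[|P_M(\infty,q^b)- (1-e^{-1})| < 4e^{-1}\, b\,q^{-b/2}.\]
   Context: Let $F=\mathrm{GF}(q)$, $K=\mathrm{GF}(q^b)$, $n=bc$. $\mathrm{M}(c,q^b)$ is the algebra of $c\times c$ matrices over $K$, acting on the space $K^c$ of row vectors. Regarding $K^c$ as an $n$-dimensional $F$-vector space $V_F$, each $X\in \mathrm{M}(c,q^b)$ acts as an $F$-linear endomorphism of $V_F$, denoted $X_F$. For an endomorphism $Y$ of a finite-dimensional $F$-space $V$ and a monic irreducible $f\in F[t]$, the $f$-primary component is $V_f=\ker f(Y)^{\dim V}$. $Y$ is $f$-primary cyclic if $V_f\neq 0$ and the minimal polynomial of $Y|_{V_f}$ equals its characteristic polynomial. $\mathrm{pcb}(c,q^b)$ is the set of $X\in\mathrm{M}(c,q^b)$ such that $X_F$ is $f$-primary cyclic for some monic irreducible $f\in F[t]$ of degree $b$. The limit defining $P_M(\infty,q^b)$ exists and equals $1-\left(1-\frac{bq^{-b}}{(1-q^{-b})^2}\omega^b\right)^{N}$, where $\omega=\prod_{i\ge1}(1-q^{-bi})$ and $N$ is the number of monic irreducible polynomials of degree $b$ over $F$.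 *)

theory Defs
  imports
    "Jordan_Normal_Form.VS_Connect"
    "Jordan_Normal_Form.Char_Poly"
begin

hide_const (open) Multiset.mult Polynomial.smult

section \<open>Endomorphisms of a vector space over a field given as a type\<close>

text \<open>
  A vector space over the field type \<open>'f\<close> is a module record \<open>V\<close> with
  \<open>vectorspace class_ring V\<close>; an endomorphism of \<open>V\<close> is a function \<open>T\<close> of which only the
  values on \<open>carrier V\<close> matter.  The restriction of \<open>T\<close> to an invariant subspace \<open>W\<close> is \<open>T\<close>
  itself, considered on \<open>V\<lparr>carrier := W\<rparr>\<close>.
\<close>

definition poly_endo ::
  "('f::field, 'v, 'm) module_scheme \<Rightarrow> 'f poly \<Rightarrow> ('v \<Rightarrow> 'v) \<Rightarrow> 'v \<Rightarrow> 'v" where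
  "poly_endo V p T v = (\<Oplus>\<^bsub>V\<^esub>i\<in>{..degree p}. coeff p i \<odot>\<^bsub>V\<^esub> (T ^^ i) v)"

definition annihilates ::
  "('f::field, 'v, 'm) module_scheme \<Rightarrow> ('v \<Rightarrow> 'v) \<Rightarrow> 'f poly \<Rightarrow> bool" where
  "annihilates V T p \<longleftrightarrow> (\<forall>v\<in>carrier V. poly_endo V p T v = \<zero>\<^bsub>V\<^esub>)"

definition min_poly_endo ::
  "('f::field, 'v, 'm) module_scheme \<Rightarrow> ('v \<Rightarrow> 'v) \<Rightarrow> 'f poly" where
  "min_poly_endo V T =
     (THE m. monic m \<and> annihilates V T m \<and>
             (\<forall>p. p \<noteq> 0 \<longrightarrow> annihilates V T p \<longrightarrow> degree m \<le> degree p))"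

definition ordered_basis :: "('f::field, 'v, 'm) module_scheme \<Rightarrow> 'v list \<Rightarrow> bool" where
  "ordered_basis V bs \<longleftrightarrow> distinct bs \<and> vectorspace.basis class_ring V (set bs)"

definition represents ::
  "('f::field, 'v, 'm) module_scheme \<Rightarrow> ('v \<Rightarrow> 'v) \<Rightarrow> 'v list \<Rightarrow> 'f mat \<Rightarrow> bool" where
  "represents V T bs A \<longleftrightarrow>
     A \<in> carrier_mat (length bs) (length bs) \<and>
     (\<forall>j<length bs. T (bs ! j) = (\<Oplus>\<^bsub>V\<^esub>i\<in>{..<length bs}. A $$ (i, j) \<odot>\<^bsub>V\<^esub> bs ! i))"

text \<open>For finite-dimensional \<open>V\<close> exactly one \<open>p\<close> qualifies, since matrices representing \<open>T\<close> in
  two bases are similar.\<close>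

definition char_poly_endo ::
  "('f::field, 'v, 'm) module_scheme \<Rightarrow> ('v \<Rightarrow> 'v) \<Rightarrow> 'f poly" where
  "char_poly_endo V T =
     (SOME p. \<exists>bs A. ordered_basis V bs \<and> represents V T bs A \<and> p = char_poly A)"

definition primary_component ::
  "('f::field, 'v, 'm) module_scheme \<Rightarrow> ('v \<Rightarrow> 'v) \<Rightarrow> 'f poly \<Rightarrow> 'v set" where
  "primary_component V T f =
     {v \<in> carrier V. (poly_endo V f T ^^ vectorspace.dim class_ring V) v = \<zero>\<^bsub>V\<^esub>}"

definition primary_cyclic ::
  "('f::field, 'v, 'm) module_scheme \<Rightarrow> ('v \<Rightarrow> 'v) \<Rightarrow> 'f poly \<Rightarrow> bool" where
  "primary_cyclic V T f \<longleftrightarrow>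
     (let W = V\<lparr>carrier := primary_component V T f\<rparr> in
        carrier W \<noteq> {\<zero>\<^bsub>V\<^esub>} \<and> min_poly_endo W T = char_poly_endo W T)"


section \<open>Matrices over an extension field\<close>

text \<open>The extension \<open>K/F\<close> is given by a field homomorphism \<open>h\<close> from \<open>F\<close> (the type \<open>'f\<close>) to \<open>K\<close>
  (the type \<open>'k\<close>).  The following is \<open>K\<^sup>c\<close> with scalars restricted to \<open>F\<close>.\<close>

definition restricted_space ::
  "('f::field \<Rightarrow> 'k::field) \<Rightarrow> nat \<Rightarrow> ('f, 'k vec) module" where
  "restricted_space h c =
     \<lparr> carrier = carrier_vec c, mult = undefined, one = undefined,
       zero = 0\<^sub>v c, add = (+), smult = (\<lambda>a v. h a \<cdot>\<^sub>v v) \<rparr>"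

lemma vectorspace_restricted_space:
  assumes "field_hom h"
  shows "vectorspace class_ring (restricted_space h c)"
proof -
  interpret field_hom h by fact
  have ab: "abelian_group (restricted_space h c)"
    by (rule abelian_groupI)
      (auto simp: restricted_space_def comm_add_vec intro!: bexI[of _ "- _"] dest: uminus_l_inv_vec)
  interpret abelian_group "restricted_space h c" by (rule ab)
  show ?thesis
    by unfold_locales
      (auto simp: restricted_space_def hom_distribs add_smult_distrib_vec smult_add_distrib_vec
         smult_smult_assoc)
qed

definition row_action :: "'k::field mat \<Rightarrow> 'k vec \<Rightarrow> 'k vec" where
  "row_action X v = vec (dim_col X) (\<lambda>j. v \<bullet> col X j)"

definition pcb :: "('f::field \<Rightarrow> 'k::field) \<Rightarrow> nat \<Rightarrow> nat \<Rightarrow> 'k mat set" where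
  "pcb h b c =
     {X \<in> carrier_mat c c.
        \<exists>f :: 'f poly. monic f \<and> irreducible f \<and> degree f = b \<and>
          primary_cyclic (restricted_space h c) (row_action X) f}"

definition pcb_proportion :: "('f::field \<Rightarrow> 'k::field) \<Rightarrow> nat \<Rightarrow> nat \<Rightarrow> real" where
  "pcb_proportion h b c =
     real (card (pcb h b c)) / real (card (carrier_mat c c :: 'k mat set))"

definition P_M :: "('f::field \<Rightarrow> 'k::field) \<Rightarrow> nat \<Rightarrow> real" where
  "P_M h b = lim (\<lambda>c. pcb_proportion h b c)"

end

theory Submission
  imports Defs "HOL-Library.Cardinality" "HOL-Library.Multiset" "HOL-Number_Theory.Cong"
begin

text \<open>
  Put \<open>Q = q ^ b\<close>.  If a monic irreducible \<open>f\<close> of degree \<open>b\<close> over \<open>F\<close> has a root in \<open>K\<close>, its roots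
  form a Frobenius orbit of size \<open>b\<close>, and \<open>X\<^sub>F\<close> is \<open>f\<close>-primary cyclic iff \<open>ker (f(X))\<close> is a line over
  \<open>K\<close>, that is, iff exactly one of these roots is an eigenvalue of \<open>X\<close> and its eigenspace is a line;
  without a root in \<open>K\<close> neither can happen.

  The joint distribution of the eigenspaces is found by moments.  For pairwise different \<open>a\<^sub>1, \<dots>\<close> and
  multiplicities \<open>k\<^sub>1, \<dots>\<close> with sum \<open>k\<close>, the average over \<open>X\<close> of the number of families of \<open>k\<^sub>i\<close>
  independent eigenvectors to each \<open>a\<^sub>i\<close> is the product of \<open>1 - Q ^ i / Q ^ c\<close> over \<open>i < k\<close>: such a
  family is jointly independent, and prescribing its image leaves \<open>Q ^ (c (c - k))\<close> matrices.  The
  indicators of a trivial and of a one-dimensional eigenspace are rapidly convergent combinations of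
  these counts, so for \<open>c \<longlonglongrightarrow> \<infinity>\<close> the eigenspaces become independent, and the limit is
  \<open>1 - (1 - a) ^ N\<close> with \<open>N\<close> the number of orbits of size \<open>b\<close>.  As \<open>b N\<close> is close to \<open>Q\<close> and \<open>a\<close> is
  close to \<open>b / Q\<close>, this is close to \<open>1 - exp (-1)\<close>.
\<close>

section \<open>Eigenvectors of matrices over a finite field\<close>

text \<open>Moments are used because the condition that given vectors are eigenvectors to given
  eigenvalues is linear in the matrix and separate for each column, whereas the event that an
  eigenspace has a given dimension is not. A moment for \<open>k\<close> vectors differs from 1 by
  at most \<open>Q ^ k / Q ^ c\<close>. The coefficients that expand an indicator decay like the
  reciprocal of \<open>Q ^ (k * (k + 1) div 2)\<close>, which beats the factor \<open>Q ^ k\<close>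
  in this error; so the limit may be taken term by term for all eigenvalues at once.

  Dimensions enter mostly as cardinalities. In particular a minimal polynomial of degree
  \<open>d\<close> equals the characteristic polynomial iff the space has \<open>q ^ d\<close>
  elements, a condition that can be compared over F and over K.

  In the final estimate \<open>b N\<close> falls short of \<open>Q\<close> by at most
  \<open>2 * q ^ (b div 2)\<close>, a bound for the number of elements in shorter orbits. This
  relative loss is of larger order than the others and is the reason for the exponent
  \<open>b/2\<close> in the lower bound.\<close>

definition lin_closed :: "nat \<Rightarrow> 'k::field vec set \<Rightarrow> bool" where
  "lin_closed c U \<longleftrightarrow> U \<subseteq> carrier_vec c \<and> 0\<^sub>v c \<in> U \<and>
     (\<forall>u\<in>U. \<forall>v\<in>U. u + v \<in> U) \<and> (\<forall>a. \<forall>u\<in>U. a \<cdot>\<^sub>v u \<in> U)"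

lemma lin_closedD:
  assumes "lin_closed c U"
  shows "U \<subseteq> carrier_vec c" "u \<in> U \<Longrightarrow> u \<in> carrier_vec c" "0\<^sub>v c \<in> U"
    "u \<in> U \<Longrightarrow> v \<in> U \<Longrightarrow> u + v \<in> U" "u \<in> U \<Longrightarrow> a \<cdot>\<^sub>v u \<in> U"
  using assms unfolding lin_closed_def by auto

lemma lin_closed_minus:
  assumes "lin_closed c U" "u \<in> U" "v \<in> U"
  shows "u - v \<in> U"
proof -
  have "u + (-1) \<cdot>\<^sub>v v \<in> U"
    using assms by (intro lin_closedD(4,5)[OF assms(1)])
  moreover have "u + (-1) \<cdot>\<^sub>v v = u - v"
    using lin_closedD(2)[OF assms(1) assms(2)] lin_closedD(2)[OF assms(1) assms(3)]
    by (intro eq_vecI) auto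
  ultimately show ?thesis by simp
qed

lemma finite_carrier_vec [simp, intro]: "finite (carrier_vec c :: 'k::finite vec set)"
proof -
  have "carrier_vec c \<subseteq> vec_of_list ` {xs :: 'k list. set xs \<subseteq> UNIV \<and> length xs = c}"
  proof
    fix v :: "'k vec" assume "v \<in> carrier_vec c"
    then have "v = vec_of_list (list_of_vec v)" "length (list_of_vec v) = c"
      by (auto simp: vec_list)
    then show "v \<in> vec_of_list ` {xs :: 'k list. set xs \<subseteq> UNIV \<and> length xs = c}" by blast
  qed
  then show ?thesis
    by (rule finite_subset) (intro finite_imageI finite_lists_length_eq, simp)
qed

lemma card_carrier_vec: "card (carrier_vec c :: 'k::finite vec set) = CARD('k) ^ c"
proof -
  have "bij_betw list_of_vec (carrier_vec c :: 'k vec set) {xs. set xs \<subseteq> UNIV \<and> length xs = c}"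
    by (rule bij_betw_byWitness[where f' = vec_of_list])
      (auto simp: vec_list list_vec intro!: carrier_vecI)
  from bij_betw_same_card[OF this] show ?thesis
    using card_lists_length_eq[of "UNIV :: 'k set" c] by simp
qed

lemma finite_lin_closed: "lin_closed c (U :: 'k::{field,finite} vec set) \<Longrightarrow> finite U"
  by (rule finite_subset[OF lin_closedD(1)]) auto

lemma inj_on_line:
  assumes U: "lin_closed c U" and v: "v \<in> carrier_vec c" "v \<notin> U"
  shows "inj_on (\<lambda>(a, u). a \<cdot>\<^sub>v v + u) (UNIV \<times> U)"
proof (rule inj_onI, clarify)
  fix a u a' u'
  assume *: "u \<in> U" "u' \<in> U" "a \<cdot>\<^sub>v v + u = a' \<cdot>\<^sub>v v + u'"
  note uc = lin_closedD(2)[OF U *(1)] lin_closedD(2)[OF U *(2)]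
  have e: "a * v $ i + u $ i = a' * v $ i + u' $ i" if "i < c" for i
    using arg_cong[OF *(3), of "\<lambda>w. w $ i"] that uc v(1) by simp
  have "a = a'"
  proof (rule ccontr)
    assume "a \<noteq> a'"
    then have "v = inverse (a - a') \<cdot>\<^sub>v (u' - u)"
      using uc v(1) e by (intro eq_vecI) (auto simp: field_simps)
    also have "\<dots> \<in> U" using * U by (intro lin_closedD(5) lin_closed_minus)
    finally show False using v by simp
  qed
  moreover from this have "u = u'"
    using uc e by (intro eq_vecI) auto
  ultimately show "a = a' \<and> u = u'" by simp
qed

lemma card_line:
  fixes U :: "'k::{field,finite} vec set"
  assumes "lin_closed c U" "v \<in> carrier_vec c" "v \<notin> U"
  shows "card ((\<lambda>(a, u). a \<cdot>\<^sub>v v + u) ` (UNIV \<times> U)) = CARD('k) * card U"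
  using card_image[OF inj_on_line[OF assms]] by (simp add: card_cartesian_product)

text \<open>The head is the vector adjoined last, so induction on the list enlarges a closed set by
  one vector at a time, as in \<open>inj_on_line\<close>; independence follows the same
  recursion.\<close>

fun lin_span :: "nat \<Rightarrow> 'k::field vec list \<Rightarrow> 'k vec set" where
  "lin_span c [] = {0\<^sub>v c}"
| "lin_span c (v # vs) = (\<lambda>(a, u). a \<cdot>\<^sub>v v + u) ` (UNIV \<times> lin_span c vs)"

fun lin_indep :: "nat \<Rightarrow> 'k::field vec list \<Rightarrow> bool" where
  "lin_indep c [] \<longleftrightarrow> True"
| "lin_indep c (v # vs) \<longleftrightarrow> v \<notin> lin_span c vs \<and> lin_indep c vs"

lemma lin_span_ConsI: "u \<in> lin_span c vs \<Longrightarrow> a \<cdot>\<^sub>v v + u \<in> lin_span c (v # vs)"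
  by (simp add: image_eqI[where x = "(a, u)"])

lemma lin_closed_lin_span:
  "set vs \<subseteq> carrier_vec c \<Longrightarrow> lin_closed c (lin_span c vs)"
proof (induction vs)
  case Nil
  show ?case by (auto simp: lin_closed_def)
next
  case (Cons v vs)
  then have U: "lin_closed c (lin_span c vs)" and v: "v \<in> carrier_vec c" by auto
  note D = lin_closedD[OF U]
  show ?case unfolding lin_closed_def
  proof (intro conjI ballI allI)
    show "lin_span c (v # vs) \<subseteq> carrier_vec c" using D v by auto
    have "0\<^sub>v c = 0 \<cdot>\<^sub>v v + 0\<^sub>v c" using v by auto
    with D(3) show "0\<^sub>v c \<in> lin_span c (v # vs)" using lin_span_ConsI by metis
  next
    fix x y assume "x \<in> lin_span c (v # vs)" "y \<in> lin_span c (v # vs)"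
    then obtain a u a' u' where *: "x = a \<cdot>\<^sub>v v + u" "y = a' \<cdot>\<^sub>v v + u'"
      "u \<in> lin_span c vs" "u' \<in> lin_span c vs" by auto
    then have "x + y = (a + a') \<cdot>\<^sub>v v + (u + u')"
      using v D(2)[OF *(3)] D(2)[OF *(4)] by (intro eq_vecI) (auto simp: algebra_simps)
    moreover have "u + u' \<in> lin_span c vs" using * D by blast
    ultimately show "x + y \<in> lin_span c (v # vs)" using lin_span_ConsI by metis
  next
    fix r x assume "x \<in> lin_span c (v # vs)"
    then obtain a u where *: "x = a \<cdot>\<^sub>v v + u" "u \<in> lin_span c vs" by auto
    then have "r \<cdot>\<^sub>v x = (r * a) \<cdot>\<^sub>v v + r \<cdot>\<^sub>v u"
      using v D(2)[OF *(2)] by (intro eq_vecI) (auto simp: algebra_simps)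
    moreover have "r \<cdot>\<^sub>v u \<in> lin_span c vs" using * D by blast
    ultimately show "r \<cdot>\<^sub>v x \<in> lin_span c (v # vs)" using lin_span_ConsI by metis
  qed
qed

lemma lin_span_subset: "lin_closed c U \<Longrightarrow> set vs \<subseteq> U \<Longrightarrow> lin_span c vs \<subseteq> U"
proof (induction vs)
  case (Cons v vs)
  then have "lin_span c vs \<subseteq> U" "v \<in> U" by auto
  then show ?case using lin_closedD(4,5)[OF Cons.prems(1)] by (auto simp: subset_iff)
qed (simp add: lin_closedD)

lemma lin_span_Cons_mono:
  assumes "set vs \<subseteq> carrier_vec c" "v \<in> carrier_vec c"
  shows "lin_span c vs \<subseteq> lin_span c (v # vs)"
proof
  fix u assume u: "u \<in> lin_span c vs"
  then have "u = 0 \<cdot>\<^sub>v v + u"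
    using assms lin_closedD(2)[OF lin_closed_lin_span[OF assms(1)] u] by auto
  with u show "u \<in> lin_span c (v # vs)" using lin_span_ConsI by metis
qed

lemma set_subset_lin_span:
  "set vs \<subseteq> carrier_vec c \<Longrightarrow> set vs \<subseteq> lin_span c vs"
proof (induction vs)
  case (Cons v vs)
  have "v = 1 \<cdot>\<^sub>v v + 0\<^sub>v c" using Cons.prems by auto
  moreover have "0\<^sub>v c \<in> lin_span c vs"
    using Cons.prems by (intro lin_closedD(3) lin_closed_lin_span) auto
  ultimately have "v \<in> lin_span c (v # vs)" using lin_span_ConsI by metis
  moreover have "lin_span c vs \<subseteq> lin_span c (v # vs)"
    using Cons.prems by (intro lin_span_Cons_mono) auto
  ultimately show ?case using Cons by auto
qed simp

lemma card_lin_span: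
  fixes vs :: "'k::{field,finite} vec list"
  shows "set vs \<subseteq> carrier_vec c \<Longrightarrow> lin_indep c vs \<Longrightarrow> card (lin_span c vs) = CARD('k) ^ length vs"
proof (induction vs)
  case (Cons v vs)
  then have "card ((\<lambda>(a, u). a \<cdot>\<^sub>v v + u) ` (UNIV \<times> lin_span c vs)) = CARD('k) * card (lin_span c vs)"
    using lin_closed_lin_span[of vs c] by (intro card_line) auto
  then show ?case using Cons by simp
qed simp

text \<open>The double annihilator argument. If some \<open>x0\<close> kills \<open>vs\<close> but
  not \<open>v\<close>, subtracting a multiple of \<open>v\<close> from \<open>w\<close> makes it
  vanish at \<open>x0\<close>, and every annihilator of \<open>vs\<close> is a multiple of
  \<open>x0\<close> plus an annihilator of \<open>v # vs\<close>. If there is no such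
  \<open>x0\<close>, the hypothesis on \<open>w\<close> already holds for \<open>vs\<close>
  alone.\<close>

lemma mem_lin_span_if_annihilated:
  fixes w :: "'k::field vec"
  assumes "set vs \<subseteq> carrier_vec c" "w \<in> carrier_vec c"
    and "\<And>x. x \<in> carrier_vec c \<Longrightarrow> (\<forall>v\<in>set vs. v \<bullet> x = 0) \<Longrightarrow> w \<bullet> x = 0"
  shows "w \<in> lin_span c vs"
  using assms
proof (induction vs arbitrary: w)
  case Nil
  have "w $ i = 0" if "i < c" for i
    using Nil(3)[of "unit_vec c i"] Nil(2) that by simp
  then have "w = 0\<^sub>v c" using Nil(2) by (intro eq_vecI) auto
  then show ?case by simp
next
  case (Cons v vs)
  then have vs: "set vs \<subseteq> carrier_vec c" and v: "v \<in> carrier_vec c" by auto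
  show ?case
  proof (cases "\<exists>x0 \<in> carrier_vec c. (\<forall>u\<in>set vs. u \<bullet> x0 = 0) \<and> v \<bullet> x0 \<noteq> 0")
    case False
    then have "w \<in> lin_span c vs" using Cons.prems by (intro Cons.IH vs) auto
    then show ?thesis using lin_span_Cons_mono[OF vs v] by auto
  next
    case True
    then obtain x0 where x0: "x0 \<in> carrier_vec c" "\<forall>u\<in>set vs. u \<bullet> x0 = 0" "v \<bullet> x0 \<noteq> 0" by auto
    define a where "a = (w \<bullet> x0) / (v \<bullet> x0)"
    have "w - a \<cdot>\<^sub>v v \<in> lin_span c vs"
    proof (rule Cons.IH[OF vs])
      show "w - a \<cdot>\<^sub>v v \<in> carrier_vec c" using Cons.prems v by auto
      fix x assume x: "x \<in> carrier_vec c" "\<forall>u\<in>set vs. u \<bullet> x = 0"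
      define r where "r = (v \<bullet> x) / (v \<bullet> x0)"
      have y: "x - r \<cdot>\<^sub>v x0 \<in> carrier_vec c" using x x0 by auto
      have sp: "u \<bullet> (x - r \<cdot>\<^sub>v x0) = u \<bullet> x - r * (u \<bullet> x0)" if "u \<in> carrier_vec c" for u
        using that x(1) x0(1) by (simp add: scalar_prod_minus_distrib)
      have "w \<bullet> (x - r \<cdot>\<^sub>v x0) = 0"
      proof (intro Cons.prems(3)[OF y] ballI)
        fix u assume "u \<in> set (v # vs)"
        then show "u \<bullet> (x - r \<cdot>\<^sub>v x0) = 0"
          using vs v x(2) x0(2,3) by (subst sp) (auto simp: r_def)
      qed
      then have "w \<bullet> x = r * (w \<bullet> x0)" using sp Cons.prems(2) by auto
      also have "\<dots> = a * (v \<bullet> x)" by (simp add: r_def a_def)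
      finally show "(w - a \<cdot>\<^sub>v v) \<bullet> x = 0"
        using Cons.prems(2) v x(1) by (simp add: minus_scalar_prod_distrib)
    qed
    moreover have "w = a \<cdot>\<^sub>v v + (w - a \<cdot>\<^sub>v v)" using Cons.prems(2) v by auto
    ultimately show ?thesis using lin_span_ConsI by metis
  qed
qed

lemma exists_dual_vec:
  assumes "set (v # vs) \<subseteq> carrier_vec c" "v \<notin> lin_span c vs"
  obtains x where "x \<in> carrier_vec c" "\<forall>u\<in>set vs. u \<bullet> x = 0" "v \<bullet> x = (1::'k::field)"
proof -
  from assms obtain x where x: "x \<in> carrier_vec c" "\<forall>u\<in>set vs. u \<bullet> x = 0" "v \<bullet> x \<noteq> 0"
    using mem_lin_span_if_annihilated[of vs c v] by auto
  have "v \<bullet> (inverse (v \<bullet> x) \<cdot>\<^sub>v x) = 1" "\<forall>u\<in>set vs. u \<bullet> (inverse (v \<bullet> x) \<cdot>\<^sub>v x) = 0"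
    using x assms by (auto simp: scalar_prod_smult_right subset_iff)
  with x(1) show thesis by (intro that[of "inverse (v \<bullet> x) \<cdot>\<^sub>v x"]) auto
qed

definition lin_solutions :: "nat \<Rightarrow> 'k::field vec list \<Rightarrow> 'k list \<Rightarrow> 'k vec set" where
  "lin_solutions c vs ys = {x \<in> carrier_vec c. list_all2 (\<lambda>v y. v \<bullet> x = y) vs ys}"

text \<open>A dual vector \<open>x0\<close> of \<open>v\<close> shifts the value at \<open>v\<close>
  freely without disturbing the equations for \<open>vs\<close>, so each new equation divides the
  number of solutions by the field size. The product form keeps the exponent free of natural
  subtraction.\<close>

lemma card_lin_solutions:
  fixes vs :: "'k::{field,finite} vec list"
  assumes "set vs \<subseteq> carrier_vec c" "lin_indep c vs" "length ys = length vs"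
  shows "card (lin_solutions c vs ys) * CARD('k) ^ length vs = CARD('k) ^ c"
  using assms
proof (induction vs arbitrary: ys)
  case Nil
  then show ?case by (simp add: lin_solutions_def card_carrier_vec)
next
  case (Cons v vs)
  then obtain y ys' where ys: "ys = y # ys'" "length ys' = length vs" by (cases ys) auto
  obtain x0 where x0: "x0 \<in> carrier_vec c" "\<forall>u\<in>set vs. u \<bullet> x0 = 0" "v \<bullet> x0 = 1"
    using exists_dual_vec[of v vs c] Cons.prems by auto
  have v: "v \<in> carrier_vec c" and vs: "set vs \<subseteq> carrier_vec c" using Cons.prems by auto
  have shift: "u \<bullet> (a \<cdot>\<^sub>v x0 + x) = a * (u \<bullet> x0) + u \<bullet> x"
    if "u \<in> carrier_vec c" "x \<in> carrier_vec c" for u x a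
    using that x0(1) by (simp add: scalar_prod_add_distrib)
  have shift_all: "list_all2 (\<lambda>v y. v \<bullet> (a \<cdot>\<^sub>v x0 + x) = y) vs ys' \<longleftrightarrow>
      list_all2 (\<lambda>v y. v \<bullet> x = y) vs ys'" if "x \<in> carrier_vec c" for a x
    using vs x0(2) that by (intro list.rel_cong refl) (auto simp: shift subset_iff)
  have "bij_betw (\<lambda>(a, x). a \<cdot>\<^sub>v x0 + x) (UNIV \<times> lin_solutions c (v # vs) ys)
      (lin_solutions c vs ys')"
  proof (rule bij_betw_byWitness[where f' = "\<lambda>z. (v \<bullet> z - y, - (v \<bullet> z - y) \<cdot>\<^sub>v x0 + z)"])
    show "\<forall>p\<in>UNIV \<times> lin_solutions c (v # vs) ys.
        (\<lambda>z. (v \<bullet> z - y, - (v \<bullet> z - y) \<cdot>\<^sub>v x0 + z)) ((\<lambda>(a, x). a \<cdot>\<^sub>v x0 + x) p) = p"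
      using x0 v by (auto simp: lin_solutions_def ys shift intro!: eq_vecI)
    show "\<forall>z\<in>lin_solutions c vs ys'.
        (\<lambda>(a, x). a \<cdot>\<^sub>v x0 + x) (v \<bullet> z - y, - (v \<bullet> z - y) \<cdot>\<^sub>v x0 + z) = z"
      using x0 v by (auto simp: lin_solutions_def algebra_simps intro!: eq_vecI)
    show "(\<lambda>(a, x). a \<cdot>\<^sub>v x0 + x) ` (UNIV \<times> lin_solutions c (v # vs) ys) \<subseteq> lin_solutions c vs ys'"
      using x0 by (auto simp: lin_solutions_def ys shift_all)
    show "(\<lambda>z. (v \<bullet> z - y, - (v \<bullet> z - y) \<cdot>\<^sub>v x0 + z)) ` lin_solutions c vs ys'
        \<subseteq> UNIV \<times> lin_solutions c (v # vs) ys"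
      using x0 v by (auto simp: lin_solutions_def ys shift_all shift)
  qed
  from bij_betw_same_card[OF this]
  have "CARD('k) * card (lin_solutions c (v # vs) ys) = card (lin_solutions c vs ys')"
    by (simp add: card_cartesian_product)
  then have "card (lin_solutions c (v # vs) ys) * CARD('k) ^ length (v # vs) =
      card (lin_solutions c vs ys') * CARD('k) ^ length vs" by (simp add: algebra_simps)
  also have "\<dots> = CARD('k) ^ c" using Cons.IH[OF vs _ ys(2)] Cons.prems by simp
  finally show ?case .
qed

section \<open>Lists of independent eigenvectors and their average number\<close>

definition eig :: "nat \<Rightarrow> 'k::field mat \<Rightarrow> 'k \<Rightarrow> 'k vec set" where
  "eig c X a = {v \<in> carrier_vec c. row_action X v = a \<cdot>\<^sub>v v}"

text \<open>Repetitions in \<open>ts\<close> encode the multiplicities, so one list fixes both the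
  eigenvalues and how many vectors each receives.\<close>

definition eig_lists :: "nat \<Rightarrow> 'k::field mat \<Rightarrow> 'k list \<Rightarrow> 'k vec list set" where
  "eig_lists c X ts = {vs. lin_indep c vs \<and> list_all2 (\<lambda>v t. v \<in> eig c X t) vs ts}"

lemma row_action_carrier [simp]: "X \<in> carrier_mat c c \<Longrightarrow> row_action X v \<in> carrier_vec c"
  by (auto simp: row_action_def)

lemma row_action_add:
  assumes "X \<in> carrier_mat c c" "u \<in> carrier_vec c" "v \<in> carrier_vec c"
  shows "row_action X (u + v) = row_action X u + row_action X v"
  using assms by (intro eq_vecI) (auto simp: row_action_def intro!: add_scalar_prod_distrib)

lemma row_action_smult:
  assumes "X \<in> carrier_mat c c" "v \<in> carrier_vec c"
  shows "row_action X (a \<cdot>\<^sub>v v) = a \<cdot>\<^sub>v row_action X v"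
  using assms by (intro eq_vecI) (auto simp: row_action_def)

lemma lin_closed_eig:
  assumes X: "X \<in> carrier_mat c c"
  shows "lin_closed c (eig c X a)"
proof -
  have "0\<^sub>v c \<in> eig c X a"
    using X by (auto simp: eig_def row_action_def intro!: eq_vecI)
  moreover have "u + v \<in> eig c X a" if "u \<in> eig c X a" "v \<in> eig c X a" for u v
    using that row_action_add[OF X, of u v] smult_add_distrib_vec[of u c v a]
    by (auto simp: eig_def)
  moreover have "r \<cdot>\<^sub>v u \<in> eig c X a" if "u \<in> eig c X a" for r u
    using that row_action_smult[OF X, of u r] by (auto simp: eig_def smult_smult_assoc mult.commute)
  ultimately show ?thesis by (auto simp: lin_closed_def eig_def)
qed

lemma eig_lists_carrier: "vs \<in> eig_lists c X ts \<Longrightarrow> set vs \<subseteq> carrier_vec c"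
  by (auto simp: eig_lists_def eig_def list_all2_conv_all_nth in_set_conv_nth)

lemma eig_lists_length: "vs \<in> eig_lists c X ts \<Longrightarrow> length vs = length ts"
  by (auto simp: eig_lists_def dest: list_all2_lengthD)

lemma finite_eig_lists: "finite (eig_lists c X ts :: 'k::{field,finite} vec list set)"
proof (rule finite_subset)
  show "eig_lists c X ts \<subseteq> {vs. set vs \<subseteq> carrier_vec c \<and> length vs = length ts}"
    using eig_lists_carrier eig_lists_length by blast
qed (intro finite_lists_length_eq finite_carrier_vec)

text \<open>Eigenvectors to distinct eigenvalues are independent, so an eigenvector in the span of
  eigenvectors only involves those to the same eigenvalue.\<close>

lemma eig_Int_lin_span:
  assumes X: "X \<in> carrier_mat c c" and vs: "vs \<in> eig_lists c X ts"
  shows "card (eig c X a \<inter> lin_span c vs) = CARD('k::{field,finite}) ^ count_list ts (a::'k)"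
proof -
  define sel where "sel = (\<lambda>vs ts. map fst (filter (\<lambda>(v, t). t = a) (zip (vs :: 'k vec list) ts)))"
  \<comment> \<open>Strengthened for the induction: invariance of the span under \<open>X\<close> is
    what allows \<open>key\<close> below to compare components along \<open>v\<close> and in the
    span of the remaining vectors.\<close>
  have *: "eig c X a \<inter> lin_span c vs = lin_span c (sel vs ts) \<and> length (sel vs ts) = count_list ts a
      \<and> lin_indep c (sel vs ts) \<and> set (sel vs ts) \<subseteq> set vs \<and>
      (\<forall>u\<in>lin_span c vs. row_action X u \<in> lin_span c vs)"
    if "lin_indep c vs" "list_all2 (\<lambda>v t. v \<in> eig c X t) vs ts"
    using that(2,1)
  proof (induction rule: list_all2_induct)
    case Nil
    show ?case using lin_closedD(3)[OF lin_closed_eig[OF X]] X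
      by (auto simp: sel_def row_action_def intro!: eq_vecI)
  next
    case (Cons v vs t ts)
    have "set vs \<subseteq> carrier_vec c" using Cons(2)
      by (auto simp: eig_def list_all2_conv_all_nth in_set_conv_nth)
    note U = lin_closed_lin_span[OF this]
    have v: "v \<in> carrier_vec c" "row_action X v = t \<cdot>\<^sub>v v" using Cons by (auto simp: eig_def)
    from Cons have IH: "eig c X a \<inter> lin_span c vs = lin_span c (sel vs ts)"
      "length (sel vs ts) = count_list ts a" "lin_indep c (sel vs ts)" "set (sel vs ts) \<subseteq> set vs"
      "\<And>u. u \<in> lin_span c vs \<Longrightarrow> row_action X u \<in> lin_span c vs" and nv: "v \<notin> lin_span c vs" by auto
    have sp: "row_action X (r \<cdot>\<^sub>v v + u) = (r * t) \<cdot>\<^sub>v v + row_action X u" if "u \<in> lin_span c vs" for r u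
      using lin_closedD(2)[OF U that] v X
      by (simp add: row_action_add[of X c] row_action_smult[of X c] smult_smult_assoc)
    have inv: "row_action X u \<in> lin_span c (v # vs)" if u: "u \<in> lin_span c (v # vs)" for u
    proof -
      from u obtain r w where "u = r \<cdot>\<^sub>v v + w" "w \<in> lin_span c vs" by auto
      then show ?thesis using lin_span_ConsI[OF IH(5)] by (simp only: sp)
    qed
    have sel_sub: "lin_span c (sel vs ts) \<subseteq> lin_span c vs" using IH(1) by blast
    \<comment> \<open>Since \<open>v\<close> is outside the span, the eigenvector equation may be
      read separately for the coefficient of \<open>v\<close> and for the part in the span.\<close>
    have key: "r * t = a * r \<and> row_action X u = a \<cdot>\<^sub>v u"
      if u: "u \<in> lin_span c vs" and e: "r \<cdot>\<^sub>v v + u \<in> eig c X a" for r u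
    proof -
      have "(r * t) \<cdot>\<^sub>v v + row_action X u = a \<cdot>\<^sub>v (r \<cdot>\<^sub>v v + u)"
        using e sp[OF u, of r] by (simp add: eig_def)
      also have "\<dots> = (a * r) \<cdot>\<^sub>v v + a \<cdot>\<^sub>v u"
        using lin_closedD(2)[OF U u] v by (simp add: smult_add_distrib_vec smult_smult_assoc)
      finally have "(r * t, row_action X u) = (a * r, a \<cdot>\<^sub>v u)"
        using inj_onD[OF inj_on_line[OF U v(1) nv], of "(r * t, row_action X u)" "(a * r, a \<cdot>\<^sub>v u)"]
          IH(5)[OF u] lin_closedD(5)[OF U u] by simp
      then show ?thesis by simp
    qed
    show ?case
    proof (cases "t = a")
      case False
      have "eig c X a \<inter> lin_span c (v # vs) = eig c X a \<inter> lin_span c vs"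
      proof
        show "eig c X a \<inter> lin_span c (v # vs) \<subseteq> eig c X a \<inter> lin_span c vs"
        proof
          fix x assume x: "x \<in> eig c X a \<inter> lin_span c (v # vs)"
          then obtain r u where ru: "x = r \<cdot>\<^sub>v v + u" "u \<in> lin_span c vs" by auto
          with key[of u r] x False have "r = 0" by (auto simp: mult.commute)
          then have "x = u" using ru v lin_closedD(2)[OF U ru(2)] by auto
          with x ru show "x \<in> eig c X a \<inter> lin_span c vs" by auto
        qed
        show "eig c X a \<inter> lin_span c vs \<subseteq> eig c X a \<inter> lin_span c (v # vs)"
          using lin_span_Cons_mono[OF \<open>set vs \<subseteq> carrier_vec c\<close> v(1)] by auto
      qed
      moreover have "sel (v # vs) (t # ts) = sel vs ts" using False by (simp add: sel_def)
      ultimately show ?thesis using IH inv False by auto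
    next
      case True
      have sel: "sel (v # vs) (t # ts) = v # sel vs ts" using True by (simp add: sel_def)
      have ve: "v \<in> eig c X a" using Cons True by simp
      note E = lin_closedD[OF lin_closed_eig[OF X, of a]]
      have "eig c X a \<inter> lin_span c (v # vs) = lin_span c (v # sel vs ts)"
      proof
        show "eig c X a \<inter> lin_span c (v # vs) \<subseteq> lin_span c (v # sel vs ts)"
        proof
          fix x assume x: "x \<in> eig c X a \<inter> lin_span c (v # vs)"
          then obtain r u where ru: "x = r \<cdot>\<^sub>v v + u" "u \<in> lin_span c vs" by auto
          with key[of u r] x have "u \<in> eig c X a \<inter> lin_span c vs"
            using lin_closedD(2)[OF U] by (auto simp: eig_def)
          then show "x \<in> lin_span c (v # sel vs ts)" using ru(1) IH(1) lin_span_ConsI by metis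
        qed
        show "lin_span c (v # sel vs ts) \<subseteq> eig c X a \<inter> lin_span c (v # vs)"
        proof
          fix x assume "x \<in> lin_span c (v # sel vs ts)"
          then obtain r u where ru: "x = r \<cdot>\<^sub>v v + u" "u \<in> lin_span c (sel vs ts)" by auto
          then have u: "u \<in> eig c X a" "u \<in> lin_span c vs" using IH(1) by auto
          have "r \<cdot>\<^sub>v v + u \<in> eig c X a" by (intro E(4) E(5) ve u(1))
          then show "x \<in> eig c X a \<inter> lin_span c (v # vs)"
            using ru(1) lin_span_ConsI[OF u(2)] by simp
        qed
      qed
      then show ?thesis unfolding sel using IH inv True nv sel_sub by auto
    qed
  qed
  from * vs have "eig c X a \<inter> lin_span c vs = lin_span c (sel vs ts)" "length (sel vs ts) = count_list ts a"
     "lin_indep c (sel vs ts)" "set (sel vs ts) \<subseteq> carrier_vec c"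
    using eig_lists_carrier[OF vs] by (auto simp: eig_lists_def)
  then show ?thesis by (simp add: card_lin_span)
qed

text \<open>The q-analogue of the falling factorial: at \<open>z = Q ^ n\<close> it is the number of
  independent lists of length \<open>k\<close> in a space of dimension \<open>n\<close> over a field
  with \<open>Q\<close> elements.\<close>

definition qfall :: "real \<Rightarrow> nat \<Rightarrow> real \<Rightarrow> real" where
  "qfall Q k z = (\<Prod>i<k. z - Q ^ i)"

lemma qfall_0 [simp]: "qfall Q 0 z = 1"
  and qfall_Suc: "qfall Q (Suc k) z = qfall Q k z * (z - Q ^ k)"
  by (simp_all add: qfall_def)

lemma eig_lists_Cons:
  "eig_lists c X (t # ts) = (\<lambda>(vs, v). v # vs) ` (SIGMA vs : eig_lists c X ts. eig c X t - lin_span c vs)"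
  by (auto simp: eig_lists_def list_all2_Cons2 image_iff)

text \<open>A new eigenvector to \<open>t\<close> may be anything in its eigenspace outside the span
  of the vectors chosen so far, and by \<open>eig_Int_lin_span\<close> the number of excluded
  vectors depends only on how often \<open>t\<close> has occurred. Hence the count factors over the
  eigenvalues.\<close>

lemma card_eig_lists:
  fixes X :: "'k::{field,finite} mat"
  assumes X: "X \<in> carrier_mat c c"
  shows "real (card (eig_lists c X ts)) =
    (\<Prod>a\<in>UNIV. qfall (CARD('k)) (count_list ts a) (card (eig c X a)))"
proof (induction ts)
  case Nil
  have "eig_lists c X [] = {[]}" by (auto simp: eig_lists_def)
  then show ?case by simp
next
  case (Cons t ts)
  have fin: "finite (eig c X t)" by (rule finite_lin_closed[OF lin_closed_eig[OF X]])
  have "real (card (eig_lists c X (t # ts))) =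
      (\<Sum>vs\<in>eig_lists c X ts. real (card (eig c X t - lin_span c vs)))"
    unfolding eig_lists_Cons
    by (subst card_image) (auto simp: inj_on_def card_SigmaI finite_eig_lists fin)
  also have "\<dots> = (\<Sum>vs\<in>eig_lists c X ts. real (card (eig c X t)) - real CARD('k) ^ count_list ts t)"
  proof (rule sum.cong[OF refl])
    fix vs assume vs: "vs \<in> eig_lists c X ts"
    have "card (eig c X t - lin_span c vs) = card (eig c X t) - card (eig c X t \<inter> lin_span c vs)"
      using fin by (metis card_Diff_subset_Int finite_Int)
    also have "real \<dots> = real (card (eig c X t)) - real (card (eig c X t \<inter> lin_span c vs))"
      by (intro of_nat_diff card_mono fin) auto
    finally show "real (card (eig c X t - lin_span c vs)) =
        real (card (eig c X t)) - real CARD('k) ^ count_list ts t"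
      using eig_Int_lin_span[OF X vs, of t] by simp
  qed
  also have "\<dots> = real (card (eig_lists c X ts)) * (card (eig c X t) - real CARD('k) ^ count_list ts t)"
    by simp
  also have "\<dots> = (\<Prod>a\<in>UNIV. qfall (CARD('k)) (count_list ts a) (card (eig c X a)) *
       (if a = t then card (eig c X t) - real CARD('k) ^ count_list ts t else 1))"
    unfolding Cons.IH prod.distrib by simp
  also have "\<dots> = (\<Prod>a\<in>UNIV. qfall (CARD('k)) (count_list (t # ts) a) (card (eig c X a)))"
    by (intro prod.cong) (auto simp: qfall_Suc)
  finally show ?case .
qed

lemma bij_betw_mat_cols:
  "bij_betw (\<lambda>X. \<lambda>j\<in>{..<c}. col X j) (carrier_mat c c :: 'a mat set) ({..<c} \<rightarrow>\<^sub>E carrier_vec c)"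
proof (rule bij_betw_byWitness[where f' = "\<lambda>f. mat c c (\<lambda>(i, j). f j $ i)"])
  show "\<forall>X\<in>carrier_mat c c. mat c c (\<lambda>(i, j). (\<lambda>j\<in>{..<c}. col X j) j $ i) = X"
    by (intro ballI eq_matI) auto
  show "\<forall>f\<in>{..<c} \<rightarrow>\<^sub>E carrier_vec c. (\<lambda>j\<in>{..<c}. col (mat c c (\<lambda>(i, j). f j $ i)) j) = (f :: nat \<Rightarrow> 'a vec)"
  proof (intro ballI ext)
    fix f :: "nat \<Rightarrow> 'a vec" and j assume f: "f \<in> {..<c} \<rightarrow>\<^sub>E carrier_vec c"
    show "(\<lambda>j\<in>{..<c}. col (mat c c (\<lambda>(i, j). f j $ i)) j) j = f j"
    proof (cases "j < c")
      case True
      then have "dim_vec (f j) = c" using PiE_mem[OF f, of j] by simp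
      then show ?thesis using True by (intro eq_vecI) simp_all
    next
      case False
      then show ?thesis using PiE_arb[OF f, of j] by simp
    qed
  qed
qed (simp_all add: image_subset_iff)

lemma finite_carrier_mat: "finite (carrier_mat c c :: 'k::finite mat set)"
  using bij_betw_finite[OF bij_betw_mat_cols[where ?'a = 'k and c = c]]
  by (simp add: finite_PiE)

lemma card_carrier_mat: "card (carrier_mat c c :: 'k::finite mat set) = CARD('k) ^ (c * c)"
  using bij_betw_same_card[OF bij_betw_mat_cols[where ?'a = 'k and c = c]]
  by (simp add: card_PiE card_carrier_vec power_mult)

text \<open>Entry \<open>j\<close> of \<open>row_action X v\<close> involves only column
  \<open>j\<close> of \<open>X\<close>, so the eigenvector equations split into \<open>c\<close>
  separate linear systems, one per column.\<close>

lemma card_mats_with_eigenvectors: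
  fixes vs :: "'k::{field,finite} vec list"
  assumes vs: "set vs \<subseteq> carrier_vec c" "lin_indep c vs" "length ts = length vs"
  shows "card {X \<in> carrier_mat c c. vs \<in> eig_lists c X ts} * CARD('k) ^ (c * length vs) = CARD('k) ^ (c * c)"
proof -
  define ys where "ys j = map2 (\<lambda>v t. t * v $ j) vs ts" for j
  let ?\<phi> = "\<lambda>X. \<lambda>j\<in>{..<c}. col X j"
  have char: "vs \<in> eig_lists c X ts \<longleftrightarrow> (\<forall>j<c. col X j \<in> lin_solutions c vs (ys j))"
    if X: "X \<in> carrier_mat c c" for X
  proof -
    have "vs \<in> eig_lists c X ts \<longleftrightarrow>
        (\<forall>i<length vs. \<forall>j<c. vs ! i \<bullet> col X j = ts ! i * vs ! i $ j)"
    proof -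
      have "vs ! i \<in> eig c X (ts ! i) \<longleftrightarrow> (\<forall>j<c. vs ! i \<bullet> col X j = ts ! i * vs ! i $ j)"
        if "i < length vs" for i
      proof -
        have "vs ! i \<in> carrier_vec c" using vs(1) that by auto
        then show ?thesis using X by (auto simp: eig_def row_action_def vec_eq_iff)
      qed
      then show ?thesis using vs(2,3) by (auto simp: eig_lists_def list_all2_conv_all_nth)
    qed
    also have "\<dots> \<longleftrightarrow> (\<forall>j<c. col X j \<in> lin_solutions c vs (ys j))"
      using X vs(3) by (auto simp: lin_solutions_def list_all2_conv_all_nth ys_def)
    finally show ?thesis .
  qed
  have "bij_betw ?\<phi> {X \<in> carrier_mat c c. vs \<in> eig_lists c X ts}
      (\<Pi>\<^sub>E j\<in>{..<c}. lin_solutions c vs (ys j))"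
  proof -
    have "?\<phi> ` {X \<in> carrier_mat c c. vs \<in> eig_lists c X ts} =
        {f \<in> {..<c} \<rightarrow>\<^sub>E carrier_vec c. \<forall>j<c. f j \<in> lin_solutions c vs (ys j)}"
      (is "?L = ?R")
    proof
      show "?L \<subseteq> ?R"
      proof (rule image_subsetI)
        fix X assume "X \<in> {X \<in> carrier_mat c c. vs \<in> eig_lists c X ts}"
        then have "X \<in> carrier_mat c c" "\<forall>j<c. col X j \<in> lin_solutions c vs (ys j)"
          using char[of X] by blast+
        then show "?\<phi> X \<in> ?R" by simp
      qed
      show "?R \<subseteq> ?L"
      proof
        fix f assume f: "f \<in> ?R"
        then have "f \<in> ?\<phi> ` carrier_mat c c"
          by (simp add: bij_betw_imp_surj_on[OF bij_betw_mat_cols])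
        then obtain X where X: "X \<in> carrier_mat c c" "f = ?\<phi> X" by blast
        with f char show "f \<in> ?L" by simp
      qed
    qed
    also have "\<dots> = (\<Pi>\<^sub>E j\<in>{..<c}. lin_solutions c vs (ys j))"
      by (simp add: PiE_iff lin_solutions_def set_eq_iff) blast
    finally show ?thesis
      using bij_betw_imp_inj_on[OF bij_betw_mat_cols[where ?'a = 'k and c = c]]
      by (intro bij_betw_imageI) (auto intro: inj_on_subset)
  qed
  from bij_betw_same_card[OF this]
  have "card {X \<in> carrier_mat c c. vs \<in> eig_lists c X ts} = (\<Prod>j<c. card (lin_solutions c vs (ys j)))"
    by (simp add: card_PiE)
  also have "\<dots> * CARD('k) ^ (c * length vs) = (\<Prod>j<c. card (lin_solutions c vs (ys j)) * CARD('k) ^ length vs)"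
    by (simp add: prod.distrib power_mult mult.commute[of c])
  also have "\<dots> = (\<Prod>j<c. CARD('k) ^ c)"
    by (intro prod.cong card_lin_solutions vs) (simp_all add: ys_def vs(3))
  finally show ?thesis by (simp add: power_mult)
qed

text \<open>Independent lists are the eigenvector lists of the identity matrix to the eigenvalue 1.\<close>

lemma card_indep_lists:
  "real (card {vs :: 'k::{field,finite} vec list. set vs \<subseteq> carrier_vec c \<and> lin_indep c vs \<and> length vs = k}) =
    qfall (CARD('k)) k (CARD('k) ^ c)"
proof -
  have e: "eig c (1\<^sub>m c) (1 :: 'k) = carrier_vec c"
    by (auto simp: eig_def row_action_def intro!: eq_vecI)
  have "{vs :: 'k vec list. set vs \<subseteq> carrier_vec c \<and> lin_indep c vs \<and> length vs = k} =
      eig_lists c (1\<^sub>m c) (replicate k 1)"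
    by (auto simp: eig_lists_def list_all2_conv_all_nth e set_conv_nth)
  moreover have "count_list (replicate k (1::'k)) a = (if a = 1 then k else 0)" for a
    by (induction k) auto
  ultimately show ?thesis
    by (simp add: card_eig_lists card_carrier_vec e if_distrib[of "\<lambda>k. qfall _ k _"] prod.delta' cong: if_cong)
qed

text \<open>Double counting of pairs of a matrix and a list. The result sees \<open>ts\<close> only
  through its length, which is where the independence of the eigenvalues in the limit comes
  from.\<close>

lemma sum_card_eig_lists:
  fixes ts :: "'k::{field,finite} list"
  shows "(\<Sum>X\<in>carrier_mat c c. real (card (eig_lists c X ts))) =
    real CARD('k) ^ (c * c) * (\<Prod>i<length ts. 1 - real CARD('k) ^ i / real CARD('k) ^ c)"
proof -
  let ?Q = "real CARD('k)" and ?k = "length ts"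
  define S where "S = {vs :: 'k vec list. set vs \<subseteq> carrier_vec c \<and> lin_indep c vs \<and> length vs = ?k}"
  have finS: "finite S"
    by (rule finite_subset[OF _ finite_lists_length_eq[OF finite_carrier_vec[of c], of ?k]]) (auto simp: S_def)
  have "(\<Sum>X\<in>carrier_mat c c. real (card (eig_lists c X ts))) =
      (\<Sum>X\<in>carrier_mat c c. \<Sum>vs\<in>S. if vs \<in> eig_lists c X ts then 1 else 0)"
  proof (rule sum.cong[OF refl])
    fix X :: "'k mat"
    have "eig_lists c X ts \<subseteq> S"
      using eig_lists_carrier[of _ c X ts] eig_lists_length[of _ c X ts]
      by (auto simp: S_def eig_lists_def)
    then have "S \<inter> {vs. vs \<in> eig_lists c X ts} = eig_lists c X ts" by auto
    then show "real (card (eig_lists c X ts)) = (\<Sum>vs\<in>S. if vs \<in> eig_lists c X ts then 1 else 0)"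
      using finS by (simp add: sum.If_cases)
  qed
  also have "\<dots> = (\<Sum>vs\<in>S. real (card {X \<in> carrier_mat c c. vs \<in> eig_lists c X ts}))"
    by (subst sum.swap) (simp add: sum.If_cases finite_carrier_mat Int_def)
  also have "\<dots> = (\<Sum>vs\<in>S. ?Q ^ (c * c) / ?Q ^ (c * ?k))"
  proof (rule sum.cong[OF refl])
    fix vs assume "vs \<in> S"
    then have "real (card {X \<in> carrier_mat c c. vs \<in> eig_lists c X ts} * CARD('k) ^ (c * ?k)) =
        real (CARD('k) ^ (c * c))"
      using card_mats_with_eigenvectors[of vs c ts] by (simp add: S_def)
    then show "real (card {X \<in> carrier_mat c c. vs \<in> eig_lists c X ts}) = ?Q ^ (c * c) / ?Q ^ (c * ?k)"
      by (simp add: field_simps)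
  qed
  also have "\<dots> = qfall ?Q ?k (?Q ^ c) * (?Q ^ (c * c) / ?Q ^ (c * ?k))"
    using card_indep_lists[where ?'k = 'k, of c ?k] by (simp add: S_def)
  also have "\<dots> = ?Q ^ (c * c) * (qfall ?Q ?k (?Q ^ c) / (\<Prod>i<?k. ?Q ^ c))"
    by (simp add: power_mult)
  also have "qfall ?Q ?k (?Q ^ c) / (\<Prod>i<?k. ?Q ^ c) = (\<Prod>i<?k. 1 - ?Q ^ i / ?Q ^ c)"
    unfolding qfall_def by (subst prod_dividef[symmetric]) (simp add: diff_divide_distrib)
  finally show ?thesis .
qed

section \<open>Asymptotic independence of the eigenspaces\<close>

text \<open>The coefficients \<open>euler_coeff Q\<close> and \<open>euler_coeff' Q\<close> expand, in terms of the functions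
  \<open>qfall Q k\<close>, the indicators of \<open>z = 1\<close> and \<open>z = Q\<close> on the powers \<open>z\<close> of \<open>Q\<close>.  They come from
  Moebius inversion over the lattice of subspaces.\<close>

definition euler_coeff :: "real \<Rightarrow> nat \<Rightarrow> real" where
  "euler_coeff Q k = (-1) ^ k / (\<Prod>i<k. Q ^ Suc i - 1)"

definition euler_coeff' :: "real \<Rightarrow> nat \<Rightarrow> real" where
  "euler_coeff' Q k = (case k of 0 \<Rightarrow> 0 | Suc j \<Rightarrow> euler_coeff Q j * (1 / Q) ^ j / (Q - 1))"

lemma qfall_Suc_shift: "qfall Q (Suc k) z = (z - 1) * (\<Prod>i<k. z - Q ^ Suc i)"
  unfolding qfall_def by (subst prod.lessThan_Suc_shift) simp

text \<open>A finite q-binomial identity, proved by telescoping. At \<open>z = 1\<close> every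
  factor is 1, and at \<open>z = Q ^ n\<close> with \<open>1 \<le> n \<le> m\<close> the factor
  \<open>i = n - 1\<close> vanishes.\<close>

lemma sum_euler_coeff_qfall:
  assumes "Q > 1"
  shows "(\<Sum>k\<le>m. euler_coeff Q k * qfall Q k z) = (\<Prod>i<m. (Q ^ Suc i - z) / (Q ^ Suc i - 1))"
proof (induction m)
  case 0
  show ?case by (simp add: euler_coeff_def)
next
  case (Suc m)
  define A where "A = (\<Prod>i<m. Q ^ Suc i - z)"
  define D where "D = (\<Prod>i<m. Q ^ Suc i - 1)"
  define d where "d = Q ^ Suc m - 1"
  have "Q ^ Suc i > 1" for i using assms by (intro one_less_power) auto
  then have nz: "D \<noteq> 0" "d \<noteq> 0" by (auto simp: D_def d_def less_imp_neq[symmetric])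
  have "(\<Prod>i<m. z - Q ^ Suc i) = (\<Prod>i<m. - 1 * (Q ^ Suc i - z))" by simp
  also have "\<dots> = (-1) ^ m * A" unfolding prod.distrib A_def by simp
  finally have "qfall Q (Suc m) z = (z - 1) * ((-1) ^ m * A)" by (simp only: qfall_Suc_shift)
  then have "euler_coeff Q (Suc m) * qfall Q (Suc m) z = (-1) ^ Suc m * (-1) ^ m * ((z - 1) * A / (D * d))"
    by (simp add: euler_coeff_def D_def d_def)
  also have "(-1 :: real) ^ Suc m * (-1) ^ m = - 1" by (simp flip: power_add add: mult_2[symmetric])
  finally have "(\<Sum>k\<le>Suc m. euler_coeff Q k * qfall Q k z) = A / D - (z - 1) * A / (D * d)"
    by (simp add: Suc.IH A_def D_def prod_dividef)
  also have "\<dots> = A * (Q ^ Suc m - z) / (D * d)"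
    using nz by (simp add: d_def field_simps)
  also have "\<dots> = (\<Prod>i<Suc m. (Q ^ Suc i - z) / (Q ^ Suc i - 1))"
    by (simp add: A_def D_def d_def prod_dividef)
  finally show ?case .
qed

lemma sum_euler_coeff_power:
  assumes "Q > 1" "n \<le> m"
  shows "(\<Sum>k\<le>m. euler_coeff Q k * qfall Q k (Q ^ n)) = of_bool (n = 0)"
proof (cases n)
  case 0
  have "Q ^ Suc i \<noteq> 1" for i using one_less_power[OF assms(1), of "Suc i"] by auto
  then show ?thesis using assms 0 by (simp add: sum_euler_coeff_qfall)
next
  case (Suc j)
  then have "(\<Prod>i<m. (Q ^ Suc i - Q ^ n) / (Q ^ Suc i - 1)) = 0"
    using assms(2) by (intro prod_zero bexI[of _ j]) auto
  then show ?thesis using assms Suc by (simp add: sum_euler_coeff_qfall)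
qed

lemma sum_euler_coeff'_power:
  assumes "Q > 1" "n \<le> m"
  shows "(\<Sum>k\<le>m. euler_coeff' Q k * qfall Q k (Q ^ n)) = of_bool (n = 1)"
proof (cases m)
  case 0
  then show ?thesis using assms by (simp add: euler_coeff'_def)
next
  case (Suc l)
  \<comment> \<open>Passing from \<open>z\<close> to \<open>z / Q\<close> reduces the claim to the
    coefficients \<open>euler_coeff\<close>; the prefactor \<open>(z - 1) / (Q - 1)\<close> is 1 at
    \<open>z = Q\<close> and disposes of the case \<open>z = 1\<close>.\<close>
  have term_eq: "euler_coeff' Q (Suc k) * qfall Q (Suc k) z =
      (z - 1) / (Q - 1) * (euler_coeff Q k * qfall Q k (z / Q))" for k z
  proof -
    have "(\<Prod>i<k. z - Q ^ Suc i) = (\<Prod>i<k. Q * (z / Q - Q ^ i))"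
      using assms by (intro prod.cong) (auto simp: field_simps)
    then have "qfall Q (Suc k) z = (z - 1) * (Q ^ k * qfall Q k (z / Q))"
      unfolding qfall_Suc_shift prod.distrib by (simp add: qfall_def)
    then show ?thesis using assms by (simp add: euler_coeff'_def power_one_over)
  qed
  have "(\<Sum>k\<le>m. euler_coeff' Q k * qfall Q k (Q ^ n)) =
      (\<Sum>k\<le>l. euler_coeff' Q (Suc k) * qfall Q (Suc k) (Q ^ n))"
    unfolding Suc by (subst sum.atMost_Suc_shift) (simp add: euler_coeff'_def)
  also have "\<dots> = (Q ^ n - 1) / (Q - 1) * (\<Sum>k\<le>l. euler_coeff Q k * qfall Q k (Q ^ n / Q))"
    unfolding term_eq by (rule sum_distrib_left[symmetric])
  also have "\<dots> = of_bool (n = 1)"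
  proof (cases n)
    case (Suc j)
    then have "Q ^ n / Q = Q ^ j" "j \<le> l" using assms \<open>m = Suc l\<close> by auto
    then show ?thesis using assms(1) Suc by (simp add: sum_euler_coeff_power)
  qed simp
  finally show ?thesis .
qed

lemma euler_coeff_Suc: "euler_coeff Q (Suc k) = - euler_coeff Q k / (Q ^ Suc k - 1)"
  by (simp add: euler_coeff_def)

lemma summable_euler_coeff:
  assumes "Q \<ge> 2"
  shows "summable (\<lambda>k. \<bar>euler_coeff Q k\<bar> * Q ^ k)"
\<comment> \<open>The ratio of consecutive terms is \<open>Q / (Q ^ Suc k - 1)\<close>. For
  \<open>k = 0\<close> it exceeds 1, so the test starts at \<open>k = 1\<close>, where the value 2/3
  is attained for \<open>Q = 2\<close>.\<close>
proof (rule summable_ratio_test[where c = "2/3" and N = 1])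
  fix k :: nat assume k: "k \<ge> 1"
  have "Q ^ 2 \<le> Q ^ Suc k" using assms k by (intro power_increasing) auto
  moreover have "(2 * Q + 1) * (Q - 2) \<ge> 0" using assms by simp
  ultimately have r: "3 * Q \<le> 2 * (Q ^ Suc k - 1)" by (simp add: power2_eq_square algebra_simps)
  moreover define w where "w = Q ^ Suc k"
  ultimately have pos: "Q ^ Suc k - 1 > 0" using assms by simp
  have nn: "\<bar>euler_coeff Q j\<bar> * Q ^ j \<ge> 0" for j using assms by simp
  have "Q / (Q ^ Suc k - 1) \<le> 2/3" using r pos by (simp add: divide_le_eq)
  then have "Q / (Q ^ Suc k - 1) * (\<bar>euler_coeff Q k\<bar> * Q ^ k) \<le> 2/3 * (\<bar>euler_coeff Q k\<bar> * Q ^ k)"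
    by (rule mult_right_mono[OF _ nn])
  moreover have "\<bar>euler_coeff Q (Suc k)\<bar> * Q ^ Suc k = Q / (Q ^ Suc k - 1) * (\<bar>euler_coeff Q k\<bar> * Q ^ k)"
    using pos unfolding euler_coeff_Suc abs_divide abs_minus_cancel by simp
  ultimately show "norm (\<bar>euler_coeff Q (Suc k)\<bar> * Q ^ Suc k) \<le> 2/3 * norm (\<bar>euler_coeff Q k\<bar> * Q ^ k)"
    unfolding real_norm_def abs_of_nonneg[OF nn] by (simp only:)
qed simp

lemma summable_euler_coeff_power:
  assumes "Q \<ge> 2" "\<bar>x\<bar> \<le> Q"
  shows "summable (\<lambda>k. \<bar>euler_coeff Q k * x ^ k\<bar>)"
proof (rule summable_comparison_test'[OF summable_euler_coeff[OF assms(1)], of 0])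
  fix k
  have "\<bar>x\<bar> ^ k \<le> Q ^ k" using assms(2) by (intro power_mono) auto
  then show "norm \<bar>euler_coeff Q k * x ^ k\<bar> \<le> \<bar>euler_coeff Q k\<bar> * Q ^ k"
    by (simp add: abs_mult power_abs mult_left_mono)
qed

lemma summable_euler_coeff':
  assumes "Q \<ge> 2"
  shows "summable (\<lambda>k. \<bar>euler_coeff' Q k\<bar> * Q ^ k)"
proof -
  have "\<bar>euler_coeff' Q (Suc k)\<bar> * Q ^ Suc k = Q / (Q - 1) * \<bar>euler_coeff Q k * 1 ^ k\<bar>" for k
    using assms by (simp add: euler_coeff'_def abs_mult power_one_over field_simps)
  then have "summable (\<lambda>k. \<bar>euler_coeff' Q (Suc k)\<bar> * Q ^ Suc k)"
    using summable_mult[OF summable_euler_coeff_power[of Q 1], of "Q / (Q - 1)"] assms by simp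
  then show ?thesis by (subst (asm) summable_Suc_iff)
qed

lemma abs_inverse_le: "Q \<ge> 2 \<Longrightarrow> \<bar>1 / Q :: real\<bar> \<le> Q"
  by (rule order_trans[of _ 1]) auto

text \<open>By an identity of Euler this is the product of \<open>1 - 1 / Q ^ i\<close> over \<open>i \<ge> 2\<close>, that is
  \<open>\<omega> / (1 - 1 / Q)\<close> for the paper's \<open>\<omega>\<close>; only the alternating series is used here.\<close>

definition euler_sum :: "real \<Rightarrow> real" where
  "euler_sum Q = (\<Sum>k. euler_coeff Q k * (1 / Q) ^ k)"

text \<open>By the recursion for the coefficients, term \<open>k + 1\<close> of the difference of
  the two series is \<open>- 1 / Q\<close> times term \<open>k\<close> of
  \<open>euler_sum Q\<close>, and term 0 cancels. Hence the difference is
  \<open>- euler_sum Q / Q\<close>.\<close>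

lemma suminf_euler_coeff:
  assumes "Q \<ge> 2"
  shows "suminf (euler_coeff Q) = (1 - 1 / Q) * euler_sum Q"
proof -
  let ?g = "\<lambda>k. euler_coeff Q k * (1 / Q) ^ k"
  have s1: "summable (euler_coeff Q)"
    using summable_euler_coeff_power[of Q 1] assms by (simp add: summable_rabs_cancel)
  have s2: "summable ?g"
    by (rule summable_rabs_cancel[OF summable_euler_coeff_power[OF assms abs_inverse_le[OF assms]]])
  have "suminf (euler_coeff Q) - euler_sum Q = (\<Sum>k. euler_coeff Q k - ?g k)"
    unfolding euler_sum_def by (rule suminf_diff[OF s1 s2])
  also have "\<dots> = (\<Sum>k. euler_coeff Q (Suc k) - ?g (Suc k))"
    by (subst suminf_split_head[OF summable_diff[OF s1 s2]]) simp
  also have "\<dots> = (\<Sum>k. - (1 / Q) * ?g k)"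
  proof (rule suminf_cong)
    fix k
    have "Q ^ Suc k > 1" using assms by (intro one_less_power) auto
    then have nz: "Q * Q ^ k - 1 \<noteq> 0" by simp
    have "euler_coeff Q (Suc k) - ?g (Suc k) = - euler_coeff Q k / (Q * Q ^ k - 1) * (1 - (1 / Q) ^ Suc k)"
      unfolding euler_coeff_Suc power_Suc[of Q] by (simp only: right_diff_distrib mult_1_right)
    also have "1 - (1 / Q) ^ Suc k = (Q * Q ^ k - 1) * (1 / Q) ^ Suc k"
      using assms by (simp add: power_one_over field_simps)
    also have "- euler_coeff Q k / (Q * Q ^ k - 1) * ((Q * Q ^ k - 1) * (1 / Q) ^ Suc k) = - (1 / Q) * ?g k"
      using nz by simp
    finally show "euler_coeff Q (Suc k) - ?g (Suc k) = - (1 / Q) * ?g k" .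
  qed
  also have "\<dots> = - (1 / Q) * euler_sum Q" unfolding euler_sum_def by (rule suminf_mult[OF s2])
  finally show ?thesis by (simp add: algebra_simps)
qed

lemma suminf_euler_coeff':
  assumes "Q \<ge> 2"
  shows "suminf (euler_coeff' Q) = euler_sum Q / (Q - 1)"
proof -
  have s: "summable (euler_coeff' Q)"
  proof (rule summable_rabs_cancel, rule summable_comparison_test'[OF summable_euler_coeff'[OF assms], of 0])
    fix k
    have "1 \<le> Q ^ k" using assms by (intro one_le_power) auto
    then show "norm \<bar>euler_coeff' Q k\<bar> \<le> \<bar>euler_coeff' Q k\<bar> * Q ^ k"
      using mult_left_mono[of 1 "Q ^ k" "\<bar>euler_coeff' Q k\<bar>"] by simp
  qed
  have s2: "summable (\<lambda>k. euler_coeff Q k * (1 / Q) ^ k)"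
    by (rule summable_rabs_cancel[OF summable_euler_coeff_power[OF assms abs_inverse_le[OF assms]]])
  have "suminf (euler_coeff' Q) = (\<Sum>k. euler_coeff' Q (Suc k))"
    by (subst suminf_split_head[OF s]) (simp add: euler_coeff'_def)
  also have "\<dots> = euler_sum Q / (Q - 1)"
    unfolding euler_sum_def by (subst suminf_divide[OF s2, symmetric]) (simp add: euler_coeff'_def)
  finally show ?thesis .
qed

text \<open>The terms alternate and decrease in size, so the sum lies between its first two partial
  sums.\<close>

lemma euler_sum_bounds:
  assumes "Q \<ge> 2"
  shows "euler_sum Q \<le> 1" "euler_sum Q \<ge> 1 - 1 / (Q * (Q - 1))"
proof -
  define a where "a k = (1 / Q) ^ k / (\<Prod>i<k. Q ^ Suc i - 1)" for k
  have p: "Q ^ Suc i - 1 \<ge> 1" for i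
  proof -
    have "Q ^ 1 \<le> Q ^ Suc i" using assms by (intro power_increasing) auto
    with assms have "2 \<le> Q ^ Suc i" by (simp only: power_one_right)
    then show ?thesis by simp
  qed
  have p0: "(\<Prod>i<k. Q ^ Suc i - 1) \<ge> 0" for k
    by (intro prod_nonneg ballI order_trans[OF _ p]) simp
  have eq: "euler_coeff Q k * (1 / Q) ^ k = (-1) ^ k * a k" for k
    by (simp add: euler_coeff_def a_def)
  have "summable a"
  proof -
    have "\<bar>euler_coeff Q k * (1 / Q) ^ k\<bar> = a k" for k
    proof -
      have "a k \<ge> 0" unfolding a_def using assms by (intro divide_nonneg_nonneg p0) simp
      then show ?thesis unfolding eq by (simp add: abs_mult)
    qed
    then show ?thesis using summable_euler_coeff_power[OF assms abs_inverse_le[OF assms]] by simp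
  qed
  then have lim: "a \<longlonglongrightarrow> 0" by (rule summable_LIMSEQ_zero)
  have pos: "a k \<ge> 0" for k
    unfolding a_def using assms by (intro divide_nonneg_nonneg p0) simp
  have mono: "a (Suc k) \<le> a k" for k
  proof -
    have "a (Suc k) = a k * ((1 / Q) / (Q ^ Suc k - 1))" by (simp add: a_def)
    also have "(1 / Q) / (Q ^ Suc k - 1) \<le> 1 / 1"
      using assms p[of k] by (intro frac_le) auto
    then have "a k * ((1 / Q) / (Q ^ Suc k - 1)) \<le> a k * 1"
      using pos by (intro mult_left_mono) auto
    finally show ?thesis by simp
  qed
  from summable_Leibniz'(4)[where a = a and n = 0, OF lim pos mono] show "euler_sum Q \<le> 1"
    unfolding euler_sum_def eq by (simp add: a_def)
  from summable_Leibniz'(2)[where a = a and n = 1, OF lim pos mono] show "euler_sum Q \<ge> 1 - 1 / (Q * (Q - 1))"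
    unfolding euler_sum_def eq by (simp add: a_def numeral_2_eq_2)
qed

text \<open>Since \<open>qfall Q k\<close> vanishes at \<open>Q ^ n\<close> for \<open>n < k\<close>, a function on the powers of \<open>Q\<close> is
  determined by the coefficients \<open>a\<close> of its expansion, which plays the role of a Newton series.\<close>

definition has_expansion :: "nat \<Rightarrow> (nat \<Rightarrow> real) \<Rightarrow> (nat \<Rightarrow> real) \<Rightarrow> bool" where
  "has_expansion Q a u \<longleftrightarrow>
     (\<forall>c n. n \<le> c \<longrightarrow> (\<Sum>k\<le>c. a k * qfall Q k (real Q ^ n)) = u (Q ^ n)) \<and>
     summable (\<lambda>k. \<bar>a k\<bar> * real Q ^ k)"

text \<open>Used for eigenvalues on which no condition is imposed.\<close>

lemma has_expansion_one: "has_expansion Q (\<lambda>k. of_bool (k = 0)) (\<lambda>_. 1)"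
proof -
  have "(\<lambda>k. \<bar>of_bool (k = 0)\<bar> * real Q ^ k) = (\<lambda>k. if k = 0 then 1 else 0)" by auto
  then show ?thesis
    by (simp add: has_expansion_def of_bool_def if_distrib[of "\<lambda>x. x * _"] sum.delta summable_single cong: if_cong)
qed

lemma has_expansion_eq_one:
  assumes "Q \<ge> 2"
  shows "has_expansion Q (euler_coeff Q) (\<lambda>z. of_bool (z = 1))"
  using assms by (simp add: has_expansion_def sum_euler_coeff_power summable_euler_coeff)

lemma has_expansion_eq_base:
  assumes "Q \<ge> 2"
  shows "has_expansion Q (euler_coeff' Q) (\<lambda>z. of_bool (z = Q))"
proof -
  have "Q ^ n = Q \<longleftrightarrow> n = 1" for n
    using assms power_inject_exp[of Q n 1] by simp
  then show ?thesis
    using assms by (simp add: has_expansion_def sum_euler_coeff'_power summable_euler_coeff')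
qed

lemma card_field_ge_2: "CARD('k::{field,finite}) \<ge> 2"
  using card_mono[of "UNIV :: 'k set" "{0, 1}"] by simp

text \<open>There are no \<open>Suc c\<close> independent vectors in dimension \<open>c\<close>. So
  the number of such lists in the eigenspace, a \<open>qfall\<close> by
  \<open>card_eig_lists\<close>, is zero, and the roots of this \<open>qfall\<close> are the powers
  \<open>CARD('k) ^ n\<close> with \<open>n \<le> c\<close>.\<close>

lemma card_eig_power:
  fixes X :: "'k::{field,finite} mat"
  assumes X: "X \<in> carrier_mat c c"
  obtains n where "n \<le> c" "card (eig c X a) = CARD('k) ^ n"
proof -
  let ?ts = "replicate (Suc c) a"
  have Q: "CARD('k) > 1" using card_field_ge_2[where 'k = 'k] by simp
  have "eig_lists c X ?ts = {}"
  proof (rule equals0I)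
    fix vs assume vs: "vs \<in> eig_lists c X ?ts"
    have "CARD('k) ^ Suc c = card (lin_span c vs)"
      using card_lin_span[OF eig_lists_carrier[OF vs]] eig_lists_length[OF vs] vs
      by (simp add: eig_lists_def)
    also have "\<dots> \<le> CARD('k) ^ c"
      unfolding card_carrier_vec[symmetric]
      using lin_closed_lin_span[OF eig_lists_carrier[OF vs]] by (intro card_mono lin_closedD(1)) auto
    finally show False using Q by simp
  qed
  moreover have "count_list ?ts b = (if b = a then Suc c else 0)" for b
  proof -
    have "count_list (replicate k a) b = (if b = a then k else 0)" for k by (induction k) auto
    then show ?thesis by blast
  qed
  ultimately have "(\<Prod>b\<in>UNIV. if b = a then qfall CARD('k) (Suc c) (card (eig c X b)) else 1) = 0"
    using card_eig_lists[OF X, of ?ts] by (simp add: if_distrib[of "\<lambda>k. qfall _ k _"] cong: if_cong)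
  then have "qfall CARD('k) (Suc c) (card (eig c X a)) = 0" by simp
  then obtain n where "n \<in> {..<Suc c}" "real (card (eig c X a)) - real CARD('k) ^ n = 0"
    unfolding qfall_def prod_zero_iff[OF finite_lessThan] by blast
  then show thesis using that[of n] by (simp flip: of_nat_power)
qed

section \<open>Averages over all matrices and their limits\<close>

definition avg :: "nat \<Rightarrow> ('k::{field,finite} mat \<Rightarrow> real) \<Rightarrow> real" where
  "avg c f = (\<Sum>X\<in>carrier_mat c c. f X) / real CARD('k) ^ (c * c)"

lemma avg_diff: "avg c (\<lambda>X. f X - g X) = avg c f - avg c g"
  by (simp add: avg_def sum_subtractf diff_divide_distrib)

lemma avg_sum: "avg c (\<lambda>X. \<Sum>i\<in>I. f i X) = (\<Sum>i\<in>I. avg c (f i))"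
  unfolding avg_def by (subst sum.swap) (simp add: sum_divide_distrib)

lemma exists_list_with_counts:
  fixes g :: "'a::finite \<Rightarrow> nat"
  obtains ts where "\<And>a. count_list ts a = g a" "length ts = (\<Sum>a\<in>UNIV. g a)"
proof -
  obtain ts where ts: "mset ts = (\<Sum>a\<in>UNIV. replicate_mset (g a) a)" using ex_mset by blast
  have "count_list ts a = g a" for a
    unfolding count_mset[symmetric] ts by (simp add: count_sum)
  moreover have "length ts = (\<Sum>a\<in>UNIV. g a)"
    unfolding size_mset[symmetric] ts by simp
  ultimately show thesis using that by blast
qed

text \<open>A union bound, the sum of the \<open>Q ^ i\<close> over \<open>i < k\<close> being at
  most \<open>Q ^ k\<close> because \<open>Q \<ge> 2\<close>. For \<open>k > c\<close> the factor
  \<open>i = c\<close> makes the product zero while the right side is at least 1.\<close>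

lemma one_minus_prod_bounds:
  fixes Q :: real
  assumes "Q \<ge> 2"
  shows "\<bar>1 - (\<Prod>i<k. 1 - Q ^ i / Q ^ c)\<bar> \<le> Q ^ k / Q ^ c"
proof (cases "k \<le> c")
  case True
  have f: "0 \<le> Q ^ i / Q ^ c" "Q ^ i / Q ^ c \<le> 1" if "i < k" for i
    using assms True that by (auto intro!: power_increasing simp: divide_le_eq_1)
  have "(\<Prod>i<k. 1 - Q ^ i / Q ^ c) \<le> 1"
    using f by (intro prod_le_1) auto
  moreover have "1 - Q ^ j / Q ^ c \<le> (\<Prod>i<j. 1 - Q ^ i / Q ^ c)" if "j \<le> k" for j
    using that
  proof (induction j)
    case 0
    show ?case using assms by simp
  next
    case (Suc j)
    let ?P = "\<Prod>i<j. 1 - Q ^ i / Q ^ c"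
    have P: "?P \<le> 1" using f Suc.prems by (intro prod_le_1) auto
    have x: "0 \<le> Q ^ j / Q ^ c" using f[of j] Suc.prems by auto
    have "2 * Q ^ j \<le> Q ^ Suc j" using assms by simp
    then have "2 * Q ^ j / Q ^ c \<le> Q ^ Suc j / Q ^ c" using assms by (intro divide_right_mono) auto
    then have "1 - Q ^ Suc j / Q ^ c \<le> 1 - Q ^ j / Q ^ c - Q ^ j / Q ^ c" by simp
    also have "\<dots> \<le> ?P - Q ^ j / Q ^ c" using Suc by simp
    also have "\<dots> \<le> ?P - ?P * (Q ^ j / Q ^ c)" using mult_right_mono[OF P x] by simp
    also have "\<dots> = (\<Prod>i<Suc j. 1 - Q ^ i / Q ^ c)" by (simp add: algebra_simps)
    finally show ?case .
  qed
  ultimately show ?thesis using le_refl[of k] by (smt (verit, best))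
next
  case False
  then have "(\<Prod>i<k. 1 - Q ^ i / Q ^ c) = 0"
    using assms by (intro prod_zero bexI[of _ c]) auto
  moreover have "Q ^ c \<le> Q ^ k" using False assms by (intro power_increasing) auto
  then have "1 \<le> Q ^ k / Q ^ c" using assms by (simp add: le_divide_eq)
  ultimately show ?thesis by (simp only: diff_zero abs_one)
qed

text \<open>Each factor is replaced by its expansion, and the product of sums is multiplied out over
  the functions \<open>g\<close> that choose a number of vectors for each eigenvalue; the average of
  each resulting product is a known moment. Cutting off at \<open>c\<close> is exact, since
  eigenspaces have dimension at most \<open>c\<close>.\<close>

lemma avg_prod_eq:
  fixes u A :: "'k::{field,finite} \<Rightarrow> nat \<Rightarrow> real"
  assumes e: "\<And>a. has_expansion CARD('k) (A a) (u a)"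
  shows "avg c (\<lambda>X. \<Prod>a\<in>UNIV. u a (card (eig c X a))) =
    (\<Sum>g\<in>PiE UNIV (\<lambda>_. {..c}). (\<Prod>a\<in>UNIV. A a (g a)) *
        (\<Prod>i<(\<Sum>a\<in>UNIV. g a). 1 - real CARD('k) ^ i / real CARD('k) ^ c))"
proof -
  let ?Q = "real CARD('k)" and ?G = "PiE (UNIV :: 'k set) (\<lambda>_. {..c})"
  have "avg c (\<lambda>X. \<Prod>a\<in>UNIV. u a (card (eig c X a))) = avg c (\<lambda>X. \<Sum>g\<in>?G.
      (\<Prod>a\<in>UNIV. A a (g a)) * (\<Prod>a\<in>UNIV. qfall ?Q (g a) (card (eig c X a))))"
    unfolding avg_def
  proof (intro arg_cong2[where f = "(/)"] sum.cong refl)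
    fix X :: "'k mat" assume X: "X \<in> carrier_mat c c"
    have "u a (card (eig c X a)) = (\<Sum>k\<le>c. A a k * qfall ?Q k (card (eig c X a)))" for a
    proof -
      obtain n where n: "n \<le> c" "card (eig c X a) = CARD('k) ^ n" by (rule card_eig_power[OF X])
      then have "(\<Sum>k\<le>c. A a k * qfall ?Q k (?Q ^ n)) = u a (CARD('k) ^ n)"
        using e[of a] unfolding has_expansion_def by blast
      then show ?thesis unfolding n(2) by simp
    qed
    then have "(\<Prod>a\<in>UNIV. u a (card (eig c X a))) =
        (\<Prod>a\<in>UNIV. \<Sum>k\<le>c. A a k * qfall ?Q k (card (eig c X a)))" by simp
    also have "\<dots> = (\<Sum>g\<in>?G. \<Prod>a\<in>UNIV. A a (g a) * qfall ?Q (g a) (card (eig c X a)))"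
      by (rule prod_sum_PiE) auto
    finally show "(\<Prod>a\<in>UNIV. u a (card (eig c X a))) =
        (\<Sum>g\<in>?G. (\<Prod>a\<in>UNIV. A a (g a)) * (\<Prod>a\<in>UNIV. qfall ?Q (g a) (card (eig c X a))))"
      by (simp add: prod.distrib)
  qed
  also have "\<dots> = (\<Sum>g\<in>?G. (\<Prod>a\<in>UNIV. A a (g a)) *
      avg c (\<lambda>X. \<Prod>a\<in>UNIV. qfall ?Q (g a) (card (eig c X a))))"
    unfolding avg_sum by (simp add: avg_def sum_distrib_left)
  also have "\<dots> = (\<Sum>g\<in>?G. (\<Prod>a\<in>UNIV. A a (g a)) *
      (\<Prod>i<(\<Sum>a\<in>UNIV. g a). 1 - ?Q ^ i / ?Q ^ c))"
  proof (intro sum.cong refl arg_cong2[where f = "(*)"])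
    fix g :: "'k \<Rightarrow> nat"
    obtain ts where ts: "\<And>a. count_list ts a = g a" "length ts = (\<Sum>a\<in>UNIV. g a)"
      using exists_list_with_counts[of g] by blast
    have "(\<Sum>X\<in>carrier_mat c c. \<Prod>a\<in>UNIV. qfall ?Q (g a) (card (eig c X a))) =
        (\<Sum>X\<in>carrier_mat c c. real (card (eig_lists c X ts)))"
      by (intro sum.cong refl) (simp add: card_eig_lists ts(1))
    also have "\<dots> = ?Q ^ (c * c) * (\<Prod>i<(\<Sum>a\<in>UNIV. g a). 1 - ?Q ^ i / ?Q ^ c)"
      unfolding sum_card_eig_lists ts(2) ..
    finally show "avg c (\<lambda>X. \<Prod>a\<in>UNIV. qfall ?Q (g a) (card (eig c X a))) =
        (\<Prod>i<(\<Sum>a\<in>UNIV. g a). 1 - ?Q ^ i / ?Q ^ c)"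
      by (simp add: avg_def)
  qed
  finally show ?thesis .
qed

text \<open>Replacing every moment by 1 turns the average into a product of partial sums. The error
  is at most \<open>(1 / Q) ^ c\<close> times the constant \<open>B\<close>, which is finite by the
  weighted summability in \<open>has_expansion\<close>.\<close>

lemma avg_prod_tendsto:
  fixes u A :: "'k::{field,finite} \<Rightarrow> nat \<Rightarrow> real"
  assumes e: "\<And>a. has_expansion CARD('k) (A a) (u a)"
  shows "(\<lambda>c. avg c (\<lambda>X. \<Prod>a\<in>UNIV. u a (card (eig c X a)))) \<longlonglongrightarrow> (\<Prod>a\<in>UNIV. suminf (A a))"
proof -
  let ?Q = "real CARD('k)"
  have Q: "?Q \<ge> 2" using card_field_ge_2[where 'k = 'k] by simp
  have summ: "summable (\<lambda>k. \<bar>A a k\<bar> * ?Q ^ k)" for a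
    using e unfolding has_expansion_def by blast
  have summ': "summable (A a)" for a
  proof (rule summable_comparison_test'[OF summ, of 0])
    fix k
    have "1 \<le> ?Q ^ k" using Q by (intro one_le_power) auto
    then show "norm (A a k) \<le> \<bar>A a k\<bar> * ?Q ^ k"
      using mult_left_mono[of 1 "?Q ^ k" "\<bar>A a k\<bar>"] by simp
  qed
  define S where "S c = (\<Prod>a\<in>UNIV. \<Sum>k\<le>c. A a k)" for c
  define B where "B = (\<Prod>a\<in>UNIV. \<Sum>k. \<bar>A a k\<bar> * ?Q ^ k)"
  have S_lim: "S \<longlonglongrightarrow> (\<Prod>a\<in>UNIV. suminf (A a))"
    unfolding S_def using summable_LIMSEQ'[OF summ'] by (intro tendsto_prod)
  have bound: "\<bar>S c - avg c (\<lambda>X. \<Prod>a\<in>UNIV. u a (card (eig c X a)))\<bar> \<le> B * (1 / ?Q) ^ c" for c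
  proof -
    let ?G = "PiE (UNIV :: 'k set) (\<lambda>_. {..c})"
    let ?m = "\<lambda>g. \<Prod>i<(\<Sum>a\<in>UNIV. g a). 1 - ?Q ^ i / ?Q ^ c"
    have "S c = (\<Sum>g\<in>?G. \<Prod>a\<in>UNIV. A a (g a))"
      unfolding S_def by (rule prod_sum_PiE) auto
    then have "S c - avg c (\<lambda>X. \<Prod>a\<in>UNIV. u a (card (eig c X a))) =
        (\<Sum>g\<in>?G. (\<Prod>a\<in>UNIV. A a (g a)) * (1 - ?m g))"
      unfolding avg_prod_eq[OF e] by (simp add: sum_subtractf algebra_simps)
    also have "\<bar>\<dots>\<bar> \<le> (\<Sum>g\<in>?G. \<bar>(\<Prod>a\<in>UNIV. A a (g a)) * (1 - ?m g)\<bar>)" by (rule sum_abs)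
    also have "\<dots> \<le> (\<Sum>g\<in>?G. (\<Prod>a\<in>UNIV. \<bar>A a (g a)\<bar>) * (?Q ^ (\<Sum>a\<in>UNIV. g a) / ?Q ^ c))"
      unfolding abs_mult abs_prod by (intro sum_mono mult_left_mono one_minus_prod_bounds Q prod_nonneg) auto
    also have "\<dots> = (\<Sum>g\<in>?G. \<Prod>a\<in>UNIV. \<bar>A a (g a)\<bar> * ?Q ^ g a) * (1 / ?Q) ^ c"
      by (simp add: power_sum prod.distrib sum_distrib_right power_one_over sum_divide_distrib)
    also have "(\<Sum>g\<in>?G. \<Prod>a\<in>UNIV. \<bar>A a (g a)\<bar> * ?Q ^ g a) = (\<Prod>a\<in>UNIV. \<Sum>k\<le>c. \<bar>A a k\<bar> * ?Q ^ k)"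
      by (rule prod_sum_PiE[symmetric]) auto
    also have "\<dots> * (1 / ?Q) ^ c \<le> B * (1 / ?Q) ^ c"
      unfolding B_def
      by (intro mult_right_mono prod_mono conjI sum_nonneg sum_le_suminf summ) auto
    finally show ?thesis .
  qed
  have "(\<lambda>c. B * (1 / ?Q) ^ c) \<longlonglongrightarrow> B * 0"
    using Q by (intro tendsto_mult tendsto_const LIMSEQ_power_zero) auto
  then have "(\<lambda>c. B * (1 / ?Q) ^ c) \<longlonglongrightarrow> 0" by simp
  then have "(\<lambda>c. S c - avg c (\<lambda>X. \<Prod>a\<in>UNIV. u a (card (eig c X a)))) \<longlonglongrightarrow> 0"
  proof (rule tendsto_0_le[where K = 1], intro always_eventually allI)
    fix c
    show "norm (S c - avg c (\<lambda>X. \<Prod>a\<in>UNIV. u a (card (eig c X a)))) \<le> norm (B * (1 / ?Q) ^ c) * 1"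
      unfolding real_norm_def mult_1_right by (rule order_trans[OF bound abs_ge_self])
  qed
  from tendsto_diff[OF S_lim this] show ?thesis by simp
qed

text \<open>Applied to Frobenius orbits \<open>R\<close>. Cardinality 1 means that an eigenspace is
  zero, cardinality \<open>CARD('k)\<close> that it is a line.\<close>

definition simple_on :: "nat \<Rightarrow> 'k::{field,finite} mat \<Rightarrow> 'k set \<Rightarrow> bool" where
  "simple_on c X R \<longleftrightarrow>
     (\<exists>a\<in>R. card (eig c X a) = CARD('k) \<and> (\<forall>b\<in>R - {a}. card (eig c X b) = 1))"

text \<open>For different \<open>a\<close> the events are exclusive, because no eigenspace has both
  1 and \<open>CARD('k)\<close> elements. As a sum of products over single eigenvalues, the
  indicator has the form to which the moments apply.\<close>

lemma of_bool_simple_on: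
  fixes X :: "'k::{field,finite} mat"
  assumes "finite R"
  shows "of_bool (simple_on c X R) =
    (\<Sum>a\<in>R. \<Prod>b\<in>R. if b = a then of_bool (card (eig c X b) = CARD('k)) else of_bool (card (eig c X b) = 1) :: real)"
proof -
  let ?z = "\<lambda>a. card (eig c X a)"
  let ?P = "\<lambda>a. ?z a = CARD('k) \<and> (\<forall>b\<in>R - {a}. ?z b = 1)"
  have term_eq: "(\<Prod>b\<in>R. if b = a then of_bool (?z b = CARD('k)) else of_bool (?z b = 1)) = (of_bool (?P a) :: real)"
    if "a \<in> R" for a
  proof -
    have "(\<Prod>b\<in>R. if b = a then of_bool (?z b = CARD('k)) else of_bool (?z b = 1)) =
        (of_bool (?z a = CARD('k)) :: real) * (\<Prod>b\<in>R - {a}. of_bool (?z b = 1))"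
      using assms that by (subst prod.remove[of R a]) (auto intro!: prod.cong)
    also have "(\<Prod>b\<in>R - {a}. of_bool (?z b = 1)) = (of_bool (\<forall>b\<in>R - {a}. ?z b = 1) :: real)"
      using assms by (auto intro!: prod.neutral prod_zero)
    finally show ?thesis by simp
  qed
  have "(\<Sum>a\<in>R. of_bool (?P a) :: real) = of_bool (\<exists>a\<in>R. ?P a)"
  proof (cases "\<exists>a\<in>R. ?P a")
    case True
    then obtain a where a: "a \<in> R" "?P a" by blast
    have "\<not> ?P b" if "b \<in> R" "b \<noteq> a" for b
      using a that card_field_ge_2[where 'k = 'k] by fastforce
    then have "(\<Sum>b\<in>R. of_bool (?P b) :: real) = (\<Sum>b\<in>R. if b = a then 1 else 0)"
      using a by (intro sum.cong) auto
    then show ?thesis using a assms by auto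
  qed auto
  then show ?thesis using term_eq by (simp add: simple_on_def)
qed

text \<open>The free functions \<open>u\<close> on the eigenvalues outside all orbits make the
  induction work. To remove an orbit \<open>R\<close>, its factor is written as 1 minus a sum of
  products, and each of these products extends \<open>u\<close> to \<open>R\<close>; the induction
  hypothesis for the other orbits applies to every extension.\<close>

lemma avg_no_simple_on_tendsto:
  fixes A u :: "'k::{field,finite} \<Rightarrow> nat \<Rightarrow> real" and b :: nat
  assumes "finite \<O>" "\<And>R R'. R \<in> \<O> \<Longrightarrow> R' \<in> \<O> \<Longrightarrow> R \<noteq> R' \<Longrightarrow> R \<inter> R' = {}"
    and "\<And>R. R \<in> \<O> \<Longrightarrow> card R = b"
    and "\<And>a. has_expansion CARD('k) (A a) (u a)"
  shows "(\<lambda>c. avg c (\<lambda>X. (\<Prod>a\<in>- \<Union>\<O>. u a (card (eig c X a))) *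
      (\<Prod>R\<in>\<O>. 1 - of_bool (simple_on c X R)))) \<longlonglongrightarrow>
    (\<Prod>a\<in>- \<Union>\<O>. suminf (A a)) *
      (1 - b * (suminf (euler_coeff' CARD('k)) * suminf (euler_coeff CARD('k)) ^ (b - 1))) ^ card \<O>"
  using assms
proof (induction \<O> arbitrary: A u rule: finite_induct)
  case empty
  then show ?case using avg_prod_tendsto[of A u] by simp
next
  case (insert R \<O>)
  let ?U = "- \<Union>(insert R \<O>)" and ?Q = "CARD('k)"
  let ?L1 = "suminf (euler_coeff' ?Q)" and ?L0 = "suminf (euler_coeff ?Q)"
  let ?t = "1 - b * (?L1 * ?L0 ^ (b - 1))"
  let ?E = "\<lambda>c X. \<Prod>R\<in>\<O>. 1 - of_bool (simple_on c X R) :: real"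
  have Q: "?Q \<ge> 2" by (rule card_field_ge_2)
  have cardR: "card R = b" using insert.prems(2) by simp
  have disj: "R \<inter> \<Union>\<O> = {}" using insert.prems(1) insert.hyps(2) by blast
  have U: "- \<Union>\<O> = ?U \<union> R" "?U \<inter> R = {}" using disj by auto
  have split: "(\<Prod>a\<in>- \<Union>\<O>. f a) = (\<Prod>a\<in>?U. f a) * (\<Prod>a\<in>R. f a)" for f :: "'k \<Rightarrow> real"
    unfolding U(1) using U(2) by (intro prod.union_disjoint) auto
  have IH: "(\<lambda>c. avg c (\<lambda>X. (\<Prod>a\<in>- \<Union>\<O>. u' a (card (eig c X a))) * ?E c X)) \<longlonglongrightarrow>
      (\<Prod>a\<in>- \<Union>\<O>. suminf (A' a)) * ?t ^ card \<O>"
    if "\<And>a. has_expansion ?Q (A' a) (u' a)" for A' u' :: "'k \<Rightarrow> nat \<Rightarrow> real"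
    using that insert.prems(1,2) by (intro insert.IH) auto
  \<comment> \<open>\<open>u0\<close> puts no condition on \<open>R\<close>, and \<open>u1 r\<close>
    asks that \<open>r\<close> be the only eigenvalue in \<open>R\<close>, with a line as its
    eigenspace.\<close>
  define A0 u0 where "A0 = (\<lambda>a. if a \<in> R then (\<lambda>k. of_bool (k = 0)) else A a)"
    and "u0 = (\<lambda>a. if a \<in> R then (\<lambda>_. 1) else u a)"
  define A1 u1 where "A1 = (\<lambda>r a. if a \<in> R then if a = r then euler_coeff' ?Q else euler_coeff ?Q else A a)"
    and "u1 = (\<lambda>r a z. if a \<in> R then if a = r then of_bool (z = ?Q) else of_bool (z = 1) else u a z)"
  have lim0: "(\<lambda>c. avg c (\<lambda>X. (\<Prod>a\<in>- \<Union>\<O>. u0 a (card (eig c X a))) * ?E c X)) \<longlonglongrightarrow>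
      (\<Prod>a\<in>- \<Union>\<O>. suminf (A0 a)) * ?t ^ card \<O>"
    using insert.prems(3) by (intro IH) (auto simp: A0_def u0_def has_expansion_one)
  have lim1: "(\<lambda>c. avg c (\<lambda>X. (\<Prod>a\<in>- \<Union>\<O>. u1 r a (card (eig c X a))) * ?E c X)) \<longlonglongrightarrow>
      (\<Prod>a\<in>- \<Union>\<O>. suminf (A1 r a)) * ?t ^ card \<O>" for r
  proof (rule IH)
    fix a
    show "has_expansion ?Q (A1 r a) (u1 r a)"
      using insert.prems(3)[of a] has_expansion_eq_one[OF Q] has_expansion_eq_base[OF Q]
      by (cases "a \<in> R"; cases "a = r") (simp_all add: A1_def u1_def)
  qed
  have "(\<lambda>c. avg c (\<lambda>X. (\<Prod>a\<in>- \<Union>\<O>. u0 a (card (eig c X a))) * ?E c X) -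
      (\<Sum>r\<in>R. avg c (\<lambda>X. (\<Prod>a\<in>- \<Union>\<O>. u1 r a (card (eig c X a))) * ?E c X)))
    \<longlonglongrightarrow> (\<Prod>a\<in>- \<Union>\<O>. suminf (A0 a)) * ?t ^ card \<O> -
      (\<Sum>r\<in>R. (\<Prod>a\<in>- \<Union>\<O>. suminf (A1 r a)) * ?t ^ card \<O>)"
    by (intro tendsto_diff tendsto_sum lim0 lim1)
  also have "(\<lambda>c. avg c (\<lambda>X. (\<Prod>a\<in>- \<Union>\<O>. u0 a (card (eig c X a))) * ?E c X) -
      (\<Sum>r\<in>R. avg c (\<lambda>X. (\<Prod>a\<in>- \<Union>\<O>. u1 r a (card (eig c X a))) * ?E c X))) =
    (\<lambda>c. avg c (\<lambda>X. (\<Prod>a\<in>?U. u a (card (eig c X a))) *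
      (\<Prod>R\<in>insert R \<O>. 1 - of_bool (simple_on c X R))))"
  proof (rule ext)
    fix c
    have p0: "(\<Prod>a\<in>- \<Union>\<O>. u0 a (card (eig c X a))) = (\<Prod>a\<in>?U. u a (card (eig c X a)))" for X
      unfolding split using U(2) by (auto simp: u0_def intro!: prod.cong)
    have p1: "(\<Sum>r\<in>R. \<Prod>a\<in>- \<Union>\<O>. u1 r a (card (eig c X a))) =
        (\<Prod>a\<in>?U. u a (card (eig c X a))) * of_bool (simple_on c X R)" for X
      unfolding split of_bool_simple_on[OF finite[of R]] sum_distrib_left
      using U(2) by (intro sum.cong refl arg_cong2[where f = "(*)"] prod.cong) (auto simp: u1_def)
    have "avg c (\<lambda>X. (\<Prod>a\<in>- \<Union>\<O>. u0 a (card (eig c X a))) * ?E c X) -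
        (\<Sum>r\<in>R. avg c (\<lambda>X. (\<Prod>a\<in>- \<Union>\<O>. u1 r a (card (eig c X a))) * ?E c X)) =
      avg c (\<lambda>X. (\<Prod>a\<in>- \<Union>\<O>. u0 a (card (eig c X a))) * ?E c X -
        (\<Sum>r\<in>R. \<Prod>a\<in>- \<Union>\<O>. u1 r a (card (eig c X a))) * ?E c X)"
      by (simp add: avg_diff avg_sum sum_distrib_right)
    also have "\<dots> = avg c (\<lambda>X. (\<Prod>a\<in>?U. u a (card (eig c X a))) *
        (\<Prod>R\<in>insert R \<O>. 1 - of_bool (simple_on c X R)))"
      unfolding p0 p1 prod.insert[OF insert.hyps] by (simp add: algebra_simps)
    finally show "avg c (\<lambda>X. (\<Prod>a\<in>- \<Union>\<O>. u0 a (card (eig c X a))) * ?E c X) -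
        (\<Sum>r\<in>R. avg c (\<lambda>X. (\<Prod>a\<in>- \<Union>\<O>. u1 r a (card (eig c X a))) * ?E c X)) =
      avg c (\<lambda>X. (\<Prod>a\<in>?U. u a (card (eig c X a))) *
        (\<Prod>R\<in>insert R \<O>. 1 - of_bool (simple_on c X R)))" .
  qed
  also have "(\<Prod>a\<in>- \<Union>\<O>. suminf (A0 a)) * ?t ^ card \<O> -
      (\<Sum>r\<in>R. (\<Prod>a\<in>- \<Union>\<O>. suminf (A1 r a)) * ?t ^ card \<O>) =
    (\<Prod>a\<in>?U. suminf (A a)) * ?t ^ card (insert R \<O>)"
  proof -
    have "suminf (\<lambda>k. of_bool (k = 0) :: real) = 1"
      using suminf_finite[of "{0}" "\<lambda>k. of_bool (k = 0) :: real"] by simp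
    then have q0: "(\<Prod>a\<in>- \<Union>\<O>. suminf (A0 a)) = (\<Prod>a\<in>?U. suminf (A a))"
      unfolding split using U(2) by (auto simp: A0_def intro!: prod.cong)
    have q1: "(\<Prod>a\<in>- \<Union>\<O>. suminf (A1 r a)) = (\<Prod>a\<in>?U. suminf (A a)) * (?L1 * ?L0 ^ (b - 1))"
      if r: "r \<in> R" for r
    proof -
      have "(\<Prod>a\<in>R. suminf (A1 r a)) = ?L1 * (\<Prod>a\<in>R - {r}. ?L0)"
        using r by (subst prod.remove[of R r]) (auto simp: A1_def)
      also have "(\<Prod>a\<in>R - {r}. ?L0) = ?L0 ^ (b - 1)" using r cardR by simp
      finally show ?thesis unfolding split using U(2)
        by (intro arg_cong2[where f = "(*)"] prod.cong) (auto simp: A1_def)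
    qed
    show ?thesis
      using insert.hyps by (simp add: q0 q1 cardR algebra_simps)
  qed
  finally show ?case .
qed

section \<open>Frobenius orbits\<close>

lemma prime_CHAR_finite_field: "prime CHAR('a::{field,finite})"
  using prime_CHAR_semidom[where 'a = 'a] finite_imp_CHAR_pos[where 'a = 'a] by simp

lemma power_card_field:
  fixes x :: "'a::{field,finite}"
  shows "x ^ CARD('a) = x"
proof (cases "x = 0")
  case True
  then show ?thesis using card_field_ge_2[where 'k = 'a] by (simp add: power_0_left)
next
  case False
  have "(\<Prod>y\<in>UNIV - {0}. x * y) = (\<Prod>y\<in>UNIV - {0}. y)"
    by (rule prod.reindex_bij_witness[of _ "\<lambda>y. y / x" "\<lambda>y. x * y"]) (use False in auto)
  then have "x ^ (CARD('a) - 1) * \<Prod>(UNIV - {0}) = \<Prod>(UNIV - {0})"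
    by (simp add: prod.distrib)
  then have "x ^ (CARD('a) - 1) = 1" by simp
  then have "x ^ Suc (CARD('a) - 1) = x" unfolding power_Suc by (simp only: mult_1_right)
  moreover have "Suc (CARD('a) - 1) = CARD('a)" using card_field_ge_2[where 'k = 'a] by simp
  ultimately show ?thesis by argo
qed

text \<open>An additive subgroup of order a power of the characteristic is enlarged by adjoining an
  element until it is the whole field.\<close>

lemma card_field_power_CHAR:
  obtains n where "CARD('a::{field,finite}) = CHAR('a) ^ n"
proof -
  let ?p = "CHAR('a)"
  have p: "prime ?p" by (rule prime_CHAR_finite_field)
  have "\<exists>n. CARD('a) = ?p ^ n"
    if "0 \<in> G" "\<And>x y. x \<in> G \<Longrightarrow> y \<in> G \<Longrightarrow> x + y \<in> G" "card G = ?p ^ k" for G :: "'a set" and k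
    using that
  proof (induction "CARD('a) - card G" arbitrary: G k rule: less_induct)
    case less
    show ?case
    proof (cases "G = UNIV")
      case True
      then show ?thesis using less.prems(3) by auto
    next
      case False
      then obtain w where w: "w \<notin> G" by auto
      have mult: "of_nat n * x \<in> G" if "x \<in> G" for n x
        using that less.prems(1,2) by (induction n) (auto simp: algebra_simps)
      \<comment> \<open>Closure under negation follows from closure under addition, as
        \<open>- x\<close> is the sum of \<open>CHAR('a) - 1\<close> copies of
        \<open>x\<close>.\<close>
      have minus: "- x \<in> G" if "x \<in> G" for x
      proof -
        have "of_nat (Suc (?p - 1)) = (0 :: 'a)" using prime_gt_0_nat[OF p] by simp
        then have "(1 + of_nat (?p - 1)) * x = 0" by simp
        then have "of_nat (?p - 1) * x = - x"
          unfolding distrib_right by (simp add: eq_neg_iff_add_eq_0 add.commute)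
        then show ?thesis using mult[OF that, of "?p - 1"] by simp
      qed
      let ?f = "\<lambda>(i, g). of_nat i * w + g"
      define G' where "G' = ?f ` (UNIV \<times> G)"
      have "inj_on ?f ({..<?p} \<times> G)"
      proof -
        \<comment> \<open>A coincidence would put the \<open>(j - i)\<close>-fold multiple of
          \<open>w\<close> into \<open>G\<close>; as \<open>j - i\<close> is invertible modulo the
          characteristic, \<open>w\<close> itself would lie in \<open>G\<close>.\<close>
        have aux: False if "i < j" "j < ?p" "g \<in> G" "g' \<in> G" "of_nat i * w + g = of_nat j * w + g'" for i j g g'
        proof -
          have "of_nat (j - i) * w = g + - g'"
            using that by (simp add: of_nat_diff algebra_simps)
          then have "of_nat (j - i) * w \<in> G"
            using less.prems(2)[OF that(3) minus[OF that(4)]] by (simp only:)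
          moreover have "coprime (j - i) ?p"
            using that p by (metis coprime_commute diff_is_0_eq less_imp_diff_less linorder_not_less
                nat_dvd_not_less prime_imp_coprime zero_less_diff)
          then obtain m where m: "[(j - i) * m = Suc 0] (mod ?p)" using cong_solve_coprime_nat by blast
          then have "of_nat (m * (j - i)) = (1 :: 'a)"
            using of_nat_eq_iff_cong_CHAR[where 'a = 'a, of "(j - i) * m" 1] by (simp add: mult.commute)
          then have "of_nat m * (of_nat (j - i) * w) = w" by (simp flip: mult.assoc)
          ultimately show False using mult w by metis
        qed
        show ?thesis
        proof (rule inj_onI, clarify)
          fix i g j g' assume *: "i < ?p" "j < ?p" "g \<in> G" "g' \<in> G" "of_nat i * w + g = of_nat j * w + g'"
          have "i = j" using aux[of i j g g'] aux[of j i g' g] * by (metis linorder_neqE_nat)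
          then show "i = j \<and> g = g'" using * by simp
        qed
      qed
      moreover have "G' = ?f ` ({..<?p} \<times> G)"
      proof
        show "G' \<subseteq> ?f ` ({..<?p} \<times> G)"
        proof
          fix x assume "x \<in> G'"
          then obtain i g where x: "x = of_nat i * w + g" "g \<in> G" by (auto simp: G'_def)
          moreover have "of_nat (i mod ?p) = (of_nat i :: 'a)"
            using of_nat_eq_iff_cong_CHAR[where 'a = 'a, of "i mod ?p" i] by (simp add: cong_def)
          ultimately have "x = ?f (i mod ?p, g)" by simp
          moreover have "(i mod ?p, g) \<in> {..<?p} \<times> G" using x(2) prime_gt_0_nat[OF p] by simp
          ultimately show "x \<in> ?f ` ({..<?p} \<times> G)" by (rule image_eqI)
        qed
      qed (auto simp: G'_def)
      ultimately have card': "card G' = ?p * card G"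
        by (simp add: card_image card_cartesian_product)
      have "card G > 0" using less.prems(1) by (auto simp: card_gt_0_iff)
      then have "card G < card G'" using card' prime_gt_1_nat[OF p] by simp
      moreover have "card G' \<le> CARD('a)" by (intro card_mono) auto
      ultimately have lt: "CARD('a) - card G' < CARD('a) - card G" by linarith
      show ?thesis
      proof (rule less.hyps[OF lt])
        show "0 \<in> G'" using less.prems(1) by (force simp: G'_def intro!: image_eqI[of _ _ "(0, 0)"])
        show "x + y \<in> G'" if xy: "x \<in> G'" "y \<in> G'" for x y
        proof -
          obtain i g j g' where "x = of_nat i * w + g" "y = of_nat j * w + g'" "g \<in> G" "g' \<in> G"
            using xy by (auto simp: G'_def)
          then have "x + y = ?f (i + j, g + g')" "g + g' \<in> G"
            using less.prems(2) by (auto simp: algebra_simps)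
          then show ?thesis unfolding G'_def by blast
        qed
        show "card G' = ?p ^ Suc k" using card' less.prems(3) by simp
      qed
    qed
  qed
  from this[of "{0}" 0] show thesis using that by auto
qed

section \<open>The Frobenius map on the larger field and its orbits\<close>

locale finite_field_ext = field_hom h
  for h :: "'f::{field,finite} \<Rightarrow> 'k::{field,finite}" +
  fixes q b :: nat
  assumes card_base: "CARD('f) = q" and card_ext: "CARD('k) = q ^ b"
begin

lemma q_ge_2: "q \<ge> 2"
  using card_field_ge_2[where 'k = 'f] by (simp add: card_base)

interpretation mp: map_poly_inj_idom_hom h ..

text \<open>The homomorphism \<open>h\<close> preserves \<open>of_nat\<close>, so both fields have
  the same characteristic, and \<open>q\<close> is a power of it.\<close>

lemma freshmans_dream_ext: "(x + y :: 'k) ^ q = x ^ q + y ^ q"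
proof -
  have "CHAR('k) dvd CHAR('f)"
    using hom_of_nat[of "CHAR('f)"] by (simp flip: of_nat_eq_0_iff_char_dvd)
  then have "CHAR('k) = CHAR('f)"
    using prime_CHAR_finite_field[where 'a = 'f] prime_CHAR_finite_field[where 'a = 'k]
    by (simp add: primes_dvd_imp_eq)
  moreover obtain n where "q = CHAR('f) ^ n"
    using card_field_power_CHAR[where 'a = 'f] card_base by metis
  ultimately show ?thesis
    using freshmans_dream'[of q n x y] prime_CHAR_finite_field[where 'a = 'k] by simp
qed

sublocale frob: field_hom "\<lambda>x :: 'k. x ^ q"
  using q_ge_2
  by unfold_locales (auto simp: freshmans_dream_ext power_mult_distrib power_0_left)

text \<open>The polynomial \<open>X ^ q - X\<close> has at most \<open>q\<close> roots, and the
  \<open>q\<close> elements of \<open>range h\<close> are among them.\<close>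

lemma frob_fixed_iff: "x ^ q = x \<longleftrightarrow> x \<in> range h"
proof -
  let ?p = "monom 1 q - [:0, 1:] :: 'k poly"
  note q = q_ge_2
  then have "coeff ?p q = 1" by (auto simp: coeff_pCons split: nat.splits)
  then have nz: "?p \<noteq> 0" by (metis coeff_0 zero_neq_one)
  have "degree ?p \<le> q" using q by (intro degree_diff_le) (auto simp: degree_monom_le)
  have roots: "{x. poly ?p x = 0} = {x. x ^ q = x}" by (auto simp: poly_monom)
  have "range h \<subseteq> {x. x ^ q = x}"
    using power_card_field[where 'a = 'f] by (auto simp: card_base simp flip: hom_power)
  moreover have "card {x :: 'k. x ^ q = x} \<le> card (range h)"
    using card_poly_roots_bound[OF nz] \<open>degree ?p \<le> q\<close> unfolding roots
    by (simp add: card_image inj_f card_base)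
  ultimately have "range h = {x. x ^ q = x}" by (intro card_seteq) auto
  then show ?thesis by auto
qed

definition orbit :: "'k \<Rightarrow> 'k set" where
  "orbit x = range (\<lambda>i. x ^ (q ^ i))"

lemma self_in_orbit: "x \<in> orbit x"
  unfolding orbit_def by (rule range_eqI[of _ _ 0]) simp

lemma orbit_closed: "y \<in> orbit x \<Longrightarrow> y ^ (q ^ i) \<in> orbit x"
  unfolding orbit_def by (auto simp flip: power_mult power_add)

lemma power_q_power_b: "x ^ (q ^ b) = (x :: 'k)"
  using power_card_field[of x] by (simp add: card_ext)

lemma power_q_power_mult_b: "x ^ (q ^ (b * j)) = (x :: 'k)"
proof (induction j)
  case (Suc j)
  have "x ^ (q ^ (b * Suc j)) = (x ^ (q ^ b)) ^ (q ^ (b * j))"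
    by (simp add: power_add flip: power_mult)
  then show ?case using Suc by (simp add: power_q_power_b)
qed simp

lemma b_pos: "b > 0"
  using card_ext card_field_ge_2[where 'k = 'k] by (cases b) auto

lemma orbit_eq_if_mem:
  assumes "y \<in> orbit x"
  shows "orbit y = orbit x"
proof
  show "orbit y \<subseteq> orbit x" using orbit_closed[OF assms] by (auto simp: orbit_def[of y])
  from assms obtain i where i: "y = x ^ (q ^ i)" by (auto simp: orbit_def)
  \<comment> \<open>Another \<open>b * i - i\<close> Frobenius steps lead from \<open>y\<close> back
    to \<open>x\<close>, as \<open>b * i\<close> steps are the identity.\<close>
  have "i \<le> b * i" using b_pos by simp
  then have "y ^ (q ^ (b * i - i)) = x ^ (q ^ (b * i))"
    unfolding i by (simp flip: power_mult power_add)
  then have "x \<in> orbit y" using power_q_power_mult_b[of x i] orbit_closed[OF self_in_orbit] by metis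
  then show "orbit x \<subseteq> orbit y" using orbit_closed[of x y] by (auto simp: orbit_def[of x])
qed

lemma orbit_eq_image: "orbit x = (\<lambda>i. x ^ (q ^ i)) ` {..<b}"
proof
  show "orbit x \<subseteq> (\<lambda>i. x ^ (q ^ i)) ` {..<b}"
  proof
    fix y assume "y \<in> orbit x"
    then obtain i where i: "y = x ^ (q ^ i)" by (auto simp: orbit_def)
    have "y = (x ^ (q ^ (b * (i div b)))) ^ (q ^ (i mod b))"
      unfolding i by (simp flip: power_mult power_add)
    then have "y = x ^ (q ^ (i mod b))" unfolding power_q_power_mult_b .
    then show "y \<in> (\<lambda>i. x ^ (q ^ i)) ` {..<b}" using b_pos by auto
  qed
qed (auto simp: orbit_def)

lemma card_orbit_le: "card (orbit x) \<le> b"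
  unfolding orbit_eq_image using card_image_le[of "{..<b}"] by simp

text \<open>A coincidence among the first \<open>b\<close> conjugates gives a period
  \<open>d < b\<close>. Then \<open>b - d\<close> is a period too, and the smaller of the two is at
  most \<open>b div 2\<close>, which is what makes elements of short orbits rare.\<close>

lemma period_if_card_orbit_less:
  assumes "card (orbit x) < b"
  obtains d where "0 < d" "d \<le> b div 2" "x ^ (q ^ d) = x"
proof -
  from assms have "\<not> inj_on (\<lambda>i. x ^ (q ^ i)) {..<b}"
    unfolding orbit_eq_image by (auto dest: card_image)
  then obtain i j where "i < j" "j < b" "x ^ (q ^ i) = x ^ (q ^ j)"
    unfolding inj_on_def by (metis lessThan_iff linorder_neqE_nat)
  then have "x ^ (q ^ (j - i)) = x"
  proof -
    have "j + (b - i) = b + (j - i)" using \<open>i < j\<close> \<open>j < b\<close> by simp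
    then have "(x ^ (q ^ j)) ^ (q ^ (b - i)) = (x ^ (q ^ b)) ^ (q ^ (j - i))"
      by (simp only: power_mult[symmetric] power_add[symmetric])
    moreover have "(x ^ (q ^ i)) ^ (q ^ (b - i)) = x ^ (q ^ b)"
      using \<open>i < j\<close> \<open>j < b\<close> by (simp flip: power_mult power_add)
    ultimately show ?thesis using \<open>x ^ (q ^ i) = x ^ (q ^ j)\<close> power_q_power_b by simp
  qed
  define d where "d = j - i"
  have d: "0 < d" "d < b" "x ^ (q ^ d) = x"
    using \<open>i < j\<close> \<open>j < b\<close> \<open>x ^ (q ^ (j - i)) = x\<close> by (auto simp: d_def)
  show thesis
  proof (cases "d \<le> b div 2")
    case True
    then show ?thesis using that d by blast
  next
    case False
    have "d + (b - d) = b" using d by simp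
    then have "(x ^ (q ^ d)) ^ (q ^ (b - d)) = x ^ (q ^ b)"
      by (simp only: power_mult[symmetric] power_add[symmetric])
    then have "x ^ (q ^ (b - d)) = x ^ (q ^ b)" using d by simp
    then have "x ^ (q ^ (b - d)) = x" by (simp add: power_q_power_b)
    then show ?thesis using False d by (intro that[of "b - d"]) auto
  qed
qed

lemma root_orbit:
  assumes "poly (map_poly h p) x = 0" "y \<in> orbit x"
  shows "poly (map_poly h p) y = 0"
proof -
  have fixed: "map_poly (\<lambda>x. x ^ q) (map_poly h p) = map_poly h p"
    by (rule poly_eqI) (simp add: frob_fixed_iff)
  have "poly (map_poly h p) (x ^ (q ^ i)) = 0" for i
  proof (induction i)
    case (Suc i)
    have "poly (map_poly h p) ((x ^ (q ^ i)) ^ q) = poly (map_poly h p) (x ^ (q ^ i)) ^ q"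
      using frob.poly_map_poly[of "map_poly h p" "x ^ (q ^ i)"] unfolding fixed .
    with Suc show ?case using q_ge_2
      by (simp add: power_0_left mult.commute flip: power_mult)
  qed (use assms in simp)
  then show ?thesis using assms(2) by (auto simp: orbit_def)
qed

section \<open>Orbits as root sets of irreducible polynomials\<close>

definition orbit_poly :: "'k \<Rightarrow> 'k poly" where
  "orbit_poly x = (\<Prod>y\<in>orbit x. [:- y, 1:])"

lemma poly_orbit_poly: "poly (orbit_poly x) y = 0 \<longleftrightarrow> y \<in> orbit x"
  by (auto simp: orbit_poly_def poly_prod)

lemma monic_orbit_poly: "monic (orbit_poly x)"
  unfolding orbit_poly_def by (rule monic_prod) auto

lemma degree_orbit_poly: "degree (orbit_poly x) = card (orbit x)"
  unfolding orbit_poly_def by (subst degree_prod_eq_sum_degree) auto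

text \<open>Frobenius permutes the roots and so fixes every coefficient; by
  \<open>frob_fixed_iff\<close> the coefficients come from the base field.\<close>

lemma orbit_poly_descends:
  obtains m :: "'f poly" where "map_poly h m = orbit_poly x"
proof -
  have bij: "bij_betw (\<lambda>y. y ^ q) (orbit x) (orbit x)"
  proof -
    have "(\<lambda>y. y ^ q) ` orbit x \<subseteq> orbit x" using orbit_closed[of _ x 1] by auto
    moreover have "inj_on (\<lambda>y. y ^ q) (orbit x)" using frob.inj_f by (rule inj_on_subset) auto
    ultimately show ?thesis by (simp add: bij_betw_def endo_inj_surj)
  qed
  interpret frob_poly: map_poly_inj_idom_hom "\<lambda>x :: 'k. x ^ q" ..
  have "map_poly (\<lambda>x. x ^ q) (orbit_poly x) = (\<Prod>y\<in>orbit x. [:- (y ^ q), 1:])"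
    unfolding orbit_poly_def frob_poly.hom_prod
    using frob.hom_uminus by (intro prod.cong) (auto simp: frob.map_poly_pCons_hom)
  also have "\<dots> = orbit_poly x"
    unfolding orbit_poly_def by (rule prod.reindex_bij_betw[OF bij])
  finally have "coeff (orbit_poly x) i ^ q = coeff (orbit_poly x) i" for i
    using frob.coeff_map_poly_hom[of "orbit_poly x" i] by simp
  then have "coeff (orbit_poly x) i \<in> range h" for i by (simp add: frob_fixed_iff)
  then have "h (inv_into UNIV h (coeff (orbit_poly x) i)) = coeff (orbit_poly x) i" for i
    by (simp add: f_inv_into_f)
  \<comment> \<open>\<open>coeff_map_poly\<close> needs a function that sends 0 to 0.\<close>
  moreover have "inv_into UNIV h 0 = 0" using Hilbert_Choice.inv_f_f[OF inj_f, of 0] by simp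
  ultimately have "map_poly h (map_poly (inv_into UNIV h) (orbit_poly x)) = orbit_poly x"
    by (intro poly_eqI) (simp add: coeff_map_poly)
  then show thesis by (rule that)
qed

lemma orbit_poly_minimal:
  assumes "poly (map_poly h p) x = 0" "p \<noteq> 0"
  shows "card (orbit x) \<le> degree p"
proof -
  have "card (orbit x) \<le> card {y. poly (map_poly h p) y = 0}"
    using root_orbit[OF assms(1)] assms(2) by (intro card_mono poly_roots_finite) auto
  also have "\<dots> \<le> degree (map_poly h p)" using assms(2) by (intro card_poly_roots_bound) simp
  finally show ?thesis by simp
qed

text \<open>In a factorisation one factor has \<open>x\<close> as a root, so its degree is already
  at least \<open>card (orbit x)\<close> and the other factor is constant.\<close>

lemma irreducible_if_orbit_poly:
  assumes m: "map_poly h m = orbit_poly x"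
  shows "irreducible m" "monic m" "degree m = card (orbit x)"
proof -
  show "monic m" using monic_orbit_poly[of x] unfolding m[symmetric] by simp
  show deg: "degree m = card (orbit x)" using degree_orbit_poly[of x] unfolding m[symmetric] by simp
  have pos: "card (orbit x) > 0" using self_in_orbit[of x] by (auto simp: card_gt_0_iff)
  have nz: "m \<noteq> 0" using deg pos by auto
  show "irreducible m"
  proof (rule irreducibleI)
    show "m \<noteq> 0" by fact
    show "\<not> m dvd 1" unfolding is_unit_iff_degree[OF nz] using deg pos by linarith
    fix r s assume rs: "m = r * s"
    then have nz': "r \<noteq> 0" "s \<noteq> 0" using nz by auto
    have "poly (map_poly h m) x = 0" unfolding m by (simp add: poly_orbit_poly self_in_orbit)
    then have "poly (map_poly h r) x = 0 \<or> poly (map_poly h s) x = 0"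
      unfolding rs by (simp add: mp.hom_mult)
    then have "card (orbit x) \<le> degree r \<or> card (orbit x) \<le> degree s"
      using nz' orbit_poly_minimal by blast
    moreover have "card (orbit x) = degree r + degree s"
      using deg nz' unfolding rs by (simp add: degree_mult_eq)
    ultimately show "r dvd 1 \<or> s dvd 1" using nz' by (auto simp: is_unit_iff_degree)
  qed
qed

text \<open>The remainder of \<open>f\<close> modulo the descended orbit polynomial also vanishes at
  \<open>x\<close>, and its degree is too small for that unless it is zero. So that polynomial
  divides \<open>f\<close>, and both are monic and irreducible.\<close>

lemma irreducible_with_root:
  assumes f: "irreducible f" "monic f" and x: "poly (map_poly h f) x = 0"
  shows "map_poly h f = orbit_poly x"
proof -
  obtain m where m: "map_poly h m = orbit_poly x" by (rule orbit_poly_descends)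
  note mm = irreducible_if_orbit_poly[OF m]
  have "m dvd f"
  proof -
    have "poly (map_poly h (f mod m)) x = 0"
    proof -
      have "map_poly h f = map_poly h (f div m) * map_poly h m + map_poly h (f mod m)"
        by (simp flip: mp.hom_mult mp.hom_add)
      moreover have "poly (orbit_poly x) x = 0" by (simp add: poly_orbit_poly self_in_orbit)
      ultimately show ?thesis using x by (simp add: m)
    qed
    then have "f mod m = 0"
      using orbit_poly_minimal[of "f mod m" x] mm degree_mod_less[of m f] by fastforce
    then show ?thesis by (simp add: dvd_eq_mod_eq_0)
  qed
  then obtain u where u: "f = m * u" unfolding dvd_def by blast
  have "\<not> m dvd 1" using mm(1) unfolding irreducible_def by blast
  then have "u dvd 1" using irreducibleD[OF f(1) u] by blast
  then obtain e where "u = [:e:]" by (metis is_unit_poly_iff)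
  moreover have "lead_coeff f = lead_coeff u" using mm(2) unfolding u by (simp add: lead_coeff_mult)
  ultimately have "u = 1" using f(2) by (simp add: one_pCons)
  then show ?thesis using u m by simp
qed

text \<open>Each such orbit is the root set of exactly one monic irreducible polynomial of degree
  \<open>b\<close> over the base field.\<close>

definition full_orbits :: "'k set set" where
  "full_orbits = orbit ` {x. card (orbit x) = b}"

lemma full_orbits_disjoint:
  "R \<in> full_orbits \<Longrightarrow> R' \<in> full_orbits \<Longrightarrow> R \<noteq> R' \<Longrightarrow> R \<inter> R' = {}"
  using orbit_eq_if_mem unfolding full_orbits_def by (metis (no_types, lifting) disjoint_iff imageE)

text \<open>An element outside the full orbits is fixed by the \<open>d\<close>-th iterate of
  Frobenius for some \<open>d\<close> between 1 and \<open>b div 2\<close>. Each \<open>d\<close>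
  accounts for at most \<open>q ^ d\<close> elements, the roots of \<open>X ^ (q ^ d) - X\<close>,
  and the geometric sum costs a factor 2.\<close>

lemma card_full_orbits:
  "b * card full_orbits \<le> q ^ b" "q ^ b \<le> b * card full_orbits + 2 * q ^ (b div 2)"
proof -
  have U: "\<Union>full_orbits = {x. card (orbit x) = b}"
  proof
    show "\<Union>full_orbits \<subseteq> {x. card (orbit x) = b}"
    proof
      fix y assume "y \<in> \<Union>full_orbits"
      then obtain x where "card (orbit x) = b" "y \<in> orbit x" unfolding full_orbits_def by blast
      then show "y \<in> {x. card (orbit x) = b}" using orbit_eq_if_mem by simp
    qed
    show "{x. card (orbit x) = b} \<subseteq> \<Union>full_orbits"
      using self_in_orbit unfolding full_orbits_def by blast
  qed
  have eq: "b * card full_orbits = card {x. card (orbit x) = b}"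
    unfolding U[symmetric]
    by (rule card_partition) (use full_orbits_disjoint in \<open>auto simp: full_orbits_def\<close>)
  show "b * card full_orbits \<le> q ^ b"
    unfolding eq card_ext[symmetric] by (intro card_mono) auto
  define Z where "Z d = {x :: 'k. x ^ (q ^ d) = x}" for d
  have Z: "card (Z d) \<le> q ^ d" if "d > 0" for d
  proof -
    let ?n = "q ^ d"
    let ?p = "monom 1 ?n - [:0, 1:] :: 'k poly"
    have "q ^ 1 \<le> ?n" using q_ge_2 that by (intro power_increasing) auto
    then have n: "?n \<ge> 2" using q_ge_2 by simp
    then have "coeff ?p ?n = 1" using that by (auto simp: coeff_pCons split: nat.splits)
    then have nz: "?p \<noteq> 0" by (metis coeff_0 zero_neq_one)
    have deg: "degree ?p \<le> ?n" using n by (intro degree_diff_le) (auto simp: degree_monom_le)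
    have "{x. poly ?p x = 0} = Z d" by (auto simp: poly_monom Z_def)
    then show ?thesis using card_poly_roots_bound[OF nz] deg by simp
  qed
  have "q ^ b = card (UNIV :: 'k set)" by (simp add: card_ext)
  also have "UNIV = {x. card (orbit x) = b} \<union> {x. card (orbit x) < b}"
    using card_orbit_le le_neq_implies_less by blast
  also have "card \<dots> \<le> card {x. card (orbit x) = b} + card {x. card (orbit x) < b}"
    by (rule card_Un_le)
  also have "card {x. card (orbit x) < b} \<le> card (\<Union>d\<in>{1..b div 2}. Z d)"
    by (intro card_mono subsetI) (auto simp: Z_def Suc_le_eq elim!: period_if_card_orbit_less)
  also have "\<dots> \<le> (\<Sum>d\<in>{1..b div 2}. card (Z d))" by (rule card_UN_le) simp
  also have "\<dots> \<le> (\<Sum>d\<in>{1..b div 2}. q ^ d)" by (intro sum_mono Z) simp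
  also have "\<dots> \<le> 2 * q ^ (b div 2)"
  proof -
    have "(\<Sum>d\<in>{1..m}. q ^ d) \<le> 2 * q ^ m" for m
    proof (induction m)
      case (Suc m)
      have "2 * q ^ m \<le> q ^ Suc m" unfolding power_Suc using q_ge_2 by (intro mult_right_mono) auto
      moreover have "(\<Sum>d\<in>{1..Suc m}. q ^ d) = (\<Sum>d\<in>{1..m}. q ^ d) + q ^ Suc m" by simp
      ultimately show ?case using Suc by linarith
    qed simp
    then show ?thesis .
  qed
  finally show "q ^ b \<le> b * card full_orbits + 2 * q ^ (b div 2)" unfolding eq by simp
qed

end

section \<open>Primary cyclic endomorphisms\<close>

locale vs_endo = vectorspace class_ring V
  for V :: "('f::field, 'v, 'm) module_scheme" +
  fixes T :: "'v \<Rightarrow> 'v"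
  assumes T_closed [simp]: "v \<in> carrier V \<Longrightarrow> T v \<in> carrier V"
    and T_add: "v \<in> carrier V \<Longrightarrow> w \<in> carrier V \<Longrightarrow> T (v \<oplus>\<^bsub>V\<^esub> w) = T v \<oplus>\<^bsub>V\<^esub> T w"
    and T_smult: "v \<in> carrier V \<Longrightarrow> T (a \<odot>\<^bsub>V\<^esub> v) = a \<odot>\<^bsub>V\<^esub> T v"
begin

lemma sm_closed [simp]: "v \<in> carrier V \<Longrightarrow> a \<odot>\<^bsub>V\<^esub> v \<in> carrier V"
  by (rule smult_closed) auto

lemma sm_add_left: "v \<in> carrier V \<Longrightarrow> (a + b) \<odot>\<^bsub>V\<^esub> v = a \<odot>\<^bsub>V\<^esub> v \<oplus>\<^bsub>V\<^esub> b \<odot>\<^bsub>V\<^esub> v"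
  using smult_l_distr[of a b v] by simp

lemma sm_add_right:
  "v \<in> carrier V \<Longrightarrow> w \<in> carrier V \<Longrightarrow> a \<odot>\<^bsub>V\<^esub> (v \<oplus>\<^bsub>V\<^esub> w) = a \<odot>\<^bsub>V\<^esub> v \<oplus>\<^bsub>V\<^esub> a \<odot>\<^bsub>V\<^esub> w"
  using smult_r_distr[of a v w] by simp

lemma sm_assoc: "v \<in> carrier V \<Longrightarrow> (a * b) \<odot>\<^bsub>V\<^esub> v = a \<odot>\<^bsub>V\<^esub> (b \<odot>\<^bsub>V\<^esub> v)"
  using smult_assoc1[of a b v] by simp

lemma sm_one [simp]: "v \<in> carrier V \<Longrightarrow> 1 \<odot>\<^bsub>V\<^esub> v = v"
  using smult_one[of v] by simp

lemma sm_zero_left [simp]: "v \<in> carrier V \<Longrightarrow> 0 \<odot>\<^bsub>V\<^esub> v = \<zero>\<^bsub>V\<^esub>"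
  using smult_l_null[of v] by simp

lemma sm_zero_right [simp]: "a \<odot>\<^bsub>V\<^esub> \<zero>\<^bsub>V\<^esub> = \<zero>\<^bsub>V\<^esub>"
  using smult_r_null[of a] by simp

lemma T_zero [simp]: "T \<zero>\<^bsub>V\<^esub> = \<zero>\<^bsub>V\<^esub>"
  using T_smult[of "\<zero>\<^bsub>V\<^esub>" 0] by simp

lemma T_funpow_closed [simp]: "v \<in> carrier V \<Longrightarrow> (T ^^ i) v \<in> carrier V"
  by (induction i) auto

lemma poly_endo_upto:
  assumes "degree p \<le> n" "v \<in> carrier V"
  shows "poly_endo V p T v = (\<Oplus>\<^bsub>V\<^esub>i\<in>{..n}. coeff p i \<odot>\<^bsub>V\<^esub> (T ^^ i) v)"
  using assms(1)
proof (induction n rule: dec_induct)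
  case base
  show ?case by (simp add: poly_endo_def)
next
  case (step n)
  have "coeff p (Suc n) = 0" using step by (intro coeff_eq_0) simp
  then show ?case
    using assms(2) step by (subst M.finsum_Suc) (auto simp: Pi_def M.finsum_closed)
qed

lemma poly_endo_closed [simp]: "v \<in> carrier V \<Longrightarrow> poly_endo V p T v \<in> carrier V"
  by (auto simp: poly_endo_def Pi_def intro!: M.finsum_closed)

lemma poly_endo_0 [simp]: "v \<in> carrier V \<Longrightarrow> poly_endo V 0 T v = \<zero>\<^bsub>V\<^esub>"
  by (simp add: poly_endo_def)

lemma T_finsum:
  assumes "\<And>i. g i \<in> carrier V"
  shows "T (\<Oplus>\<^bsub>V\<^esub>i\<in>{..n::nat}. g i) = (\<Oplus>\<^bsub>V\<^esub>i\<in>{..n}. T (g i))"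
  using assms by (induction n) (auto simp: M.finsum_Suc T_add Pi_def M.finsum_closed)

text \<open>Horner's recursion; the laws for sums and multiples of vectors and for products of
  polynomials follow from it by induction on the polynomial.\<close>

lemma poly_endo_pCons:
  assumes v: "v \<in> carrier V"
  shows "poly_endo V (pCons a p) T v = a \<odot>\<^bsub>V\<^esub> v \<oplus>\<^bsub>V\<^esub> T (poly_endo V p T v)"
proof -
  have "poly_endo V (pCons a p) T v = (\<Oplus>\<^bsub>V\<^esub>i\<in>{..Suc (degree p)}. coeff (pCons a p) i \<odot>\<^bsub>V\<^esub> (T ^^ i) v)"
    by (rule poly_endo_upto[OF degree_pCons_le v])
  also have "\<dots> = (\<Oplus>\<^bsub>V\<^esub>i\<in>{..degree p}. coeff p i \<odot>\<^bsub>V\<^esub> (T ^^ Suc i) v) \<oplus>\<^bsub>V\<^esub> a \<odot>\<^bsub>V\<^esub> v"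
    using v by (subst M.finsum_Suc2) (auto simp: Pi_def)
  also have "(\<Oplus>\<^bsub>V\<^esub>i\<in>{..degree p}. coeff p i \<odot>\<^bsub>V\<^esub> (T ^^ Suc i) v) = T (poly_endo V p T v)"
    unfolding poly_endo_def using v by (subst T_finsum) (auto simp: T_smult)
  finally show ?thesis using v by (simp add: M.a_comm)
qed

lemma poly_endo_add:
  assumes v: "v \<in> carrier V"
  shows "poly_endo V (p + r) T v = poly_endo V p T v \<oplus>\<^bsub>V\<^esub> poly_endo V r T v"
proof -
  let ?n = "max (degree p) (degree r)"
  have "poly_endo V (p + r) T v = (\<Oplus>\<^bsub>V\<^esub>i\<in>{..?n}. coeff p i \<odot>\<^bsub>V\<^esub> (T ^^ i) v \<oplus>\<^bsub>V\<^esub> coeff r i \<odot>\<^bsub>V\<^esub> (T ^^ i) v)"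
    using v by (subst poly_endo_upto[where n = ?n]) (auto simp: sm_add_left degree_add_le_max)
  also have "\<dots> = poly_endo V p T v \<oplus>\<^bsub>V\<^esub> poly_endo V r T v"
    using v by (subst M.finsum_addf) (auto simp: poly_endo_upto[where n = ?n])
  finally show ?thesis .
qed

lemma poly_endo_vadd:
  assumes "v \<in> carrier V" "w \<in> carrier V"
  shows "poly_endo V p T (v \<oplus>\<^bsub>V\<^esub> w) = poly_endo V p T v \<oplus>\<^bsub>V\<^esub> poly_endo V p T w"
proof (induction p)
  case (pCons c p)
  then show ?case using assms by (simp add: poly_endo_pCons sm_add_right T_add M.a_ac)
qed (use assms in simp)

lemma poly_endo_vsmult:
  assumes "v \<in> carrier V"
  shows "poly_endo V p T (a \<odot>\<^bsub>V\<^esub> v) = a \<odot>\<^bsub>V\<^esub> poly_endo V p T v"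
proof (induction p)
  case (pCons c p)
  then show ?case using assms
    by (simp add: poly_endo_pCons sm_add_right T_smult mult.commute flip: sm_assoc)
qed (use assms in simp)

lemma poly_endo_zero [simp]: "poly_endo V p T \<zero>\<^bsub>V\<^esub> = \<zero>\<^bsub>V\<^esub>"
  using poly_endo_vsmult[of "\<zero>\<^bsub>V\<^esub>" p 0] by simp

lemma poly_endo_smult:
  "v \<in> carrier V \<Longrightarrow> poly_endo V (Polynomial.smult a p) T v = a \<odot>\<^bsub>V\<^esub> poly_endo V p T v"
  by (induction p) (simp_all add: poly_endo_pCons sm_add_right T_smult sm_assoc)

lemma poly_endo_mult:
  assumes v: "v \<in> carrier V"
  shows "poly_endo V (p * r) T v = poly_endo V p T (poly_endo V r T v)"
proof (induction p)
  case (pCons c p)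
  then show ?case using v
    by (simp add: poly_endo_add poly_endo_pCons poly_endo_smult)
qed (use v in simp)

lemma poly_endo_1 [simp]: "v \<in> carrier V \<Longrightarrow> poly_endo V 1 T v = v"
  by (simp add: one_pCons poly_endo_pCons)

lemma poly_endo_linear_poly:
  "v \<in> carrier V \<Longrightarrow> poly_endo V [:a, 1:] T v = a \<odot>\<^bsub>V\<^esub> v \<oplus>\<^bsub>V\<^esub> T v"
  by (simp add: poly_endo_pCons)

lemma poly_endo_power:
  "v \<in> carrier V \<Longrightarrow> poly_endo V (f ^ n) T v = (poly_endo V f T ^^ n) v"
  by (induction n) (simp_all add: poly_endo_mult)

lemma poly_endo_minus_eq_0:
  assumes "v \<in> carrier V" "poly_endo V p T v = \<zero>\<^bsub>V\<^esub>" "poly_endo V r T v = \<zero>\<^bsub>V\<^esub>"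
  shows "poly_endo V (p - r) T v = \<zero>\<^bsub>V\<^esub>"
proof -
  have "poly_endo V (Polynomial.smult (-1) r) T v = \<zero>\<^bsub>V\<^esub>"
    unfolding poly_endo_smult[OF assms(1)] assms(3) by simp
  moreover have "p - r = p + Polynomial.smult (-1) r" by simp
  ultimately show ?thesis
    using poly_endo_add[OF assms(1), of p "Polynomial.smult (-1) r"] assms(2) by (simp only: M.l_zero M.zero_closed)
qed

lemma poly_endo_dvd:
  assumes "v \<in> carrier V" "poly_endo V p T v = \<zero>\<^bsub>V\<^esub>" "p dvd r"
  shows "poly_endo V r T v = \<zero>\<^bsub>V\<^esub>"
proof -
  from assms(3) obtain s where "r = s * p" unfolding dvd_def by (metis mult.commute)
  then show ?thesis using assms by (simp add: poly_endo_mult)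
qed

lemma finsum_swap:
  assumes "\<And>i j. g i j \<in> carrier V"
  shows "(\<Oplus>\<^bsub>V\<^esub>i\<in>{..<m::nat}. \<Oplus>\<^bsub>V\<^esub>j\<in>{..<n::nat}. g i j) = (\<Oplus>\<^bsub>V\<^esub>j\<in>{..<n}. \<Oplus>\<^bsub>V\<^esub>i\<in>{..<m}. g i j)"
proof (induction m)
  case 0
  show ?case by (simp add: M.finsum_zero)
next
  case (Suc m)
  have ins: "(\<Oplus>\<^bsub>V\<^esub>i\<in>{..<Suc m}. f i) = f m \<oplus>\<^bsub>V\<^esub> (\<Oplus>\<^bsub>V\<^esub>i\<in>{..<m}. f i)"
    if "\<And>i. f i \<in> carrier V" for f
    unfolding lessThan_Suc using that by (subst M.finsum_insert) auto
  have cl: "(\<Oplus>\<^bsub>V\<^esub>i\<in>{..<k::nat}. f i) \<in> carrier V" if "\<And>i. f i \<in> carrier V" for f k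
    using that by (intro M.finsum_closed) auto
  show ?case
    using assms Suc by (simp add: ins cl M.finsum_addf)
qed

lemma poly_endo_finsum:
  assumes "\<And>i. g i \<in> carrier V"
  shows "poly_endo V p T (\<Oplus>\<^bsub>V\<^esub>i\<in>{..<n::nat}. g i) = (\<Oplus>\<^bsub>V\<^esub>i\<in>{..<n}. poly_endo V p T (g i))"
proof (induction n)
  case (Suc n)
  then show ?case
    using assms unfolding lessThan_Suc
    by (subst (1 2) M.finsum_insert) (auto simp: poly_endo_vadd M.finsum_closed)
qed simp

lemma poly_endo_sum:
  assumes v: "v \<in> carrier V"
  shows "poly_endo V (\<Sum>i<n. p i) T v = (\<Oplus>\<^bsub>V\<^esub>i\<in>{..<n::nat}. poly_endo V (p i) T v)"
proof (induction n)
  case (Suc n)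
  have "(\<Oplus>\<^bsub>V\<^esub>i\<in>{..<Suc n}. poly_endo V (p i) T v) =
      poly_endo V (p n) T v \<oplus>\<^bsub>V\<^esub> (\<Oplus>\<^bsub>V\<^esub>i\<in>{..<n}. poly_endo V (p i) T v)"
    unfolding lessThan_Suc using v by (subst M.finsum_insert) auto
  then show ?case using v Suc by (simp add: poly_endo_add add.commute)
qed (use v in simp)

text \<open>Cayley-Hamilton: if \<open>M = X - A\<close> over the polynomial ring, then \<open>M\<close> annihilates the basis
  vectors, hence so does \<open>M * adj M = char_poly A\<close>.\<close>

lemma char_poly_annihilates_basis:
  assumes bs: "set bs \<subseteq> carrier V" and A: "represents V T bs A" and l: "l < length bs"
  shows "poly_endo V (char_poly A) T (bs ! l) = \<zero>\<^bsub>V\<^esub>"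
proof -
  let ?n = "length bs"
  \<comment> \<open>Padding with zero places \<open>w i\<close> in the carrier for every
    \<open>i\<close>, the form in which \<open>single\<close>, \<open>finsum_swap\<close> and
    \<open>poly_endo_finsum\<close> ask for closure.\<close>
  define w where "w i = (if i < ?n then bs ! i else \<zero>\<^bsub>V\<^esub>)" for i
  have w: "w i \<in> carrier V" for i using bs by (auto simp: w_def)
  have Ac: "A \<in> carrier_mat ?n ?n"
    and AT: "\<And>j. j < ?n \<Longrightarrow> T (bs ! j) = (\<Oplus>\<^bsub>V\<^esub>i\<in>{..<?n}. A $$ (i, j) \<odot>\<^bsub>V\<^esub> bs ! i)"
    using A by (auto simp: represents_def)
  define M where "M = char_poly_matrix A"
  define C where "C = adj_mat M"
  have Mc: "M \<in> carrier_mat ?n ?n" using Ac by (simp add: M_def)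
  have Cc: "C \<in> carrier_mat ?n ?n" and MC: "M * C = char_poly A \<cdot>\<^sub>m 1\<^sub>m ?n"
    using adj_mat[OF Mc] by (auto simp: C_def M_def char_poly_def)
  have single: "(\<Oplus>\<^bsub>V\<^esub>i\<in>{..<?n}. if i = j then f i else \<zero>\<^bsub>V\<^esub>) = f j"
    if "j < ?n" "\<And>i. f i \<in> carrier V" for j f
    using M.finsum_singleton[of j "{..<?n}" f] that by (auto simp: eq_commute[of j])
  \<comment> \<open>Column \<open>j\<close> of \<open>M\<close>, evaluated at \<open>T\<close> and
    applied to the basis, is the image of the \<open>j\<close>-th basis vector minus the expansion
    of that image.\<close>
  have col0: "(\<Oplus>\<^bsub>V\<^esub>i\<in>{..<?n}. poly_endo V (M $$ (i, j)) T (w i)) = \<zero>\<^bsub>V\<^esub>" if j: "j < ?n" for j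
  proof -
    have "poly_endo V (M $$ (i, j)) T (w i) =
        (if i = j then T (w i) else \<zero>\<^bsub>V\<^esub>) \<oplus>\<^bsub>V\<^esub> (-1) \<odot>\<^bsub>V\<^esub> (A $$ (i, j) \<odot>\<^bsub>V\<^esub> w i)" if "i < ?n" for i
      using that j Ac w[of i]
      by (auto simp: M_def char_poly_matrix_def poly_endo_pCons M.a_comm simp flip: sm_assoc)
    then have "(\<Oplus>\<^bsub>V\<^esub>i\<in>{..<?n}. poly_endo V (M $$ (i, j)) T (w i)) =
        (\<Oplus>\<^bsub>V\<^esub>i\<in>{..<?n}. (if i = j then T (w i) else \<zero>\<^bsub>V\<^esub>) \<oplus>\<^bsub>V\<^esub> (-1) \<odot>\<^bsub>V\<^esub> (A $$ (i, j) \<odot>\<^bsub>V\<^esub> w i))"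
      using w by (intro M.finsum_cong') auto
    also have "\<dots> = T (w j) \<oplus>\<^bsub>V\<^esub> (\<Oplus>\<^bsub>V\<^esub>i\<in>{..<?n}. (-1) \<odot>\<^bsub>V\<^esub> (A $$ (i, j) \<odot>\<^bsub>V\<^esub> w i))"
      using w j by (subst M.finsum_addf) (auto simp: single)
    also have "(\<Oplus>\<^bsub>V\<^esub>i\<in>{..<?n}. (-1) \<odot>\<^bsub>V\<^esub> (A $$ (i, j) \<odot>\<^bsub>V\<^esub> w i)) =
        (\<Oplus>\<^bsub>V\<^esub>i\<in>{..<?n}. poly_endo V [:-1:] T (A $$ (i, j) \<odot>\<^bsub>V\<^esub> w i))"
      using w by (intro M.finsum_cong') (auto simp: poly_endo_pCons)
    also have "\<dots> = poly_endo V [:-1:] T (\<Oplus>\<^bsub>V\<^esub>i\<in>{..<?n}. A $$ (i, j) \<odot>\<^bsub>V\<^esub> w i)"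
      using w by (intro poly_endo_finsum[symmetric]) auto
    also have "(\<Oplus>\<^bsub>V\<^esub>i\<in>{..<?n}. A $$ (i, j) \<odot>\<^bsub>V\<^esub> w i) = T (w j)"
    proof -
      have "(\<Oplus>\<^bsub>V\<^esub>i\<in>{..<?n}. A $$ (i, j) \<odot>\<^bsub>V\<^esub> w i) = (\<Oplus>\<^bsub>V\<^esub>i\<in>{..<?n}. A $$ (i, j) \<odot>\<^bsub>V\<^esub> bs ! i)"
        using bs nth_mem[of _ bs] by (intro M.finsum_cong') (auto simp: w_def subset_iff)
      then show ?thesis using AT[OF j] j by (simp add: w_def)
    qed
    also have "T (w j) \<oplus>\<^bsub>V\<^esub> poly_endo V [:-1:] T (T (w j)) = poly_endo V ([:1:] + [:-1:]) T (T (w j))"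
      using w by (subst poly_endo_add) (auto simp: poly_endo_pCons)
    also have "\<dots> = \<zero>\<^bsub>V\<^esub>" using w by simp
    finally show ?thesis .
  qed
  have "poly_endo V (char_poly A) T (w l) =
      (\<Oplus>\<^bsub>V\<^esub>i\<in>{..<?n}. poly_endo V ((M * C) $$ (i, l)) T (w i))"
  proof -
    have "(\<Oplus>\<^bsub>V\<^esub>i\<in>{..<?n}. poly_endo V ((M * C) $$ (i, l)) T (w i)) =
        (\<Oplus>\<^bsub>V\<^esub>i\<in>{..<?n}. if i = l then poly_endo V (char_poly A) T (w i) else \<zero>\<^bsub>V\<^esub>)"
      using w l by (intro M.finsum_cong') (auto simp: MC)
    then show ?thesis using w l by (simp add: single)
  qed
  \<comment> \<open>As polynomials in \<open>T\<close> commute, the entry of \<open>C\<close> is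
    applied last; after exchanging the sums, \<open>col0\<close> makes the inner one vanish.\<close>
  also have "\<dots> = (\<Oplus>\<^bsub>V\<^esub>i\<in>{..<?n}. \<Oplus>\<^bsub>V\<^esub>j\<in>{..<?n}. poly_endo V (C $$ (j, l)) T (poly_endo V (M $$ (i, j)) T (w i)))"
  proof (intro M.finsum_cong')
    fix i assume i: "i \<in> {..<?n}"
    have "(M * C) $$ (i, l) = (\<Sum>j<?n. C $$ (j, l) * M $$ (i, j))"
      using i l Mc Cc by (auto simp: scalar_prod_def atLeast0LessThan mult.commute intro!: sum.cong)
    then show "poly_endo V ((M * C) $$ (i, l)) T (w i) =
        (\<Oplus>\<^bsub>V\<^esub>j\<in>{..<?n}. poly_endo V (C $$ (j, l)) T (poly_endo V (M $$ (i, j)) T (w i)))"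
      using w by (simp add: poly_endo_sum poly_endo_mult)
  qed (use w in \<open>auto intro!: M.finsum_closed\<close>)
  also have "\<dots> = (\<Oplus>\<^bsub>V\<^esub>j\<in>{..<?n}. \<Oplus>\<^bsub>V\<^esub>i\<in>{..<?n}. poly_endo V (C $$ (j, l)) T (poly_endo V (M $$ (i, j)) T (w i)))"
    using w by (intro finsum_swap) auto
  also have "\<dots> = (\<Oplus>\<^bsub>V\<^esub>j\<in>{..<?n}. poly_endo V (C $$ (j, l)) T (\<Oplus>\<^bsub>V\<^esub>i\<in>{..<?n}. poly_endo V (M $$ (i, j)) T (w i)))"
    using w by (intro M.finsum_cong') (auto simp: poly_endo_finsum M.finsum_closed)
  also have "\<dots> = (\<Oplus>\<^bsub>V\<^esub>j\<in>{..<?n}. \<zero>\<^bsub>V\<^esub>)"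
    by (intro M.finsum_cong') (auto simp: col0)
  also have "\<dots> = \<zero>\<^bsub>V\<^esub>" by (simp add: M.finsum_zero)
  finally show ?thesis using l by (simp add: w_def)
qed

end

section \<open>Minimal and characteristic polynomials and primary components\<close>

lemma dvd_power_irreducible:
  fixes f m :: "'a::field poly"
  assumes f: "irreducible f" and m: "m dvd f ^ n"
  shows "\<exists>k\<le>n. \<exists>u. u dvd 1 \<and> m = u * f ^ k"
  using m
proof (induction n arbitrary: m)
  case 0
  then show ?case by auto
next
  case (Suc n)
  have prime: "prime_elem f" using f by (rule field_poly_irreducible_imp_prime)
  then have nz: "f \<noteq> 0" by auto
  from Suc.prems obtain r where r: "f * f ^ n = m * r" unfolding dvd_def by auto
  then have "f dvd m * r" unfolding dvd_def by metis
  then consider "f dvd r" | "f dvd m" using prime prime_elem_dvd_multD by blast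
  then show ?case
  proof cases
    case 1
    then obtain r' where "r = f * r'" unfolding dvd_def by blast
    then have "f * f ^ n = f * (m * r')" using r by (simp add: algebra_simps)
    then have "m dvd f ^ n" using nz unfolding dvd_def by auto
    then show ?thesis using Suc.IH le_SucI by blast
  next
    case 2
    then obtain m' where m': "m = f * m'" unfolding dvd_def by blast
    then have "f * f ^ n = f * (m' * r)" using r by (simp add: algebra_simps)
    then have "m' dvd f ^ n" using nz unfolding dvd_def by auto
    then obtain k u where "k \<le> n" "u dvd 1" "m' = u * f ^ k" using Suc.IH by blast
    then have "Suc k \<le> Suc n \<and> u dvd 1 \<and> m = u * f ^ Suc k" using m' by (simp add: algebra_simps)
    then show ?thesis by blast
  qed
qed

context vs_endo
begin

lemma finite_ordered_basis:
  assumes fin: "finite (carrier V)"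
  obtains bs where "ordered_basis V bs"
proof -
  have fd: "fin_dim"
    unfolding fin_dim_def
  proof (intro exI[of _ "carrier V"] conjI)
    show "gen_set (carrier V)"
      using in_own_span[of "carrier V"] span_is_subset2[of "carrier V"] by auto
  qed (use fin in auto)
  then obtain B where B: "finite B" "basis B" using finite_basis_exists by blast
  obtain bs where "set bs = B" "distinct bs" using finite_distinct_list[OF B(1)] by blast
  then show thesis using that B unfolding ordered_basis_def by blast
qed

lemma ordered_basis_carrier: "ordered_basis V bs \<Longrightarrow> set bs \<subseteq> carrier V"
  by (simp add: ordered_basis_def basis_def)

lemma ordered_basis_unique_coeffs:
  assumes "ordered_basis V bs" "v \<in> carrier V"
  shows "\<exists>!a. a \<in> set bs \<rightarrow>\<^sub>E UNIV \<and> lincomb a (set bs) = v"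
  using assms basis_criterion[of "set bs"] ordered_basis_carrier[OF assms(1)]
  by (simp add: ordered_basis_def)

lemma lincomb_nth:
  assumes "ordered_basis V bs"
  shows "lincomb a (set bs) = (\<Oplus>\<^bsub>V\<^esub>i\<in>{..<length bs}. a (bs ! i) \<odot>\<^bsub>V\<^esub> bs ! i)"
proof -
  have bs: "distinct bs" "set bs \<subseteq> carrier V"
    using assms ordered_basis_carrier by (auto simp: ordered_basis_def)
  have "inj_on ((!) bs) {..<length bs}" "(!) bs ` {..<length bs} = set bs"
    using bs(1) by (auto simp: inj_on_nth set_conv_nth)
  then show ?thesis
    unfolding lincomb_def using M.finsum_reindex[of "\<lambda>v. a v \<odot>\<^bsub>V\<^esub> v" "(!) bs" "{..<length bs}"] bs(2)
    by (auto simp: subset_iff)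
qed

lemma card_carrier_basis:
  assumes "ordered_basis V bs"
  shows "card (carrier V) = card (UNIV :: 'f set) ^ length bs"
proof -
  have "bij_betw (\<lambda>a. lincomb a (set bs)) (set bs \<rightarrow>\<^sub>E UNIV) (carrier V)"
    unfolding bij_betw_def
  proof
    have cl: "lincomb a (set bs) \<in> carrier V" for a
      using ordered_basis_carrier[OF assms] by (intro lincomb_closed) auto
    show "inj_on (\<lambda>a. lincomb a (set bs)) (set bs \<rightarrow>\<^sub>E UNIV)"
      using ordered_basis_unique_coeffs[OF assms cl] unfolding inj_on_def by blast
    show "(\<lambda>a. lincomb a (set bs)) ` (set bs \<rightarrow>\<^sub>E UNIV) = carrier V"
      using ordered_basis_unique_coeffs[OF assms] cl by blast
  qed
  from bij_betw_same_card[OF this] show ?thesis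
    using assms by (simp add: card_PiE distinct_card ordered_basis_def)
qed

lemma exists_represents:
  assumes "ordered_basis V bs"
  obtains A where "represents V T bs A"
proof -
  let ?n = "length bs"
  have "\<exists>a. (\<Oplus>\<^bsub>V\<^esub>i\<in>{..<?n}. a (bs ! i) \<odot>\<^bsub>V\<^esub> bs ! i) = T (bs ! j)" if "j < ?n" for j
  proof -
    have "T (bs ! j) \<in> carrier V"
      using ordered_basis_carrier[OF assms] that by (intro T_closed) (auto simp: subset_iff)
    then show ?thesis
      using ordered_basis_unique_coeffs[OF assms] unfolding lincomb_nth[OF assms] by blast
  qed
  then obtain a where a: "\<And>j. j < ?n \<Longrightarrow> (\<Oplus>\<^bsub>V\<^esub>i\<in>{..<?n}. a j (bs ! i) \<odot>\<^bsub>V\<^esub> bs ! i) = T (bs ! j)"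
    by metis
  have "represents V T bs (mat ?n ?n (\<lambda>(i, j). a j (bs ! i)))"
    unfolding represents_def
  proof (intro conjI allI impI)
    fix j assume j: "j < ?n"
    have "(\<Oplus>\<^bsub>V\<^esub>i\<in>{..<?n}. mat ?n ?n (\<lambda>(i, j). a j (bs ! i)) $$ (i, j) \<odot>\<^bsub>V\<^esub> bs ! i) =
        (\<Oplus>\<^bsub>V\<^esub>i\<in>{..<?n}. a j (bs ! i) \<odot>\<^bsub>V\<^esub> bs ! i)"
      using ordered_basis_carrier[OF assms] j nth_mem[of _ bs]
      by (intro M.finsum_cong') (auto simp: subset_iff)
    then show "T (bs ! j) = (\<Oplus>\<^bsub>V\<^esub>i\<in>{..<?n}. mat ?n ?n (\<lambda>(i, j). a j (bs ! i)) $$ (i, j) \<odot>\<^bsub>V\<^esub> bs ! i)"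
      using a[OF j] by simp
  qed simp
  then show thesis by (rule that)
qed

lemma char_poly_annihilates:
  assumes bs: "ordered_basis V bs" and A: "represents V T bs A"
  shows "annihilates V T (char_poly A)"
  unfolding annihilates_def
proof
  fix v assume v: "v \<in> carrier V"
  let ?n = "length bs"
  obtain a where a: "v = (\<Oplus>\<^bsub>V\<^esub>i\<in>{..<?n}. a (bs ! i) \<odot>\<^bsub>V\<^esub> bs ! i)"
    using ordered_basis_unique_coeffs[OF bs v] unfolding lincomb_nth[OF bs] by blast
  define w where "w i = (if i < ?n then bs ! i else \<zero>\<^bsub>V\<^esub>)" for i
  have w: "w i \<in> carrier V" for i using ordered_basis_carrier[OF bs] by (auto simp: w_def)
  have "v = (\<Oplus>\<^bsub>V\<^esub>i\<in>{..<?n}. a (bs ! i) \<odot>\<^bsub>V\<^esub> w i)"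
    unfolding a using ordered_basis_carrier[OF bs] nth_mem[of _ bs]
    by (intro M.finsum_cong') (auto simp: w_def subset_iff)
  then have "poly_endo V (char_poly A) T v =
      (\<Oplus>\<^bsub>V\<^esub>i\<in>{..<?n}. poly_endo V (char_poly A) T (a (bs ! i) \<odot>\<^bsub>V\<^esub> w i))"
    using w by (simp add: poly_endo_finsum)
  also have "\<dots> = (\<Oplus>\<^bsub>V\<^esub>i\<in>{..<?n}. \<zero>\<^bsub>V\<^esub>)"
  proof (intro M.finsum_cong')
    fix i assume "i \<in> {..<?n}"
    then have "poly_endo V (char_poly A) T (w i) = \<zero>\<^bsub>V\<^esub>"
      using char_poly_annihilates_basis[OF ordered_basis_carrier[OF bs] A] by (simp add: w_def)
    then show "poly_endo V (char_poly A) T (a (bs ! i) \<odot>\<^bsub>V\<^esub> w i) = \<zero>\<^bsub>V\<^esub>"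
      using w by (simp add: poly_endo_vadd poly_endo_vsmult)
  qed auto
  also have "\<dots> = \<zero>\<^bsub>V\<^esub>" by (simp add: M.finsum_zero)
  finally show "poly_endo V (char_poly A) T v = \<zero>\<^bsub>V\<^esub>" .
qed

text \<open>The properties hold for every ordered basis and every matrix representing
  \<open>T\<close> in it, hence for the pair behind the choice made by \<open>SOME\<close>. The last
  one recovers the degree from a cardinality.\<close>

lemma char_poly_endo_props:
  assumes fin: "finite (carrier V)"
  shows "monic (char_poly_endo V T)" "annihilates V T (char_poly_endo V T)"
    "card (carrier V) = card (UNIV :: 'f set) ^ degree (char_poly_endo V T)"
proof -
  obtain bs0 where "ordered_basis V bs0" by (rule finite_ordered_basis[OF fin])
  moreover then obtain A0 where "represents V T bs0 A0" by (rule exists_represents)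
  ultimately have "\<exists>p bs A. ordered_basis V bs \<and> represents V T bs A \<and> p = char_poly A" by blast
  from someI_ex[OF this] obtain bs A where
    bs: "ordered_basis V bs" and A: "represents V T bs A" and p: "char_poly_endo V T = char_poly A"
    unfolding char_poly_endo_def by blast
  have "A \<in> carrier_mat (length bs) (length bs)" using A by (simp add: represents_def)
  from degree_monic_char_poly[OF this]
  show "monic (char_poly_endo V T)"
    "card (carrier V) = card (UNIV :: 'f set) ^ degree (char_poly_endo V T)"
    using card_carrier_basis[OF bs] by (auto simp: p)
  show "annihilates V T (char_poly_endo V T)" unfolding p by (rule char_poly_annihilates[OF bs A])
qed

text \<open>The characteristic polynomial annihilates, so an annihilating polynomial of least degree
  exists and can be made monic. Two of them agree, since their leading terms cancel in the
  difference, whose degree would be too small; so \<open>THE\<close> has a unique witness.\<close>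

lemma min_poly_endo_props:
  assumes fin: "finite (carrier V)"
  defines "m \<equiv> min_poly_endo V T"
  shows "monic m" "annihilates V T m"
    "\<And>p. p \<noteq> 0 \<Longrightarrow> annihilates V T p \<Longrightarrow> degree m \<le> degree p"
    "\<And>p. monic p \<Longrightarrow> annihilates V T p \<Longrightarrow> degree p \<le> degree m \<Longrightarrow> p = m"
proof -
  let ?P = "\<lambda>m. monic m \<and> annihilates V T m \<and>
      (\<forall>p. p \<noteq> 0 \<longrightarrow> annihilates V T p \<longrightarrow> degree m \<le> degree p)"
  have uniq: "m1 = m2" if m1: "?P m1" and m2: "monic m2" "annihilates V T m2" "degree m2 \<le> degree m1"
    for m1 m2
  proof (rule ccontr)
    assume ne: "m1 \<noteq> m2"
    then have nz: "m1 - m2 \<noteq> 0" by simp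
    have "annihilates V T (m1 - m2)"
      using m1 m2(2) poly_endo_minus_eq_0 unfolding annihilates_def by blast
    then have *: "degree m1 \<le> degree (m1 - m2)" using m1 nz by blast
    have "m2 \<noteq> 0" using m2(1) by auto
    then have "degree m1 = degree m2" using m1 m2 by (intro antisym) auto
    then have "coeff (m1 - m2) (degree m1) = 0" using m1 m2(1) by simp
    moreover have "degree (m1 - m2) \<le> degree m1"
      using \<open>degree m1 = degree m2\<close> by (intro degree_diff_le) auto
    ultimately have "lead_coeff (m1 - m2) = 0" using * by (metis antisym)
    then show False using nz leading_coeff_neq_0 by blast
  qed
  obtain p0 where p0: "p0 \<noteq> 0" "annihilates V T p0"
      "\<And>p. p \<noteq> 0 \<Longrightarrow> annihilates V T p \<Longrightarrow> degree p0 \<le> degree p"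
  proof -
    have "char_poly_endo V T \<noteq> 0 \<and> annihilates V T (char_poly_endo V T)"
      using char_poly_endo_props[OF fin] by auto
    from ex_has_least_nat[of "\<lambda>p. p \<noteq> 0 \<and> annihilates V T p", OF this, of degree]
    show thesis using that by blast
  qed
  define s where "s = Polynomial.smult (inverse (lead_coeff p0)) p0"
  have Ps: "?P s"
    unfolding s_def using p0 poly_endo_smult by (auto simp: annihilates_def)
  have "\<exists>!m. ?P m"
  proof (rule ex1I[of _ s], rule Ps)
    fix m assume m: "?P m"
    have "s \<noteq> 0" using Ps by auto
    then have "degree m \<le> degree s" using m Ps by blast
    then show "m = s" using uniq[OF Ps, of m] m by blast
  qed
  then have Pm: "?P m" unfolding m_def min_poly_endo_def by (rule theI')
  then show "monic m" "annihilates V T m"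
    "\<And>p. p \<noteq> 0 \<Longrightarrow> annihilates V T p \<Longrightarrow> degree m \<le> degree p" by blast+
  show "p = m" if "monic p" "annihilates V T p" "degree p \<le> degree m" for p
    using uniq[OF Pm that] by simp
qed

lemma min_poly_endo_dvd:
  assumes fin: "finite (carrier V)" and p: "annihilates V T p"
  shows "min_poly_endo V T dvd p"
proof -
  let ?m = "min_poly_endo V T"
  note m = min_poly_endo_props[OF fin]
  have "annihilates V T (p mod ?m)"
    unfolding annihilates_def
  proof
    fix v assume v: "v \<in> carrier V"
    have "p mod ?m = p - ?m * (p div ?m)" by (simp add: minus_mult_div_eq_mod)
    moreover have "poly_endo V (?m * (p div ?m)) T v = \<zero>\<^bsub>V\<^esub>"
      using m(2) v by (intro poly_endo_dvd[OF v _ dvd_triv_left]) (auto simp: annihilates_def)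
    ultimately show "poly_endo V (p mod ?m) T v = \<zero>\<^bsub>V\<^esub>"
      using p v poly_endo_minus_eq_0[OF v] by (auto simp: annihilates_def)
  qed
  moreover have "?m \<noteq> 0" using m(1) by auto
  ultimately have "p mod ?m = 0"
    using m(3)[of "p mod ?m"] degree_mod_less[of ?m p] by fastforce
  then show ?thesis by (simp add: dvd_eq_mod_eq_0)
qed

text \<open>Both are monic and annihilate \<open>T\<close>, so they agree as soon as their degrees
  do, and the degree of the characteristic polynomial is visible in the cardinality of the
  space.\<close>

lemma min_poly_eq_char_poly_iff:
  assumes fin: "finite (carrier V)" and q: "card (UNIV :: 'f set) > 1"
  shows "min_poly_endo V T = char_poly_endo V T \<longleftrightarrow>
    card (carrier V) = card (UNIV :: 'f set) ^ degree (min_poly_endo V T)"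
  using char_poly_endo_props[OF fin] min_poly_endo_props(4)[OF fin, of "char_poly_endo V T"] q
  by auto

lemma subspace_vs_endo:
  assumes W: "W \<subseteq> carrier V" "\<zero>\<^bsub>V\<^esub> \<in> W" "\<And>v w. v \<in> W \<Longrightarrow> w \<in> W \<Longrightarrow> v \<oplus>\<^bsub>V\<^esub> w \<in> W"
    "\<And>a v. v \<in> W \<Longrightarrow> a \<odot>\<^bsub>V\<^esub> v \<in> W" "\<And>v. v \<in> W \<Longrightarrow> T v \<in> W"
  shows "vs_endo (V\<lparr>carrier := W\<rparr>) T"
    and "v \<in> W \<Longrightarrow> poly_endo (V\<lparr>carrier := W\<rparr>) p T v = poly_endo V p T v"
proof -
  have "submodule class_ring W V"
    using W by (simp add: submodule_def module_axioms)
  then have "VectorSpace.subspace class_ring W V"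
    by (simp add: VectorSpace.subspace_def vectorspace_axioms)
  then interpret W: vectorspace class_ring "V\<lparr>carrier := W\<rparr>" by (rule subspace_is_vs)
  show E: "vs_endo (V\<lparr>carrier := W\<rparr>) T"
    using W by unfold_locales (auto simp: T_add T_smult subset_iff)
  then interpret E: vs_endo "V\<lparr>carrier := W\<rparr>" T .
  show "poly_endo (V\<lparr>carrier := W\<rparr>) p T v = poly_endo V p T v" if "v \<in> W"
  proof (induction p)
    case 0
    then show ?case using that W(1) E.poly_endo_0[of v] by (simp add: subset_iff)
  next
    case (pCons a p)
    then show ?case
      using that W(1) E.poly_endo_pCons[of v a p] poly_endo_pCons[of v a p] by (auto simp: subset_iff)
  qed
qed

lemma ker_poly_endo_subspace:
  fixes p
  defines "W \<equiv> {v \<in> carrier V. poly_endo V p T v = \<zero>\<^bsub>V\<^esub>}"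
  shows "vs_endo (V\<lparr>carrier := W\<rparr>) T"
    and "v \<in> W \<Longrightarrow> poly_endo (V\<lparr>carrier := W\<rparr>) r T v = poly_endo V r T v"
proof -
  have inv: "T v \<in> W" if "v \<in> W" for v
  proof -
    have v: "v \<in> carrier V" "poly_endo V p T v = \<zero>\<^bsub>V\<^esub>" using that by (auto simp: W_def)
    have X: "poly_endo V [:0, 1:] T w = T w" if "w \<in> carrier V" for w
      using that by (simp add: poly_endo_pCons)
    have "poly_endo V p T (poly_endo V [:0, 1:] T v) = poly_endo V [:0, 1:] T (poly_endo V p T v)"
      using poly_endo_mult[OF v(1), of p "[:0, 1:]"] poly_endo_mult[OF v(1), of "[:0, 1:]" p]
      by (simp only: mult.commute)
    then show ?thesis using v X by (simp add: W_def)
  qed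
  have W: "W \<subseteq> carrier V" "\<zero>\<^bsub>V\<^esub> \<in> W" "\<And>v w. v \<in> W \<Longrightarrow> w \<in> W \<Longrightarrow> v \<oplus>\<^bsub>V\<^esub> w \<in> W"
    "\<And>a v. v \<in> W \<Longrightarrow> a \<odot>\<^bsub>V\<^esub> v \<in> W"
    by (auto simp: W_def poly_endo_vadd poly_endo_vsmult)
  show "vs_endo (V\<lparr>carrier := W\<rparr>) T"
    "v \<in> W \<Longrightarrow> poly_endo (V\<lparr>carrier := W\<rparr>) r T v = poly_endo V r T v"
    by (rule subspace_vs_endo[OF W inv]; assumption)+
qed

lemma primary_component_eq:
  "primary_component V T f = {v \<in> carrier V. poly_endo V (f ^ dim) T v = \<zero>\<^bsub>V\<^esub>}"
  by (auto simp: primary_component_def poly_endo_power)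

text \<open>Makes the exponent in the primary component at least 1, so that it contains the kernel
  of \<open>f\<close> itself.\<close>

lemma dim_pos:
  assumes "finite (carrier V)" "carrier V \<noteq> {\<zero>\<^bsub>V\<^esub>}"
  shows "dim > 0"
proof -
  obtain bs where bs: "ordered_basis V bs" by (rule finite_ordered_basis[OF assms(1)])
  have "dim = length bs"
    using bs dim_basis[of "set bs"] by (simp add: ordered_basis_def distinct_card)
  moreover have "length bs \<noteq> 0"
  proof
    assume "length bs = 0"
    then have "card (carrier V) = 1" using card_carrier_basis[OF bs] by simp
    then show False using assms(2) M.zero_closed by (metis card_1_singletonE singletonD)
  qed
  ultimately show ?thesis by simp
qed

text \<open>On \<open>W\<close> the minimal polynomial divides \<open>f ^ dim\<close>, so it is
  \<open>f ^ k\<close> for the least \<open>k\<close> such that \<open>f ^ k\<close> annihilates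
  \<open>W\<close>. Describing \<open>k\<close> by this property leaves only kernels and
  cardinalities, which can be carried over to the larger field.\<close>

lemma primary_cyclic_iff:
  fixes f :: "'f poly"
  assumes fin: "finite (carrier V)" and q: "card (UNIV :: 'f set) > 1"
    and f: "irreducible f" "monic f"
  defines "W \<equiv> {v \<in> carrier V. poly_endo V (f ^ dim) T v = \<zero>\<^bsub>V\<^esub>}"
  shows "primary_cyclic V T f \<longleftrightarrow> W \<noteq> {\<zero>\<^bsub>V\<^esub>} \<and>
    (\<exists>k\<le>dim. card W = card (UNIV :: 'f set) ^ (degree f * k) \<and>
       (\<forall>v\<in>W. poly_endo V (f ^ k) T v = \<zero>\<^bsub>V\<^esub>) \<and>
       (\<forall>j<k. \<exists>v\<in>W. poly_endo V (f ^ j) T v \<noteq> \<zero>\<^bsub>V\<^esub>))"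
proof -
  let ?W = "V\<lparr>carrier := W\<rparr>" and ?q = "card (UNIV :: 'f set)"
  interpret W: vs_endo ?W T unfolding W_def by (rule ker_poly_endo_subspace)
  have peW: "poly_endo ?W p T v = poly_endo V p T v" if "v \<in> W" for v p
    using that ker_poly_endo_subspace(2)[of v "f ^ dim" p] by (simp add: W_def)
  have ann: "annihilates ?W T p \<longleftrightarrow> (\<forall>v\<in>W. poly_endo V p T v = \<zero>\<^bsub>V\<^esub>)" for p
    by (simp add: annihilates_def peW)
  have finW: "finite (carrier ?W)" using fin by (simp add: W_def)
  let ?m = "min_poly_endo ?W T"
  note m = W.min_poly_endo_props[OF finW]
  have nz: "f \<noteq> 0" using f by auto
  obtain k where k: "k \<le> dim" "?m = f ^ k"
  proof -
    have "annihilates ?W T (f ^ dim)" unfolding ann by (simp add: W_def)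
    from dvd_power_irreducible[OF f(1) W.min_poly_endo_dvd[OF finW this]]
    obtain k u where ku: "k \<le> dim" "u dvd 1" "?m = u * f ^ k" by blast
    obtain e where e: "u = [:e:]" using ku(2) by (metis is_unit_poly_iff)
    have "lead_coeff ?m = e" unfolding ku(3) e by (simp add: lead_coeff_mult lead_coeff_power f(2))
    then have "u = 1" using m(1) e by (simp add: one_pCons)
    then show thesis using that ku by simp
  qed
  have degk: "degree (f ^ j) = degree f * j" for j using nz by (simp add: degree_power_eq)
  have degf: "degree f > 0"
    using f(1) nz unfolding irreducible_def by (auto simp: is_unit_iff_degree)
  have least: "(\<forall>v\<in>W. poly_endo V (f ^ k) T v = \<zero>\<^bsub>V\<^esub>)" "\<forall>j<k. \<exists>v\<in>W. poly_endo V (f ^ j) T v \<noteq> \<zero>\<^bsub>V\<^esub>"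
  proof -
    show "\<forall>v\<in>W. poly_endo V (f ^ k) T v = \<zero>\<^bsub>V\<^esub>" using m(2) unfolding k ann .
    show "\<forall>j<k. \<exists>v\<in>W. poly_endo V (f ^ j) T v \<noteq> \<zero>\<^bsub>V\<^esub>"
    proof (intro allI impI)
      fix j assume j: "j < k"
      show "\<exists>v\<in>W. poly_endo V (f ^ j) T v \<noteq> \<zero>\<^bsub>V\<^esub>"
      proof (rule ccontr)
        assume "\<not> (\<exists>v\<in>W. poly_endo V (f ^ j) T v \<noteq> \<zero>\<^bsub>V\<^esub>)"
        then have "annihilates ?W T (f ^ j)" unfolding ann by blast
        then have "degree ?m \<le> degree (f ^ j)" using m(3) nz by simp
        then show False using j degf by (simp add: k degk)
      qed
    qed
  qed
  have uniq: "k' = k" if "\<forall>v\<in>W. poly_endo V (f ^ k') T v = \<zero>\<^bsub>V\<^esub>"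
    "\<forall>j<k'. \<exists>v\<in>W. poly_endo V (f ^ j) T v \<noteq> \<zero>\<^bsub>V\<^esub>" for k'
    using that least by (metis linorder_neqE_nat)
  have "primary_cyclic V T f \<longleftrightarrow> W \<noteq> {\<zero>\<^bsub>V\<^esub>} \<and> ?m = char_poly_endo ?W T"
    by (simp add: primary_cyclic_def Let_def primary_component_eq W_def)
  also have "?m = char_poly_endo ?W T \<longleftrightarrow> card W = ?q ^ (degree f * k)"
    unfolding W.min_poly_eq_char_poly_iff[OF finW q] by (simp add: k degk)
  also have "\<dots> \<longleftrightarrow> (\<exists>k\<le>dim. card W = ?q ^ (degree f * k) \<and>
       (\<forall>v\<in>W. poly_endo V (f ^ k) T v = \<zero>\<^bsub>V\<^esub>) \<and>
       (\<forall>j<k. \<exists>v\<in>W. poly_endo V (f ^ j) T v \<noteq> \<zero>\<^bsub>V\<^esub>))"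
    using least uniq k(1) by metis
  finally show ?thesis .
qed

end

section \<open>Kernels of polynomials in a matrix\<close>

lemma restricted_space_simps [simp]:
  "carrier (restricted_space h c) = carrier_vec c" "\<zero>\<^bsub>restricted_space h c\<^esub> = 0\<^sub>v c"
  "v \<oplus>\<^bsub>restricted_space h c\<^esub> w = v + w" "a \<odot>\<^bsub>restricted_space h c\<^esub> v = h a \<cdot>\<^sub>v v"
  by (simp_all add: restricted_space_def)

lemma vs_endo_restricted_space:
  assumes "field_hom h" "X \<in> carrier_mat c c"
  shows "vs_endo (restricted_space h c) (row_action X)"
proof -
  interpret vectorspace class_ring "restricted_space h c"
    by (rule vectorspace_restricted_space[OF assms(1)])
  show ?thesis
    using assms(2) by unfold_locales (auto simp: row_action_add[of X c] row_action_smult[of X c])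
qed

lemma field_hom_ident: "field_hom (\<lambda>x :: 'k::field. x)"
  by unfold_locales auto

text \<open>The identity as homomorphism makes \<open>vs_endo\<close> available for \<open>X\<close>
  over its own field, in the same notation as over the subfield.\<close>

definition mat_poly_ker :: "nat \<Rightarrow> 'k::field mat \<Rightarrow> 'k poly \<Rightarrow> 'k vec set" where
  "mat_poly_ker c X p =
     {v \<in> carrier_vec c. poly_endo (restricted_space (\<lambda>x. x) c) p (row_action X) v = 0\<^sub>v c}"

locale square_matrix =
  fixes c :: nat and X :: "'k::{field,finite} mat"
  assumes X_carrier: "X \<in> carrier_mat c c"
begin

abbreviation T where "T \<equiv> row_action X"
abbreviation ev where "ev p v \<equiv> poly_endo (restricted_space (\<lambda>x. x) c) p T v"
abbreviation ker where "ker p \<equiv> mat_poly_ker c X p"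

sublocale E: vs_endo "restricted_space (\<lambda>x. x) c :: ('k, 'k vec) module" T
  by (rule vs_endo_restricted_space[OF field_hom_ident X_carrier])

lemma ev_closed: "v \<in> carrier_vec c \<Longrightarrow> ev p v \<in> carrier_vec c"
  using E.poly_endo_closed[of v p] by simp

lemma lin_closed_ker: "lin_closed c (ker p)"
  using E.poly_endo_vadd[of _ _ p] E.poly_endo_vsmult[of _ p] E.poly_endo_zero[of p]
  by (auto simp: lin_closed_def mat_poly_ker_def)

lemma finite_ker: "finite (ker p)"
  by (rule finite_lin_closed[OF lin_closed_ker])

lemma ker_dvd: "p dvd r \<Longrightarrow> ker p \<subseteq> ker r"
  using E.poly_endo_dvd[of _ p r] by (auto simp: mat_poly_ker_def)

text \<open>The polynomial \<open>r\<close> in \<open>X\<close> maps \<open>ker (p * r)\<close> into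
  \<open>ker p\<close>, and every nonempty fibre embeds into \<open>ker r\<close> by subtracting one
  of its elements.\<close>

lemma card_ker_mult: "card (ker (p * r)) \<le> card (ker p) * card (ker r)"
proof -
  define fib where "fib w = {v \<in> carrier_vec c. ev r v = w}" for w
  have fib: "card (fib w) \<le> card (ker r)" for w
  proof (cases "fib w = {}")
    case False
    then obtain v0 where v0: "v0 \<in> carrier_vec c" "ev r v0 = w" by (auto simp: fib_def)
    have "inj_on (\<lambda>v. v + (-1) \<cdot>\<^sub>v v0) (fib w)"
    proof (rule inj_onI)
      fix u v assume uv: "u \<in> fib w" "v \<in> fib w" "u + (-1) \<cdot>\<^sub>v v0 = v + (-1) \<cdot>\<^sub>v v0"
      then have d: "dim_vec u = c" "dim_vec v = c" by (auto simp: fib_def)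
      show "u = v"
      proof (rule eq_vecI)
        fix i assume "i < dim_vec v"
        then show "u $ i = v $ i" using arg_cong[OF uv(3), of "\<lambda>x. x $ i"] v0(1) d by simp
      qed (use d in simp)
    qed
    moreover have "(\<lambda>v. v + (-1) \<cdot>\<^sub>v v0) ` fib w \<subseteq> ker r"
    proof (rule image_subsetI)
      fix v assume v: "v \<in> fib w"
      then have "ev r (v + (-1) \<cdot>\<^sub>v v0) = w + (-1) \<cdot>\<^sub>v w"
        using E.poly_endo_vadd[of v "(-1) \<cdot>\<^sub>v v0" r] E.poly_endo_vsmult[of v0 r "-1"] v0
        by (simp add: fib_def)
      also have "\<dots> = 0\<^sub>v c" using ev_closed[OF v0(1), of r] v0(2) by (intro eq_vecI) auto
      finally show "v + (-1) \<cdot>\<^sub>v v0 \<in> ker r" using v v0 by (simp add: mat_poly_ker_def fib_def)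
    qed
    ultimately show ?thesis using card_inj_on_le finite_ker by blast
  qed simp
  have "ker (p * r) \<subseteq> (\<Union>w\<in>ker p. fib w)"
    using E.poly_endo_mult[of _ p r] ev_closed[of _ r] by (auto simp: mat_poly_ker_def fib_def)
  then have "card (ker (p * r)) \<le> card (\<Union>w\<in>ker p. fib w)"
    by (intro card_mono finite_UN_I finite_ker) (auto simp: fib_def)
  also have "\<dots> \<le> (\<Sum>w\<in>ker p. card (fib w))" by (rule card_UN_le[OF finite_ker])
  also have "\<dots> \<le> card (ker p) * card (ker r)" using sum_bounded_above[of "ker p", OF fib] by simp
  finally show ?thesis .
qed

lemma ker_1: "ker 1 = {0\<^sub>v c}"
  using E.poly_endo_1 by (auto simp: mat_poly_ker_def)

lemma card_ker_power: "card (ker (g ^ k)) \<le> card (ker g) ^ k"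
proof (induction k)
  case (Suc k)
  then show ?case using card_ker_mult[of g "g ^ k"]
    by (simp add: order_trans[OF _ mult_left_mono])
qed (simp add: ker_1)

lemma card_lin_closed_psubset:
  assumes "lin_closed c U" "lin_closed c U'" "U \<subset> U'"
  shows "CARD('k) * card U \<le> card (U' :: 'k vec set)"
proof -
  obtain v where v: "v \<in> U'" "v \<notin> U" using assms(3) by blast
  then have vc: "v \<in> carrier_vec c" using lin_closedD(2)[OF assms(2)] by blast
  have "CARD('k) * card U = card ((\<lambda>(a, u). a \<cdot>\<^sub>v v + u) ` (UNIV \<times> U))"
    by (rule card_line[OF assms(1) vc v(2), symmetric])
  also have "\<dots> \<le> card U'"
  proof (rule card_mono[OF finite_lin_closed[OF assms(2)]])
    show "(\<lambda>(a, u). a \<cdot>\<^sub>v v + u) ` (UNIV \<times> U) \<subseteq> U'"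
    proof (rule image_subsetI, clarify)
      fix a u assume "u \<in> U"
      then show "a \<cdot>\<^sub>v v + u \<in> U'"
        using v(1) assms(3) by (intro lin_closedD(4,5)[OF assms(2)]) auto
    qed
  qed
  finally show ?thesis .
qed

lemma lin_closed_0: "lin_closed c {0\<^sub>v c :: 'k vec}"
  using lin_closed_ker[of 1] unfolding ker_1 .

lemma card_lin_closed_ge:
  assumes "lin_closed c (U :: 'k vec set)" "U \<noteq> {0\<^sub>v c}"
  shows "CARD('k) \<le> card U"
  using card_lin_closed_psubset[OF lin_closed_0 assms(1)] assms lin_closedD(3)[OF assms(1)] by auto

lemma ker_power_stable:
  assumes "ker (g ^ j) = ker (g ^ Suc j)" "j \<le> i"
  shows "ker (g ^ i) = ker (g ^ j)"
  using assms(2)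
proof (induction i rule: dec_induct)
  case (step i)
  have "v \<in> ker (g ^ i)" if "v \<in> ker (g ^ Suc i)" for v
  proof -
    have v: "v \<in> carrier_vec c" using that by (simp add: mat_poly_ker_def)
    have "Suc i = Suc j + (i - j)" using step by simp
    then have "g ^ Suc i = g ^ Suc j * g ^ (i - j)" by (simp only: power_add)
    then have "ev (g ^ Suc i) v = ev (g ^ Suc j) (ev (g ^ (i - j)) v)"
      using E.poly_endo_mult[of v "g ^ Suc j" "g ^ (i - j)"] v by (simp only: restricted_space_simps)
    moreover have "ev (g ^ Suc i) v = 0\<^sub>v c" using that unfolding mat_poly_ker_def by blast
    ultimately have "ev (g ^ (i - j)) v \<in> ker (g ^ Suc j)"
      using ev_closed[OF v, of "g ^ (i - j)"] unfolding mat_poly_ker_def by simp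
    then have "ev (g ^ (i - j)) v \<in> ker (g ^ j)" using assms(1) by simp
    then have "ev (g ^ j * g ^ (i - j)) v = 0\<^sub>v c"
      using E.poly_endo_mult[of v "g ^ j" "g ^ (i - j)"] v by (simp add: mat_poly_ker_def)
    moreover have "g ^ j * g ^ (i - j) = g ^ i" using step(1) by (simp flip: power_add)
    ultimately show ?thesis using v unfolding mat_poly_ker_def by simp
  qed
  then have "ker (g ^ Suc i) = ker (g ^ i)" using ker_dvd[of "g ^ i" "g ^ Suc i"] by auto
  then show ?case using step by simp
qed simp

text \<open>The kernels of the powers of \<open>g\<close> grow by a factor of at least \<open>CARD('k)\<close> until they
  stabilise, and by a factor of at most the size of the first kernel.\<close>

lemma card_ker_iff_primary:
  fixes g :: "'k poly" and n :: nat
  defines "W \<equiv> ker (g ^ n)"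
  assumes n: "n > 0 \<or> carrier_vec c = {0\<^sub>v c :: 'k vec}"
  shows "(W \<noteq> {0\<^sub>v c} \<and> (\<exists>k\<le>n. card W = CARD('k) ^ k \<and> W \<subseteq> ker (g ^ k) \<and>
      (\<forall>j<k. \<not> W \<subseteq> ker (g ^ j)))) \<longleftrightarrow> card (ker g) = CARD('k)"
proof -
  let ?Q = "CARD('k)"
  have Q: "?Q \<ge> 2" by (rule card_field_ge_2)
  have mono: "ker (g ^ i) \<subseteq> ker (g ^ j)" if "i \<le> j" for i j
    by (rule ker_dvd) (simp add: le_imp_power_dvd that)
  have grow: "?Q * card (ker (g ^ j)) \<le> card (ker (g ^ Suc j))"
    if k: "k \<le> n" "\<forall>j<k. \<not> W \<subseteq> ker (g ^ j)" "j < k" for j k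
  proof (rule card_lin_closed_psubset[OF lin_closed_ker lin_closed_ker])
    \<comment> \<open>Equality at some \<open>j < k\<close> would persist up to \<open>n\<close> and
      give \<open>W \<subseteq> ker (g ^ j)\<close>.\<close>
    have "ker (g ^ j) \<noteq> ker (g ^ Suc j)"
      using ker_power_stable[of g j n] k by (auto simp: W_def)
    moreover have "ker (g ^ j) \<subseteq> ker (g ^ Suc j)" by (rule mono) simp
    ultimately show "ker (g ^ j) \<subset> ker (g ^ Suc j)" by blast
  qed
  show ?thesis
  proof
    assume L: "W \<noteq> {0\<^sub>v c} \<and> (\<exists>k\<le>n. card W = ?Q ^ k \<and> W \<subseteq> ker (g ^ k) \<and>
      (\<forall>j<k. \<not> W \<subseteq> ker (g ^ j)))"
    then obtain k where k: "k \<le> n" "card W = ?Q ^ k" "W \<subseteq> ker (g ^ k)" "\<forall>j<k. \<not> W \<subseteq> ker (g ^ j)"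
      by blast
    have Wk: "W = ker (g ^ k)" using k(3) mono[OF k(1)] by (auto simp: W_def)
    have "k \<noteq> 0" using Wk L ker_1 by auto
    then obtain k' where k': "k = Suc k'" by (cases k) auto
    \<comment> \<open>From \<open>ker g\<close> there are \<open>k - 1\<close> growth steps up to
      \<open>W\<close>, which leaves at most a factor \<open>CARD('k)\<close> for
      \<open>ker g\<close> itself.\<close>
    have "?Q ^ i * card (ker g) \<le> card (ker (g ^ Suc i))" if "i \<le> k'" for i
      using that
    proof (induction i)
      case (Suc i)
      have "?Q ^ Suc i * card (ker g) \<le> ?Q * card (ker (g ^ Suc i))" using Suc by simp
      also have "\<dots> \<le> card (ker (g ^ Suc (Suc i)))" by (rule grow[OF k(1,4)]) (use Suc.prems k' in simp)
      finally show ?case .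
    qed simp
    from this[of k'] have "?Q ^ k' * card (ker g) \<le> ?Q ^ k' * ?Q"
      using k(2) unfolding Wk k' by simp
    then have "card (ker g) \<le> ?Q" using Q by simp
    moreover have "ker g \<noteq> {0\<^sub>v c}"
    proof
      assume "ker g = {0\<^sub>v c}"
      then have "card W \<le> 1" using card_ker_power[of g n] by (simp add: W_def)
      moreover have "?Q \<le> card W" using L lin_closed_ker by (intro card_lin_closed_ge) (auto simp: W_def)
      ultimately show False using Q by simp
    qed
    ultimately show "card (ker g) = ?Q" using card_lin_closed_ge[OF lin_closed_ker, of g] by simp
  next
    assume R: "card (ker g) = ?Q"
    have ne: "ker g \<noteq> {0\<^sub>v c}" using R Q by auto
    then have "carrier_vec c \<noteq> {0\<^sub>v c :: 'k vec}"
      using lin_closedD(1,3)[OF lin_closed_ker[of g]] by auto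
    then have "1 \<le> n" using n by auto
    then have "ker g \<subseteq> W" using mono[of 1 n] by (simp add: W_def)
    then have Wne: "W \<noteq> {0\<^sub>v c}" using ne lin_closedD(3)[OF lin_closed_ker[of g]] by auto
    define k where "k = (LEAST k. W \<subseteq> ker (g ^ k))"
    have "W \<subseteq> ker (g ^ n)" by (simp add: W_def)
    then have k: "W \<subseteq> ker (g ^ k)" "k \<le> n" unfolding k_def by (rule LeastI, rule Least_le)
    have least: "\<forall>j<k. \<not> W \<subseteq> ker (g ^ j)" unfolding k_def using not_less_Least by blast
    have Wk: "W = ker (g ^ k)" using k mono[OF k(2)] by (auto simp: W_def)
    have "?Q ^ i \<le> card (ker (g ^ i))" if "i \<le> k" for i
      using that
    proof (induction i)
      case (Suc i)
      have "?Q ^ Suc i \<le> ?Q * card (ker (g ^ i))" using Suc by simp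
      also have "\<dots> \<le> card (ker (g ^ Suc i))" by (rule grow[OF k(2) least]) (use Suc.prems in simp)
      finally show ?case .
    qed (simp add: ker_1)
    then have "card W = ?Q ^ k" using card_ker_power[of g k] R by (simp add: Wk antisym)
    then show "W \<noteq> {0\<^sub>v c} \<and> (\<exists>k\<le>n. card W = ?Q ^ k \<and> W \<subseteq> ker (g ^ k) \<and>
      (\<forall>j<k. \<not> W \<subseteq> ker (g ^ j)))" using Wne k least by blast
  qed
qed

lemma ev_eig: "v \<in> eig c X a \<Longrightarrow> ev p v = poly p a \<cdot>\<^sub>v v"
proof (induction p)
  case 0
  then show ?case using E.poly_endo_0[of v] by (auto simp: eig_def intro!: eq_vecI)
next
  case (pCons r p)
  then have v: "v \<in> carrier_vec c" "T v = a \<cdot>\<^sub>v v" by (auto simp: eig_def)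
  have "ev (pCons r p) v = r \<cdot>\<^sub>v v + T (ev p v)" using E.poly_endo_pCons[of v r p] v by simp
  also have "T (ev p v) = poly p a \<cdot>\<^sub>v (a \<cdot>\<^sub>v v)"
    using pCons v row_action_smult[OF X_carrier v(1)] by simp
  finally show ?case using v
    by (simp add: smult_smult_assoc add_smult_distrib_vec mult.commute)
qed

lemma eig_subset_ker: "poly p a = 0 \<Longrightarrow> eig c X a \<subseteq> ker p"
  using ev_eig[of _ a p] by (auto simp: mat_poly_ker_def eig_def intro!: eq_vecI)

lemma ker_linear: "ker [:- a, 1:] = eig c X a"
proof -
  have "ev [:- a, 1:] v = 0\<^sub>v c \<longleftrightarrow> T v = a \<cdot>\<^sub>v v" if v: "v \<in> carrier_vec c" for v
  proof -
    have Tv: "T v \<in> carrier_vec c" using X_carrier by simp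
    have "ev [:- a, 1:] v = - a \<cdot>\<^sub>v v + T v" using E.poly_endo_linear_poly[of v "- a"] v by simp
    moreover have "- a * x + y = 0 \<longleftrightarrow> y = a * x" for x y
      by (metis add.inverse_inverse add_eq_0_iff mult_minus_left)
    then have "- a \<cdot>\<^sub>v v + T v = 0\<^sub>v c \<longleftrightarrow> T v = a \<cdot>\<^sub>v v"
      using v Tv by (simp add: vec_eq_iff)
    ultimately show ?thesis by simp
  qed
  then show ?thesis by (auto simp: mat_poly_ker_def eig_def)
qed

lemma ker_prod_trivial:
  assumes "finite S" "\<And>a. a \<in> S \<Longrightarrow> card (eig c X a) = 1"
  shows "ker (\<Prod>a\<in>S. [:- a, 1:]) = {0\<^sub>v c}"
  using assms
proof (induction S rule: finite_induct)
  case (insert a S)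
  have "card (ker ([:- a, 1:] * (\<Prod>a\<in>S. [:- a, 1:]))) \<le> card (ker [:- a, 1:]) * card (ker (\<Prod>a\<in>S. [:- a, 1:]))"
    by (rule card_ker_mult)
  also have "\<dots> \<le> 1" using insert by (simp add: ker_linear)
  finally have "card (ker (\<Prod>a\<in>insert a S. [:- a, 1:])) < CARD('k)"
    using insert.hyps card_field_ge_2[where 'k = 'k] by simp
  then show ?case using card_lin_closed_ge[OF lin_closed_ker] by fastforce
qed (simp add: ker_1)

text \<open>In the submultiplicative upper bound the factor of the single eigenvalue contributes
  \<open>CARD('k)\<close> and the others contribute 1; the eigenspace itself gives the lower
  bound.\<close>

lemma simple_on_card_ker:
  assumes "finite R" "simple_on c X R"
  shows "card (ker (\<Prod>a\<in>R. [:- a, 1:])) = CARD('k)"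
proof -
  obtain a where a: "a \<in> R" "card (eig c X a) = CARD('k)" "\<And>b. b \<in> R - {a} \<Longrightarrow> card (eig c X b) = 1"
    using assms(2) by (auto simp: simple_on_def)
  have "(\<Prod>a\<in>R. [:- a, 1:]) = (\<Prod>b\<in>R - {a}. [:- b, 1:]) * [:- a, 1:]"
    using prod.remove[OF assms(1) a(1)] by (simp only: mult.commute)
  then have "card (ker (\<Prod>a\<in>R. [:- a, 1:])) \<le> card (ker (\<Prod>b\<in>R - {a}. [:- b, 1:])) * card (ker [:- a, 1:])"
    using card_ker_mult[of "\<Prod>b\<in>R - {a}. [:- b, 1:]" "[:- a, 1:]"] by (simp only:)
  also have "\<dots> = CARD('k)" using ker_prod_trivial[of "R - {a}"] a assms(1) by (simp add: ker_linear)
  finally have "card (ker (\<Prod>a\<in>R. [:- a, 1:])) \<le> CARD('k)" .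
  moreover have "card (eig c X a) \<le> card (ker (\<Prod>a\<in>R. [:- a, 1:]))"
    using a(1) assms(1) by (intro card_mono finite_ker eig_subset_ker) (auto simp: poly_prod)
  ultimately show ?thesis using a(2) by simp
qed

text \<open>A kernel of this size is a line that \<open>X\<close> preserves, so its generator is an
  eigenvector to some \<open>a\<close>, and \<open>ev_eig\<close> makes \<open>a\<close> a root of
  \<open>g\<close>. Eigenvectors to any root lie in the same line and therefore have eigenvalue
  \<open>a\<close>.\<close>

lemma card_ker_simple_root:
  assumes card_ker: "card (ker g) = CARD('k)"
  obtains a where "poly g a = 0" "simple_on c X {y. poly g y = 0}"
proof -
  have "ker g \<noteq> {0\<^sub>v c}" using card_ker card_field_ge_2[where 'k = 'k] by auto
  then obtain v where v: "v \<in> ker g" "v \<noteq> 0\<^sub>v c"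
    using lin_closedD(3)[OF lin_closed_ker[of g]] by auto
  then have vc: "v \<in> carrier_vec c" by (simp add: mat_poly_ker_def)
  have full: "U = ker g" if "lin_closed c U" "U \<subseteq> ker g" "U \<noteq> {0\<^sub>v c}" for U
    using that card_lin_closed_ge[OF that(1,3)] card_ker by (intro card_seteq finite_ker) auto
  have "lin_span c [v] = ker g"
  proof (rule full)
    show "lin_closed c (lin_span c [v])" by (rule lin_closed_lin_span) (simp add: vc)
    show "lin_span c [v] \<subseteq> ker g" using v by (intro lin_span_subset lin_closed_ker) auto
    have "v \<in> lin_span c [v]" using set_subset_lin_span[of "[v]" c] vc by (simp del: lin_span.simps)
    then show "lin_span c [v] \<noteq> {0\<^sub>v c}" using v(2) by (metis singletonD)
  qed
  then have span: "\<exists>r. w = r \<cdot>\<^sub>v v" if "w \<in> ker g" for w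
    using that vc by force
  have "T v \<in> ker g"
  proof -
    have Tv: "T v \<in> carrier_vec c" using X_carrier by simp
    have X: "ev [:0, 1:] w = T w" if "w \<in> carrier_vec c" for w
    proof -
      have "dim_vec (T w) = c" using row_action_carrier[OF X_carrier, of w] by simp
      then have "0 \<cdot>\<^sub>v w + T w = T w" using that by (intro eq_vecI) auto
      then show ?thesis using E.poly_endo_linear_poly[of w 0] that by simp
    qed
    have "ev g (ev [:0, 1:] v) = ev [:0, 1:] (ev g v)"
      using E.poly_endo_mult[of v g "[:0, 1:]"] E.poly_endo_mult[of v "[:0, 1:]" g] vc
      by (simp only: mult.commute restricted_space_simps)
    then have "ev g (T v) = T (0\<^sub>v c)" using v X vc by (simp add: mat_poly_ker_def)
    also have "T (0\<^sub>v c) = 0\<^sub>v c" using E.T_zero by simp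
    finally show ?thesis using Tv by (simp add: mat_poly_ker_def)
  qed
  then obtain a where a: "T v = a \<cdot>\<^sub>v v" using span by blast
  then have va: "v \<in> eig c X a" using vc by (simp add: eig_def)
  have smult_0: "r = 0" if "r \<cdot>\<^sub>v v = 0\<^sub>v c" for r
  proof (rule ccontr)
    assume "r \<noteq> 0"
    then have "v = inverse r \<cdot>\<^sub>v (r \<cdot>\<^sub>v v)" using vc by (simp add: smult_smult_assoc)
    also have "\<dots> = 0\<^sub>v c" unfolding that by (intro eq_vecI) auto
    finally show False using v(2) by simp
  qed
  have "poly g a \<cdot>\<^sub>v v = 0\<^sub>v c" using ev_eig[OF va, of g] v by (simp add: mat_poly_ker_def)
  then have root: "poly g a = 0" by (rule smult_0)
  have "simple_on c X {y. poly g y = 0}"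
    unfolding simple_on_def
  proof (intro bexI conjI ballI)
    show "a \<in> {y. poly g y = 0}" using root by simp
    have "eig c X a = ker g"
      using va v by (intro full lin_closed_eig X_carrier eig_subset_ker root) auto
    then show "card (eig c X a) = CARD('k)" using card_ker by simp
    fix y assume y: "y \<in> {y. poly g y = 0} - {a}"
    have "eig c X y = {0\<^sub>v c}"
    proof (rule antisym)
      show "eig c X y \<subseteq> {0\<^sub>v c}"
      proof
        fix w assume w: "w \<in> eig c X y"
        then have "w \<in> ker g" using eig_subset_ker[of g y] y by auto
        then obtain r where r: "w = r \<cdot>\<^sub>v v" using span by blast
        have "(y - a) * r = 0"
        proof (rule smult_0)
          have "y \<cdot>\<^sub>v w = T w" using w by (simp add: eig_def)
          also have "\<dots> = r \<cdot>\<^sub>v (a \<cdot>\<^sub>v v)" unfolding r a[symmetric] by (rule row_action_smult[OF X_carrier vc])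
          finally have "y \<cdot>\<^sub>v (r \<cdot>\<^sub>v v) = r \<cdot>\<^sub>v (a \<cdot>\<^sub>v v)" unfolding r .
          then show "((y - a) * r) \<cdot>\<^sub>v v = 0\<^sub>v c" using vc by (auto simp: vec_eq_iff algebra_simps)
        qed
        then have "r = 0" using y by simp
        then show "w \<in> {0\<^sub>v c}" using r vc by (auto intro!: eq_vecI)
      qed
    qed (use lin_closedD(3)[OF lin_closed_eig[OF X_carrier]] in auto)
    then show "card (eig c X y) = 1" by simp
  qed
  with root show thesis by (rule that)
qed

end

section \<open>Comparison of the two fields\<close>

context finite_field_ext
begin

lemma poly_endo_restricted_space:
  assumes X: "X \<in> carrier_mat c c" and v: "v \<in> carrier_vec c"
  shows "poly_endo (restricted_space h c) p (row_action X) v =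
    poly_endo (restricted_space (\<lambda>x. x) c) (map_poly h p) (row_action X) v"
proof -
  interpret F: vs_endo "restricted_space h c" "row_action X"
    by (rule vs_endo_restricted_space[OF field_hom_axioms X])
  interpret K: vs_endo "restricted_space (\<lambda>x. x) c :: ('k, 'k vec) module" "row_action X"
    by (rule vs_endo_restricted_space[OF field_hom_ident X])
  show ?thesis
  proof (induction p)
    case 0
    then show ?case using F.poly_endo_0[of v] K.poly_endo_0[of v] v by simp
  next
    case (pCons a p)
    then show ?case using F.poly_endo_pCons[of v a p] K.poly_endo_pCons[of v "h a" "map_poly h p"] v
      by (simp add: map_poly_pCons_hom)
  qed
qed

text \<open>As \<open>degree f = b\<close>, the size \<open>q ^ (degree f * k)\<close> in
  \<open>primary_cyclic_iff\<close> is \<open>CARD('k) ^ k\<close>. This turns the condition over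
  the base field into the one of \<open>card_ker_iff_primary\<close> over the extension.\<close>

lemma primary_cyclic_restricted_space_iff:
  assumes X: "X \<in> carrier_mat c c" and f: "irreducible f" "monic f" "degree f = b"
  shows "primary_cyclic (restricted_space h c) (row_action X) f \<longleftrightarrow>
    card (mat_poly_ker c X (map_poly h f)) = CARD('k)"
proof -
  interpret F: vs_endo "restricted_space h c" "row_action X"
    by (rule vs_endo_restricted_space[OF field_hom_axioms X])
  interpret square_matrix c X by unfold_locales (rule X)
  interpret mp: map_poly_inj_idom_hom h ..
  let ?g = "map_poly h f"
  have ker_eq: "{v \<in> carrier_vec c. poly_endo (restricted_space h c) (f ^ k) (row_action X) v = 0\<^sub>v c} = ker (?g ^ k)" for k
    using poly_endo_restricted_space[OF X, of _ "f ^ k"] by (auto simp: mat_poly_ker_def mp.hom_power)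
  have dim: "F.dim > 0 \<or> carrier_vec c = {0\<^sub>v c :: 'k vec}"
    using F.dim_pos by (cases "carrier_vec c = {0\<^sub>v c :: 'k vec}") simp_all
  have sub: "(\<forall>v\<in>ker (?g ^ F.dim). poly_endo (restricted_space h c) (f ^ k) (row_action X) v = 0\<^sub>v c) \<longleftrightarrow>
      ker (?g ^ F.dim) \<subseteq> ker (?g ^ k)" for k
    unfolding ker_eq[symmetric] by auto
  have "primary_cyclic (restricted_space h c) (row_action X) f \<longleftrightarrow>
    ker (?g ^ F.dim) \<noteq> {0\<^sub>v c} \<and> (\<exists>k\<le>F.dim. card (ker (?g ^ F.dim)) = CARD('k) ^ k \<and>
       ker (?g ^ F.dim) \<subseteq> ker (?g ^ k) \<and> (\<forall>j<k. \<not> ker (?g ^ F.dim) \<subseteq> ker (?g ^ j)))"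
    using F.primary_cyclic_iff[OF _ _ f(1,2)] card_field_ge_2[where 'k = 'f]
    by (simp add: ker_eq f(3) card_base card_ext power_mult flip: sub)
  also have "\<dots> \<longleftrightarrow> card (ker ?g) = CARD('k)" by (rule card_ker_iff_primary[OF dim])
  finally show ?thesis .
qed

text \<open>From left to right \<open>card_ker_simple_root\<close> produces a root in the extension,
  so the polynomial becomes an orbit polynomial there; conversely every full orbit supplies a
  polynomial by descent.\<close>

lemma pcb_eq: "pcb h b c = {X \<in> carrier_mat c c. \<exists>R\<in>full_orbits. simple_on c X R}"
proof -
  have "(\<exists>f. monic f \<and> irreducible f \<and> degree f = b \<and> primary_cyclic (restricted_space h c) (row_action X) f)
      \<longleftrightarrow> (\<exists>R\<in>full_orbits. simple_on c X R)" if X: "X \<in> carrier_mat c c" for X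
  proof -
    interpret square_matrix c X by unfold_locales (rule X)
    show ?thesis
    proof
      assume "\<exists>f. monic f \<and> irreducible f \<and> degree f = b \<and> primary_cyclic (restricted_space h c) (row_action X) f"
      then obtain f where f: "irreducible f" "monic f" "degree f = b" "card (ker (map_poly h f)) = CARD('k)"
        using primary_cyclic_restricted_space_iff[OF X] by blast
      obtain a where a: "poly (map_poly h f) a = 0" "simple_on c X {y. poly (map_poly h f) y = 0}"
        by (rule card_ker_simple_root[OF f(4)])
      have g: "map_poly h f = orbit_poly a" by (rule irreducible_with_root[OF f(1,2) a(1)])
      then have "card (orbit a) = b" using degree_orbit_poly[of a] f(3) by (simp flip: g)
      then have "orbit a \<in> full_orbits" by (simp add: full_orbits_def)
      moreover have "{y. poly (map_poly h f) y = 0} = orbit a" unfolding g by (simp add: poly_orbit_poly)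
      ultimately show "\<exists>R\<in>full_orbits. simple_on c X R" using a(2) by auto
    next
      assume "\<exists>R\<in>full_orbits. simple_on c X R"
      then obtain x where x: "card (orbit x) = b" "simple_on c X (orbit x)"
        by (auto simp: full_orbits_def)
      obtain m where m: "map_poly h m = orbit_poly x" by (rule orbit_poly_descends)
      have "card (ker (map_poly h m)) = CARD('k)"
        using simple_on_card_ker[OF _ x(2)] unfolding m orbit_poly_def by simp
      then show "\<exists>f. monic f \<and> irreducible f \<and> degree f = b \<and>
          primary_cyclic (restricted_space h c) (row_action X) f"
        using primary_cyclic_restricted_space_iff[OF X, of m] irreducible_if_orbit_poly[OF m] x(1) by auto
    qed
  qed
  then show ?thesis unfolding pcb_def by blast
qed

lemma pcb_proportion_eq:
  "pcb_proportion h b c = 1 - avg c (\<lambda>X :: 'k mat. \<Prod>R\<in>full_orbits. 1 - of_bool (simple_on c X R))"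
proof -
  let ?S = "\<lambda>X. \<exists>R\<in>full_orbits. simple_on c X R"
  have e: "(\<Prod>R\<in>full_orbits. 1 - of_bool (simple_on c X R)) = (1 - of_bool (?S X) :: real)" for X
    by (auto intro!: prod.neutral prod_zero)
  have "(\<Sum>X\<in>carrier_mat c c. of_bool (?S X) :: real) = real (card (pcb h b c))"
    unfolding pcb_eq using finite_carrier_mat[where 'k = 'k] by (simp add: sum_of_bool_eq Int_def)
  then show ?thesis
    unfolding e avg_diff pcb_proportion_def
    by (simp add: avg_def card_carrier_mat)
qed

lemma pcb_proportion_tendsto:
  defines "Q \<equiv> real (q ^ b)"
  shows "pcb_proportion h b \<longlonglongrightarrow>
    1 - (1 - b * (suminf (euler_coeff' Q) * suminf (euler_coeff Q) ^ (b - 1))) ^ card full_orbits"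
proof -
  \<comment> \<open>Eigenvalues outside the full orbits are left free by the constant function
    1.\<close>
  have "(\<lambda>c. avg c (\<lambda>X :: 'k mat. (\<Prod>a\<in>- \<Union>full_orbits. 1) *
      (\<Prod>R\<in>full_orbits. 1 - of_bool (simple_on c X R)))) \<longlonglongrightarrow>
    (\<Prod>a\<in>- \<Union>full_orbits. suminf (\<lambda>k. of_bool (k = 0))) *
      (1 - b * (suminf (euler_coeff' CARD('k)) * suminf (euler_coeff CARD('k)) ^ (b - 1))) ^ card full_orbits"
    by (rule avg_no_simple_on_tendsto)
      (use full_orbits_disjoint has_expansion_one in \<open>auto simp: full_orbits_def\<close>)
  moreover have "suminf (\<lambda>k. of_bool (k = 0) :: real) = 1"
    using suminf_finite[of "{0}" "\<lambda>k. of_bool (k = 0) :: real"] by simp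
  ultimately show ?thesis
    unfolding pcb_proportion_eq Q_def card_ext[symmetric] by (intro tendsto_diff tendsto_const) simp
qed

end

section \<open>Estimates for the limit\<close>

lemma two_mult_le_power: "b \<ge> 2 \<Longrightarrow> q \<ge> 2 \<Longrightarrow> 2 * b \<le> (q :: nat) ^ b"
proof (induction b rule: dec_induct)
  case base
  then show ?case using power_mono[of 2 q 2] by simp
next
  case (step b)
  then have "2 * Suc b \<le> 2 * (2 * b)" by simp
  also have "\<dots> \<le> q * q ^ b" using step by (intro mult_mono) auto
  finally show ?case by simp
qed

text \<open>With \<open>z = t / (1 - t)\<close> one has
  \<open>1 / (1 - t) = 1 + z \<le> exp z\<close>, so the power is at least
  \<open>exp (- (N * z))\<close>. The bound on \<open>N * t\<close> gives
  \<open>N * z \<le> 1 + z\<close>; then \<open>exp (- z) \<ge> 1 - z\<close>, and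
  \<open>z \<le> t + 2 * t\<^sup>2\<close> for \<open>t \<le> 1/2\<close>.\<close>

lemma one_minus_power_ge:
  fixes a t :: real
  assumes a: "a \<le> t" and t: "0 \<le> t" "t \<le> 1/2" and N: "real N * t \<le> 1"
  shows "(1 - a) ^ N \<ge> exp (-1) * (1 - t - 2 * t\<^sup>2)"
proof -
  define z where "z = t / (1 - t)"
  have z: "z \<le> t + 2 * t\<^sup>2"
  proof -
    have "0 \<le> t\<^sup>2 * (1 - 2 * t)" using t by simp
    then have "t \<le> (t + 2 * t\<^sup>2) * (1 - t)" by (simp add: algebra_simps power2_eq_square)
    then show ?thesis using t by (simp add: z_def divide_le_eq)
  qed
  have "1 - t - 2 * t\<^sup>2 \<le> 1 - z" using z by simp
  also have "\<dots> \<le> exp (- z)" using exp_ge_add_one_self[of "- z"] by simp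
  finally have "exp (-1) * (1 - t - 2 * t\<^sup>2) \<le> exp (-1) * exp (- z)" by simp
  also have "\<dots> = exp (- 1 - z)" by (simp flip: exp_add)
  also have "\<dots> \<le> exp (- (real N * z))"
  proof -
    have "real N * z = real N * t * (1 / (1 - t))" by (simp add: z_def)
    also have "\<dots> \<le> 1 * (1 / (1 - t))" using N t by (intro mult_right_mono) auto
    also have "\<dots> = 1 + z" using t by (simp add: z_def field_simps)
    finally show ?thesis by simp
  qed
  also have "\<dots> = exp (- z) ^ N" by (simp flip: exp_of_nat_mult)
  also have "\<dots> \<le> (1 - t) ^ N"
  proof (rule power_mono)
    have "1 / (1 - t) = 1 + z" using t by (simp add: z_def field_simps)
    also have "\<dots> \<le> exp z" by (rule exp_ge_add_one_self)
    finally have "1 / exp z \<le> 1 - t" using t by (simp add: divide_le_eq mult.commute)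
    then show "exp (- z) \<le> 1 - t" by (simp add: exp_minus inverse_eq_divide)
  qed simp
  also have "\<dots> \<le> (1 - a) ^ N" using a t by (intro power_mono) auto
  finally show ?thesis .
qed

text \<open>The numbers \<open>u\<close> and \<open>v\<close> bound the relative losses in the
  number of orbits and in the probability \<open>a\<close> for one orbit. For
  \<open>y \<ge> 3/5\<close> the right side exceeds 1 because \<open>exp 1 \<le> 3\<close>.
  Otherwise \<open>u + v \<le> 13/8 * y\<close> is below 1, where
  \<open>exp d \<le> 1 + d + d\<^sup>2\<close> holds and leaves room under the factor 4.\<close>

lemma one_minus_power_less:
  fixes a u v y :: real
  assumes a: "0 \<le> a" "a \<le> 1" and u: "0 \<le> u" "u \<le> y" and v: "0 \<le> v" "v \<le> 5/8 * y" and y: "0 < y"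
    and aN: "v \<le> 1 \<Longrightarrow> a * real N \<ge> (1 - u) * (1 - v)"
  shows "(1 - a) ^ N < exp (-1) * (1 + 4 * y)"
proof (cases "y \<ge> 3/5")
  case True
  have "(1 - a) ^ N \<le> 1" using a by (intro power_le_one) auto
  also have "1 < exp (-1) * (1 + 4 * y)"
  proof -
    have "exp 1 < 1 + 4 * y" using exp_le True by linarith
    then show ?thesis by (simp add: exp_minus field_simps)
  qed
  finally show ?thesis .
next
  case False
  define d where "d = u + v"
  have d: "0 \<le> d" "d \<le> 13/8 * y" "d \<le> 1" using u v False by (auto simp: d_def)
  have "1 - a \<le> exp (- a)" using exp_ge_add_one_self[of "- a"] by simp
  then have "(1 - a) ^ N \<le> exp (- a) ^ N" using a by (intro power_mono) auto
  also have "\<dots> = exp (- (a * real N))" by (simp add: mult.commute flip: exp_of_nat_mult)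
  also have "\<dots> \<le> exp (- 1 + d)"
  proof -
    have "a * real N \<ge> (1 - u) * (1 - v)" using v False by (intro aN) auto
    moreover have "(1 - u) * (1 - v) = 1 - d + u * v" by (simp add: d_def algebra_simps)
    moreover have "u * v \<ge> 0" using u v by simp
    ultimately show ?thesis by simp
  qed
  also have "\<dots> = exp (-1) * exp d" by (simp flip: exp_add)
  also have "\<dots> < exp (-1) * (1 + 4 * y)"
  proof -
    have "d\<^sup>2 \<le> d * 1" unfolding power2_eq_square using d by (intro mult_left_mono) auto
    have "d\<^sup>2 \<le> (13/8 * y)\<^sup>2" using d by (intro power_mono) auto
    also have "\<dots> = 169/64 * (y * y)" by (simp add: power2_eq_square)
    also have "\<dots> \<le> 169/64 * (3/5 * y)" using y False by (intro mult_left_mono mult_right_mono) auto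
    finally have "1 + d + d\<^sup>2 < 1 + 4 * y" using d y by simp
    moreover have "exp d \<le> 1 + d + d\<^sup>2" using d by (intro exp_bound) auto
    ultimately show ?thesis by simp
  qed
  finally show ?thesis .
qed

text \<open>The number \<open>a\<close> is the limiting probability that among \<open>b\<close> given eigenvalue candidates exactly
  one is an eigenvalue and that its eigenspace is a line; it equals
  \<open>b q\<^sup>-\<^sup>b \<omega>\<^sup>b / (1 - q\<^sup>-\<^sup>b)\<^sup>2\<close> in the notation of the paper.\<close>

lemma simple_root_probability_bounds:
  fixes Q :: real and b :: nat
  assumes Q: "Q \<ge> 2" and b: "b \<ge> 2"
  defines "a \<equiv> b * (suminf (euler_coeff' Q) * suminf (euler_coeff Q) ^ (b - 1))"
  shows "a \<le> b / Q" "a \<ge> b / Q * (1 - b * (1 / Q + 1 / Q\<^sup>2))" "a \<ge> 0"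
proof -
  define x where "x = 1 / Q"
  have x: "0 < x" "x \<le> 1/2" and Qx: "Q = 1 / x" using Q by (auto simp: x_def field_simps)
  let ?G = "euler_sum Q"
  have G: "?G \<le> 1" "?G * (1 - x) \<ge> 1 - (x + x\<^sup>2)"
  proof -
    show "?G \<le> 1" by (rule euler_sum_bounds(1)[OF Q])
    have "1 / (Q * (Q - 1)) = x\<^sup>2 / (1 - x)"
      using x by (simp add: Qx field_simps power2_eq_square)
    then have "?G \<ge> 1 - x\<^sup>2 / (1 - x)" using euler_sum_bounds(2)[OF Q] by simp
    then have "?G * (1 - x) \<ge> (1 - x\<^sup>2 / (1 - x)) * (1 - x)" using x by (intro mult_right_mono) auto
    also have "(1 - x\<^sup>2 / (1 - x)) * (1 - x) = 1 - (x + x\<^sup>2)" using x by (simp add: left_diff_distrib)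
    finally show "?G * (1 - x) \<ge> 1 - (x + x\<^sup>2)" .
  qed
  have xx: "x + x\<^sup>2 \<le> 1"
    using x mult_mono[of x "1/2" x "1/2"] by (simp add: power2_eq_square)
  have G0: "?G \<ge> 0"
  proof -
    have "0 \<le> ?G * (1 - x)" using G(2) xx by linarith
    then show ?thesis using x by (simp add: zero_le_mult_iff)
  qed
  \<comment> \<open>One factor \<open>1 - x\<close> of the power with exponent \<open>b - 1\<close>
    cancels against the denominator coming from \<open>euler_coeff'\<close>, so the exponent
    \<open>m = b - 2\<close> remains.\<close>
  obtain m where m: "b = Suc (Suc m)" using b by (metis Suc_le_D numeral_2_eq_2 Suc_le_mono)
  have Q1: "1 / (Q - 1) = x / (1 - x)" using x by (simp add: Qx field_simps)
  have eq: "a = b * x * (?G ^ b * (1 - x) ^ m)"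
  proof -
    have "suminf (euler_coeff' Q) = ?G * (x / (1 - x))"
      unfolding suminf_euler_coeff'[OF Q] Q1[symmetric] by simp
    moreover have "suminf (euler_coeff Q) = (1 - x) * ?G"
      unfolding suminf_euler_coeff[OF Q] x_def ..
    ultimately have "a = b * (?G * (x / (1 - x)) * ((1 - x) * ?G) ^ Suc m)"
      unfolding a_def m by simp
    also have "\<dots> = b * x * (?G ^ b * (1 - x) ^ m)"
      using x by (simp add: m power_mult_distrib)
    finally show ?thesis .
  qed
  have nn: "0 \<le> ?G ^ b * (1 - x) ^ m" using G0 x by simp
  have le1: "?G ^ b * (1 - x) ^ m \<le> 1"
    using G G0 x by (intro mult_le_one power_le_one) auto
  have bx: "real b * x \<ge> 0" using x by simp
  show "a \<ge> 0" unfolding eq using bx nn by (rule mult_nonneg_nonneg)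
  show "a \<le> b / Q" unfolding eq using mult_left_mono[OF le1 bx] by (simp add: x_def)
  \<comment> \<open>Raising the exponent of \<open>1 - x\<close> from \<open>m\<close> to
    \<open>b\<close> pairs it with each factor \<open>?G\<close>, so that \<open>G(2)\<close> and
    Bernoulli's inequality apply.\<close>
  have "1 - b * (x + x\<^sup>2) \<le> (1 - (x + x\<^sup>2)) ^ b"
  proof -
    have "1 + real b * - (x + x\<^sup>2) \<le> (1 + - (x + x\<^sup>2)) ^ b"
      using xx by (intro Bernoulli_inequality) simp
    then show ?thesis by (simp only: mult_minus_right diff_conv_add_uminus)
  qed
  also have "\<dots> \<le> (?G * (1 - x)) ^ b" using G(2) xx by (intro power_mono) auto
  also have "\<dots> = ?G ^ b * (1 - x) ^ b" by (simp add: power_mult_distrib)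
  also have "\<dots> \<le> ?G ^ b * (1 - x) ^ m"
    using x G0 by (intro mult_left_mono power_decreasing) (auto simp: m)
  finally have "b * x * (1 - b * (x + x\<^sup>2)) \<le> a" unfolding eq by (intro mult_left_mono bx)
  then show "a \<ge> b / Q * (1 - b * (1 / Q + 1 / Q\<^sup>2))" by (simp add: x_def power_one_over)
qed

text \<open>The first bound uses \<open>b * N \<le> q ^ b\<close> in the form
  \<open>N * t \<le> 1\<close> with \<open>t = b / q ^ b\<close>. For the second the short orbits
  cost the relative loss \<open>u = 2 / r\<close>, at most \<open>b / r\<close> as
  \<open>b \<ge> 2\<close>, and the lower bound on \<open>a\<close> costs \<open>v\<close>.\<close>

lemma limit_value_bounds:
  fixes q b N :: nat and a :: real
  assumes q: "q \<ge> 2" and b: "b \<ge> 2"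
    and N: "b * N \<le> q ^ b" "q ^ b \<le> b * N + 2 * q ^ (b div 2)"
    and a: "0 \<le> a" "a \<le> b / real q ^ b"
      "a \<ge> b / real q ^ b * (1 - b * (1 / real q ^ b + 1 / (real q ^ b)\<^sup>2))"
  defines "r \<equiv> real q powr (real b / 2)"
  shows "exp (-1) - (1 - a) ^ N \<le> exp (-1) * (b / real q ^ b + 2 * (b / real q ^ b)\<^sup>2)" (is ?upper)
    and "exp (-1) - (1 - a) ^ N > - (exp (-1) * (4 * b / r))" (is ?lower)
    and "r\<^sup>2 = real q ^ b" "r \<ge> 2" "b / real q ^ b \<le> 1/2"
proof -
  let ?Q = "real q ^ b"
  define t where "t = b / ?Q"
  have rpos: "r > 0" using q by (simp add: r_def)
  have "r\<^sup>2 = real q powr (real b / 2 + real b / 2)" unfolding r_def power2_eq_square powr_add ..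
  then show r2: "r\<^sup>2 = ?Q" using q by (simp add: powr_realpow)
  have "real (2 * b) \<le> real (q ^ b)" using two_mult_le_power[OF b q] by (simp only: of_nat_le_iff)
  then have Qb: "2 * real b \<le> ?Q" by (simp only: of_nat_mult of_nat_power of_nat_numeral)
  have "4 \<le> 2 * real b" using b by simp
  then have "4 \<le> r\<^sup>2" unfolding r2 using Qb by (rule order_trans)
  then show r_ge: "r \<ge> 2" using rpos power2_le_imp_le[of 2 r] by simp
  have Qpos: "?Q > 0" using q by simp
  show t_half: "b / ?Q \<le> 1/2" using Qb Qpos by (simp add: divide_le_eq)
  have "real (b * N) \<le> real (q ^ b)" using N(1) by (simp only: of_nat_le_iff)
  then have bN: "real b * real N \<le> ?Q" by (simp only: of_nat_mult of_nat_power)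
  have "real (q ^ b) \<le> real (b * N + 2 * q ^ (b div 2))" using N(2) by (simp only: of_nat_le_iff)
  then have bN': "?Q \<le> real b * real N + 2 * real q ^ (b div 2)"
    by (simp only: of_nat_mult of_nat_power of_nat_add of_nat_numeral)
  have "(1 - a) ^ N \<ge> exp (-1) * (1 - t - 2 * t\<^sup>2)"
  proof (rule one_minus_power_ge)
    show "real N * t \<le> 1" using bN Qpos by (simp add: t_def divide_le_eq mult.commute)
  qed (use a t_half in \<open>auto simp: t_def\<close>)
  then show ?upper unfolding t_def by (simp add: algebra_simps)
  have "(1 - a) ^ N < exp (-1) * (1 + 4 * (b / r))"
  proof (rule one_minus_power_less[where u = "2 / r" and v = "b * (1 / ?Q + 1 / ?Q\<^sup>2)"])
    show "0 \<le> a" by (rule a(1))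
    show "a \<le> 1" using order_trans[OF a(2) t_half] by simp
    show "2 / r \<le> b / r" using b rpos by (intro divide_right_mono) auto
    show "0 < b / r" "0 \<le> 2 / r" using b rpos by auto
    show "0 \<le> b * (1 / ?Q + 1 / ?Q\<^sup>2)" using Qpos by simp
    show "b * (1 / ?Q + 1 / ?Q\<^sup>2) \<le> 5/8 * (b / r)"
    proof -
      \<comment> \<open>The constant 5/8 is \<open>1/2 + 1/8\<close>: for
        \<open>s \<le> 1/2\<close>, \<open>s ^ 2\<close> is at most \<open>s / 2\<close> and
        \<open>s ^ 4\<close> at most \<open>s / 8\<close>.\<close>
      define s where "s = 1 / r"
      have s: "0 < s" "s \<le> 1/2" using r_ge by (auto simp: s_def field_simps)
      have "s * s \<le> 1/2 * s" using s by (intro mult_right_mono) auto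
      moreover have "s ^ 3 * s \<le> (1/2) ^ 3 * s" using s by (intro mult_right_mono power_mono) auto
      ultimately have "s\<^sup>2 + s ^ 4 \<le> 5/8 * s" by (simp add: power2_eq_square eval_nat_numeral)
      then have "b * (s\<^sup>2 + s ^ 4) \<le> b * (5/8 * s)" by (intro mult_left_mono) auto
      moreover have "1 / ?Q = s\<^sup>2" "1 / ?Q\<^sup>2 = s ^ 4"
        unfolding r2[symmetric] by (simp_all add: s_def power_one_over)
      ultimately show ?thesis by (simp add: s_def)
    qed
    \<comment> \<open>This keeps the factor \<open>1 - v\<close> nonnegative when the inequality for
      the orbits is multiplied by it.\<close>
    assume v1: "b * (1 / ?Q + 1 / ?Q\<^sup>2) \<le> 1"
    have "real q ^ (b div 2) = real q powr real (b div 2)" using q by (simp add: powr_realpow)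
    also have "\<dots> \<le> r" unfolding r_def using q by (intro powr_mono) auto
    finally have "?Q - 2 * r \<le> real b * real N" using bN' by simp
    then have "(?Q - 2 * r) / ?Q \<le> real b * real N / ?Q" using Qpos by (intro divide_right_mono) auto
    moreover have "(?Q - 2 * r) / ?Q = 1 - 2 / r"
      unfolding r2[symmetric] using rpos by (simp add: field_simps power2_eq_square)
    ultimately have "(1 - 2 / r) * (1 - b * (1 / ?Q + 1 / ?Q\<^sup>2)) \<le>
        (real b * real N / ?Q) * (1 - b * (1 / ?Q + 1 / ?Q\<^sup>2))"
      using v1 by (intro mult_right_mono) auto
    also have "\<dots> = b / ?Q * (1 - b * (1 / ?Q + 1 / ?Q\<^sup>2)) * real N" by simp
    also have "\<dots> \<le> a * real N" using a(3) by (intro mult_right_mono) auto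
    finally show "(1 - 2 / r) * (1 - b * (1 / ?Q + 1 / ?Q\<^sup>2)) \<le> a * real N" .
  qed
  then show ?lower by (simp add: algebra_simps)
qed

theorem proposition5p5:
  fixes h :: "'f::{field,finite} \<Rightarrow> 'k::{field,finite}" and q b :: nat
  assumes "field_hom h"
    and "card (UNIV :: 'f set) = q" and "card (UNIV :: 'k set) = q ^ b" and "b \<ge> 2"
  shows "convergent (\<lambda>c. pcb_proportion h b c) \<and>
    - (4 * real b / (exp 1 * real q powr (real b / 2))) < P_M h b - (1 - exp (-1)) \<and>
    P_M h b - (1 - exp (-1)) <
      (1 + real b) / (exp 1 * real q ^ b) + 2 * (1 + real b)^2 / (exp 1 * real q ^ (2 * b)) \<and>
    \<bar>P_M h b - (1 - exp (-1))\<bar> < 4 * exp (-1) * real b * real q powr (- real b / 2)"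
proof -
  interpret field_hom h by fact
  interpret finite_field_ext h q b using assms by unfold_locales
  let ?Q = "real q ^ b" and ?N = "card full_orbits"
  define a where "a = b * (suminf (euler_coeff' ?Q) * suminf (euler_coeff ?Q) ^ (b - 1))"
  define r where "r = real q powr (real b / 2)"
  have lim: "pcb_proportion h b \<longlonglongrightarrow> 1 - (1 - a) ^ ?N"
    using pcb_proportion_tendsto unfolding a_def of_nat_power .
  then have conv: "convergent (\<lambda>c. pcb_proportion h b c)" by (auto simp: convergent_def)
  have P: "P_M h b - (1 - exp (-1)) = exp (-1) - (1 - a) ^ ?N"
    unfolding P_M_def using limI[OF lim] by simp
  have "real 2 \<le> real (q ^ b)"
    using card_field_ge_2[where 'k = 'k] unfolding card_ext by (simp only: of_nat_le_iff)
  then have "?Q \<ge> 2" by (simp only: of_nat_power of_nat_numeral)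
  note a = simple_root_probability_bounds[OF this assms(4), folded a_def]
  note bounds = limit_value_bounds[OF q_ge_2 assms(4) card_full_orbits a(3) a(1) a(2), folded r_def]
  let ?t = "b / ?Q"
  have b0: "real b > 0" using assms(4) by simp
  have r: "r > 0" "r \<ge> 2" using bounds(4) by auto
  have Q: "?Q > 0" using q_ge_2 by simp
  \<comment> \<open>The estimate holds weakly with \<open>b\<close>; enlarging \<open>b\<close> to
    \<open>1 + b\<close> makes it strict.\<close>
  have upper: "exp (-1) * (?t + 2 * ?t\<^sup>2) <
      (1 + real b) / (exp 1 * ?Q) + 2 * (1 + real b)^2 / (exp 1 * real q ^ (2 * b))"
  proof -
    have "?t < (1 + real b) / ?Q" using Q by (intro divide_strict_right_mono) auto
    moreover have "?t\<^sup>2 \<le> ((1 + real b) / ?Q)\<^sup>2"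
      using Q by (intro power_mono divide_right_mono) auto
    ultimately have "exp (-1) * (?t + 2 * ?t\<^sup>2) < exp (-1) * ((1 + real b) / ?Q + 2 * ((1 + real b) / ?Q)\<^sup>2)"
      by (intro mult_strict_left_mono add_less_le_mono mult_left_mono) simp_all
    also have "\<dots> = (1 + real b) / (exp 1 * ?Q) + 2 * (1 + real b)^2 / (exp 1 * real q ^ (2 * b))"
      using Q by (simp add: exp_minus power_divide mult.commute[of 2 b] power_mult field_simps)
    finally show ?thesis .
  qed
  \<comment> \<open>For \<open>t = b / r\<^sup>2 \<le> 1/2\<close> the sum
    \<open>t + 2 * t\<^sup>2\<close> is at most \<open>2 * t\<close>, and \<open>1 / r < 2\<close>
    compares this with \<open>4 * b / r\<close>.\<close>
  have upper': "exp (-1) * (?t + 2 * ?t\<^sup>2) < exp (-1) * (4 * b / r)"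
  proof -
    have "?t * ?t \<le> 1/2 * ?t" using bounds(5) b0 Q by (intro mult_right_mono) auto
    then have "?t + 2 * ?t\<^sup>2 \<le> 2 * ?t" by (simp add: power2_eq_square)
    also have "2 * ?t = 2 * (b / r * (1 / r))" unfolding bounds(3)[symmetric] by (simp add: power2_eq_square)
    also have "2 * (b / r * (1 / r)) < 2 * (b / r * 2)"
      using b0 r by (intro mult_strict_left_mono) (auto simp: field_simps)
    finally have "?t + 2 * ?t\<^sup>2 < 4 * b / r" by simp
    then show ?thesis by (rule mult_strict_left_mono) simp
  qed
  have e1: "4 * real b / (exp 1 * r) = exp (-1) * (4 * b / r)"
    using r by (simp add: exp_minus field_simps)
  have e2: "4 * exp (-1) * real b * real q powr (- real b / 2) = exp (-1) * (4 * b / r)"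
    using q_ge_2 by (simp add: r_def powr_minus field_simps)
  show ?thesis
    unfolding P e2 r_def[symmetric] e1
    using conv bounds(1,2) upper upper' by (auto simp: abs_less_iff)
qed

end
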